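(* Let $\psi:\mathbb R\to\mathbb R$ be a non-decreasing function such that $-\log(1-x+x^2/2)\leq \psi(x)\leq \log(1+x+x^2/2)$ for all $x\in\mathbb R$. Let $Y_1,\ldots,Y_n$ be i.i.d. copies of a self-adjoint random matrix $Y\in\mathbb C^{d\times d}$ with finite second moments of entries, let $\sigma^2=\|\mathbb EY^2\|$, $\sigma_0^2=\|\mathbb E(Y-\mathbb EY)^2\|$, and let $\sigma_{\min},\sigma_{\max},\sigma_{0,\min},\sigma_{0,\max}$ be known positive constants with $\sigma_{\min}\leq\sigma\leq\sigma_{\max}$ and $\sigma_{0,\min}\leq\sigma_0\leq\sigma_{0,\max}$. Fix $t>0$ and an integer $m$ with $m\geq\lfloor n/2\rfloor$ and $n-m\geq\lfloor n/2\rfloor$; let $G_1=(Y_1,\ldots,Y_m)$ and $G_2=(Y_{m+1},\ldots,Y_n)$. Let $\sigma_j = 2^j\sigma_{\min}$, $\mathcal J_1=\{ j\in \mathbb Z: \sigma_{\min} \leq \sigma_j < 2\sigma_{\max} \}$, $\sigma_{0,j} = 2^j\sigma_{0,\min}$, $\mathcal J_2=\{ j\in \mathbb Z: \sigma_{0,\min} \leq \sigma_{0,j} < 2( \sigma_{0,\max} + 12\sigma_{\max}\sqrt{t/n}) \}$, $\theta_j=\sqrt{\frac{2t}{n/2}}\frac{1}{\sigma_j}$, $\theta_{0,j}=\sqrt{\frac{2t}{n/2}}\frac{1}{\sigma_{0,j}}$. For self-adjoint $S$ define \[ T^{(1)}_{j}(S)=\frac{1}{m\theta_j}\sum_{i=1}^{m}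 \psi(\theta_j (Y_i - S)),\qquad T^{(2)}_{j}(S)=\frac{1}{(n-m)\theta_{0,j}}\sum_{i=m+1}^{n} \psi(\theta_{0,j} (Y_i - S)). \] Let $j_1^\ast=\min\{ j\in \mathcal J_1: \forall k\in \mathcal J_1,\ k>j \Rightarrow \| T^{(1)}_{k}(0) - T^{(1)}_{j}(0) \|\leq 2\sigma_k \sqrt{2t/m} \}$, $\hat T_0=T^{(1)}_{j_1^\ast}(0)$, $j_2^\ast=\min\{ j\in \mathcal J_2: \forall k\in \mathcal J_2,\ k>j \Rightarrow \| T^{(2)}_{k}(\hat T_0) - T^{(2)}_{j}(\hat T_0) \|\leq 2\sigma_{0,k} \sqrt{2t/(n-m)} \}$, and $\hat T_1=\hat T_0 + T^{(2)}_{j_2^\ast}(\hat T_0)$. Then with probability at least \[ 1- 2d\Big(2+ \log_2\Big( \frac{\sigma_{\max}}{\sigma_{\min}}\Big) + \log_2\Big(\frac{\sigma_{0,\max}+12\sigma_{\max}\sqrt{t/n}}{\sigma_{0,\min}}\Big) \Big)e^{-t}, \] \[ \big\| \hat T_1 -\mathbb EY \big\| \leq 12\Big(\sigma_0 + 12\sigma\sqrt{\frac t n} \Big)\sqrt{\frac{t}{n}}. \]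
   Context: $\|\cdot\|$ is the operator norm. For a real function $f$ and a self-adjoint matrix $A=U\,\mathrm{diag}(\lambda_i)\,U^\ast$, $f(A):=U\,\mathrm{diag}(f(\lambda_i))\,U^\ast$. Expectations are entrywise. *)

theory Defs
  imports "HOL-Analysis.Analysis" "HOL-Probability.Probability"
begin

definition adjoint_mat :: "complex^'n^'n \<Rightarrow> complex^'n^'n" where
  "adjoint_mat A = (\<chi> i j. cnj (A $ j $ i))"

definition hermitian :: "complex^'n^'n \<Rightarrow> bool" where
  "hermitian A \<longleftrightarrow> adjoint_mat A = A"

definition unitary_mat :: "complex^'n^'n \<Rightarrow> bool" where
  "unitary_mat U \<longleftrightarrow> U ** adjoint_mat U = mat 1 \<and> adjoint_mat U ** U = mat 1"

definition diag_mat :: "('n \<Rightarrow> complex) \<Rightarrow> complex^'n^'n" where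
  "diag_mat l = (\<chi> i j. if i = j then l i else 0)"

definition mat_fun :: "(real \<Rightarrow> real) \<Rightarrow> complex^'n^'n \<Rightarrow> complex^'n^'n" where
  "mat_fun f A = (SOME B. \<exists>U (l :: 'n \<Rightarrow> real). unitary_mat U \<and>
       A = U ** diag_mat (\<lambda>i. complex_of_real (l i)) ** adjoint_mat U \<and>
       B = U ** diag_mat (\<lambda>i. complex_of_real (f (l i))) ** adjoint_mat U)"

definition opnorm :: "complex^'n^'n \<Rightarrow> real" where
  "opnorm A = onorm (\<lambda>x :: complex^'n. A *v x)"

definition mat_expect :: "'a measure \<Rightarrow> ('a \<Rightarrow> complex^'n^'n) \<Rightarrow> complex^'n^'n" where
  "mat_expect M X = (\<chi> i j. integral\<^sup>L M (\<lambda>\<omega>. X \<omega> $ i $ j))"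

end

theory Submission
  imports Defs
begin

text \<open>
  For i.i.d. summands Lieb's concavity theorem can be replaced by two elementary trace inequalities.
  Write \<open>Z = \<theta> (Y - S)\<close>, \<open>X = \<psi> Z\<close>, \<open>C = E Z\<close>, and let \<open>w\<close> bound \<open>E Z\<^sup>2 / 2\<close>. Golden--Thompson gives
  \<open>tr exp (A - C + X) \<le> tr (exp (A - C) exp X) \<le> tr (exp (A - C) (1 + Z + Z\<^sup>2 / 2))\<close>; taking the expectation over
  the fresh summand leaves \<open>tr (exp (A - C) (1 + C + w))\<close>, which is at most \<open>exp w tr (exp A)\<close> by Klein's
  inequality. Hence the centred sum has trace exponential moment at most \<open>d exp (m w)\<close>, with no loss in the constants.

  Since \<open>m\<close> may differ from \<open>n / 2\<close>, the deviation level \<open>\<sigma>\<^sub>j sqrt (2 t / m)\<close> is not guaranteed with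
  failure probability \<open>2 d exp (- t)\<close> at every grid point. Instead the oracle index of Lepski's method is chosen with
  \<open>\<tau> / \<sigma>\<^sub>j\<close> in \<open>[0.65, 1.3]\<close>. There the Lepski thresholds and the target radius both allow deviation levels
  with failure probability \<open>2 d exp (- 3 t / 2)\<close>; as the claim is void unless \<open>exp (- t) < 1 / 4\<close>, the extra factor
  \<open>exp (- t / 2)\<close> pays for the union over both grids. The second stage is conditioned on the
  first one, whose estimate is measurable because \<open>\<psi>\<close> is Borel.
\<close>

section \<open>Spectral decomposition of Hermitian matrices\<close>

text \<open>The truncation levels are built from n / 2, the Lepski thresholds from the actual group
  sizes. With u = sqrt (4 t / n) and c^2 = n / (2 m) the thresholds are 2 sigma_k u c. At truncation
  u / sigma_j a deviation level s fails with probability at most 2 d exp (m u^2 (tau / sigma_j)^2 /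
  2 - m u s / sigma_j). Prescribing the exponent - 3 t / 2 gives the level e_j = sigma_j u (3 c^2 /
  2 + (tau / sigma_j)^2) / 2 used at every grid point. The target radius of a stage is 6 tau u = 12
  tau sqrt (t / n). Recentring at an estimate with error at most R1 = 12 sigma sqrt (t / n) raises
  the variance to at most sigma0^2 + R1^2 <= (sigma0 + R1)^2, hence tau = sigma0 + R1 in the second
  stage. Golden--Thompson rests on |tr M^(2 N)| <= tr (M M')^N, with M' the adjoint and N a power of
  two, and on the Lie--Trotter limit along powers of two. Since \<psi> is only monotone it may jump,
  so its matrix version need not be continuous. Measurability comes from pointwise approximation,
  which suffices because a matrix has finitely many eigenvalues.\<close>

definition cinner :: "complex^'n \<Rightarrow> complex^'n \<Rightarrow> complex" where
  "cinner x y = (\<Sum>i\<in>UNIV. cnj (x $ i) * y $ i)"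

text \<open>The real product \<open>inner\<close> suffices for quadratic forms and norms, while
  orthonormality over the complex numbers needs the full form \<open>cinner\<close>,
  conjugate-linear in its first argument.\<close>

lemma Re_cinner: "Re (cinner x y) = inner x y"
  by (simp add: cinner_def inner_vec_def inner_complex_def)

lemma cinner_commute: "cinner y x = cnj (cinner x y)"
  by (simp add: cinner_def mult.commute)

lemma cinner_self: "cinner x x = complex_of_real ((norm x)\<^sup>2)"
proof -
  have "Im (cinner x x) = 0"
    by (simp add: cinner_def)
  moreover have "Re (cinner x x) = (norm x)\<^sup>2"
    by (simp add: Re_cinner power2_norm_eq_inner)
  ultimately show ?thesis by (simp add: complex_eq_iff)
qed

lemma cinner_adjoint: "cinner x (A *v y) = cinner (adjoint_mat A *v x) y"
proof -
  have "cinner x (A *v y) = (\<Sum>i\<in>UNIV. \<Sum>j\<in>UNIV. cnj (x $ i) * (A $ i $ j * y $ j))"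
    by (simp add: cinner_def matrix_vector_mult_def sum_distrib_left)
  also have "\<dots> = (\<Sum>j\<in>UNIV. \<Sum>i\<in>UNIV. cnj (x $ i) * (A $ i $ j * y $ j))"
    by (rule sum.swap)
  also have "\<dots> = cinner (adjoint_mat A *v x) y"
    by (simp add: cinner_def matrix_vector_mult_def sum_distrib_left sum_distrib_right adjoint_mat_def mult_ac)
  finally show ?thesis .
qed

lemma inner_adjoint: "inner x (A *v y) = inner (adjoint_mat A *v x) y"
  for x y :: "complex^'n"
  by (metis Re_cinner cinner_adjoint)

lemma inner_hermitian: "hermitian A \<Longrightarrow> inner x (A *v y) = inner (A *v x) y"
  by (simp add: inner_adjoint hermitian_def)

section \<open>Algebra of adjoints and closure properties of Hermitian matrices\<close>

lemma adjoint_mat_component [simp]: "adjoint_mat A $ i $ j = cnj (A $ j $ i)"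
  by (simp add: adjoint_mat_def)

lemma adjoint_mat_mult: "adjoint_mat (A ** B) = adjoint_mat B ** adjoint_mat A"
  by (simp add: vec_eq_iff matrix_matrix_mult_def mult.commute)

lemma adjoint_mat_adjoint_mat [simp]: "adjoint_mat (adjoint_mat A) = A"
  by (simp add: vec_eq_iff)

lemma adjoint_mat_add: "adjoint_mat (A + B) = adjoint_mat A + adjoint_mat B"
  by (simp add: vec_eq_iff)

lemma adjoint_mat_diff: "adjoint_mat (A - B) = adjoint_mat A - adjoint_mat B"
  by (simp add: vec_eq_iff)

lemma adjoint_mat_uminus: "adjoint_mat (- A) = - adjoint_mat A"
  by (simp add: vec_eq_iff)

lemma adjoint_mat_scaleR: "adjoint_mat (r *\<^sub>R A) = r *\<^sub>R adjoint_mat A"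
  by (simp add: vec_eq_iff)

lemma adjoint_mat_zero: "adjoint_mat 0 = 0"
  by (simp add: vec_eq_iff)

lemma adjoint_mat_one: "adjoint_mat (mat 1) = mat 1"
  by (simp add: vec_eq_iff mat_def)

lemma adjoint_diag_mat: "adjoint_mat (diag_mat (\<lambda>i. complex_of_real (l i))) = diag_mat (\<lambda>i. complex_of_real (l i))"
  by (simp add: vec_eq_iff diag_mat_def)

lemma hermitian_add: "hermitian A \<Longrightarrow> hermitian B \<Longrightarrow> hermitian (A + B)"
  by (simp add: hermitian_def adjoint_mat_add)

lemma hermitian_diff: "hermitian A \<Longrightarrow> hermitian B \<Longrightarrow> hermitian (A - B)"
  by (simp add: hermitian_def adjoint_mat_diff)

lemma hermitian_uminus: "hermitian A \<Longrightarrow> hermitian (- A)"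
  by (simp add: hermitian_def adjoint_mat_uminus)

lemma hermitian_scaleR: "hermitian A \<Longrightarrow> hermitian (r *\<^sub>R A)"
  by (simp add: hermitian_def adjoint_mat_scaleR)

lemma hermitian_zero: "hermitian 0"
  by (simp add: hermitian_def adjoint_mat_zero)

lemma hermitian_one: "hermitian (mat 1)"
  by (simp add: hermitian_def adjoint_mat_one)

lemma hermitian_square: "hermitian A \<Longrightarrow> hermitian (A ** A)"
  by (simp add: hermitian_def adjoint_mat_mult)

lemma hermitian_sum: "(\<And>i. i \<in> I \<Longrightarrow> hermitian (f i)) \<Longrightarrow> hermitian (sum f I)"
  by (induction I rule: infinite_finite_induct) (auto intro: hermitian_add hermitian_zero)

lemmas hermitian_intros = hermitian_add hermitian_diff hermitian_uminus hermitian_scaleR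
  hermitian_zero hermitian_one hermitian_square hermitian_sum

lemma complex_mat_vec_scaleR: "A *v (r *\<^sub>R x) = r *\<^sub>R (A *v x)" for A :: "complex^'n^'m"
  by (simp add: linear_cmul)

text \<open>The first-order condition for a minimum at 0. If \<open>b\<close> were nonzero, the step
  \<open>- b / c\<close> with \<open>c\<close> larger than both 0 and \<open>a\<close> would make
  the quadratic negative.\<close>

lemma quadratic_nonneg_imp_linear_zero:
  fixes a b :: real
  assumes "\<And>s. 0 \<le> 2 * s * b + s\<^sup>2 * a"
  shows "b = 0"
proof (rule ccontr)
  assume b: "b \<noteq> 0"
  define c where "c = \<bar>a\<bar> + 1"
  have c: "c > 0" "a < c" by (auto simp: c_def)
  have "0 \<le> 2 * (- b / c) * b + (- b / c)\<^sup>2 * a" by (rule assms)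
  also have "\<dots> = (b\<^sup>2 / c) * (a / c - 2)"
    using c by (simp add: field_simps power2_eq_square)
  also have "\<dots> < 0"
    using b c by (intro mult_pos_neg) (auto simp: field_simps)
  finally show False by simp
qed

text \<open>The eigenvector is a maximiser of the quadratic form on the unit sphere of the subspace.\<close>
lemma eigenvector_in_invariant_subspace:
  fixes A :: "complex^'n^'n"
  assumes A: "hermitian A"
    and S: "subspace S" "\<And>x. x \<in> S \<Longrightarrow> A *v x \<in> S" "\<exists>x\<in>S. x \<noteq> 0"
  shows "\<exists>x\<in>S. \<exists>l::real. norm x = 1 \<and> A *v x = l *\<^sub>R x"
proof -
  let ?K = "S \<inter> sphere 0 1"
  have K: "compact ?K"
    by (metis S(1) closed_subspace compact_sphere closed_Int_compact)
  obtain x0 where x0: "x0 \<in> S" "x0 \<noteq> 0" using S by blast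
  then have "(1 / norm x0) *\<^sub>R x0 \<in> ?K"
    using S(1) by (auto simp: subspace_def)
  then have ne: "?K \<noteq> {}" by blast
  have cont: "continuous_on ?K (\<lambda>x. inner x (A *v x))"
    by (intro continuous_intros linear_continuous_on matrix_vector_mul_bounded_linear)
  obtain x where x: "x \<in> ?K" and max: "\<And>y. y \<in> ?K \<Longrightarrow> inner y (A *v y) \<le> inner x (A *v x)"
    using continuous_attains_sup[OF K ne cont] by blast
  define l where "l = inner x (A *v x)"
  \<comment> \<open>On \<open>S\<close> the form of \<open>l - A\<close> is nonnegative and vanishes
    at the maximiser \<open>x\<close>. Its first variation at \<open>x\<close> is therefore zero, so
    \<open>B x\<close> is orthogonal to \<open>S\<close>; as it also lies in \<open>S\<close>, it is
    zero.\<close>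
  define B where "B = (\<lambda>y. l *\<^sub>R y - A *v y)"
  have nx: "norm x = 1" "x \<in> S" using x by auto
  have Bpos: "0 \<le> inner y (B y)" if "y \<in> S" for y
  proof (cases "y = 0")
    case False
    let ?z = "(1 / norm y) *\<^sub>R y"
    have "?z \<in> ?K" using False that S(1) by (auto simp: subspace_def)
    then have "inner ?z (A *v ?z) \<le> l" unfolding l_def by (rule max)
    then have "inner y (A *v y) / (norm y)\<^sup>2 \<le> l"
      by (simp add: complex_mat_vec_scaleR power2_eq_square)
    then have "inner y (A *v y) \<le> l * (norm y)\<^sup>2"
      using False by (simp add: field_simps)
    then show ?thesis
      by (simp add: B_def inner_diff_right power2_norm_eq_inner)
  qed (simp add: B_def)
  have Bx: "inner x (B x) = 0"
    using nx by (simp add: B_def inner_diff_right l_def) (simp add: norm_eq_1)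
  have Bsym: "inner y (B z) = inner z (B y)" for y z
    using inner_hermitian[OF A, of y z] by (simp add: B_def inner_diff_right inner_commute)
  have Badd: "B (x + s *\<^sub>R z) = B x + s *\<^sub>R B z" for s z
    by (simp add: B_def matrix_vector_right_distrib complex_mat_vec_scaleR algebra_simps)
  have orth: "inner z (B x) = 0" if z: "z \<in> S" for z
  proof (rule quadratic_nonneg_imp_linear_zero)
    fix s :: real
    have "x + s *\<^sub>R z \<in> S" using z nx S(1) by (auto simp: subspace_def)
    from Bpos[OF this]
    show "0 \<le> 2 * s * inner z (B x) + s\<^sup>2 * inner z (B z)"
      unfolding Badd using Bx Bsym[of x z]
      by (simp add: inner_add_left inner_add_right power2_eq_square algebra_simps)
  qed
  have "B x \<in> S" unfolding B_def using nx S by (simp add: subspace_diff subspace_scale)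
  then have "B x = 0" using orth by (metis inner_eq_zero_iff)
  then show ?thesis using nx unfolding B_def by (metis eq_iff_diff_eq_0)
qed

text \<open>Each new eigenvector is taken in the orthogonal complement of the earlier ones, which is
  invariant because \<open>A\<close> is Hermitian. Indexing by subsets of \<open>'n\<close> leaves a
  free index \<open>k\<close> at every step, which shows that the complement is nonzero.\<close>

lemma orthonormal_eigenvectors:
  fixes A :: "complex^'n^'n"
  assumes A: "hermitian A" and "finite I"
  shows "\<exists>(u :: 'n \<Rightarrow> complex^'n) (l :: 'n \<Rightarrow> real).
    (\<forall>i\<in>I. A *v u i = l i *\<^sub>R u i) \<and> (\<forall>i\<in>I. \<forall>j\<in>I. cinner (u i) (u j) = (if i = j then 1 else 0))"
  using \<open>finite I\<close>
proof (induction I)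
  case empty
  then show ?case by simp
next
  case (insert k I)
  then obtain u :: "'n \<Rightarrow> complex^'n" and l :: "'n \<Rightarrow> real" where
    u: "\<And>i. i \<in> I \<Longrightarrow> A *v u i = l i *\<^sub>R u i"
    and o: "\<And>i j. i \<in> I \<Longrightarrow> j \<in> I \<Longrightarrow> cinner (u i) (u j) = (if i = j then 1 else 0)"
    by blast
  define S where "S = {x. \<forall>i\<in>I. cinner (u i) x = 0}"
  \<comment> \<open>The complement \<open>S\<close> is the kernel of this square matrix. Its row
    \<open>k\<close> is zero, so it is singular and the kernel contains a nonzero vector.\<close>
  define R where "R = (\<chi> i j. if i \<in> I then cnj (u i $ j) else 0)"
  have "row k R = 0" using insert by (simp add: row_def R_def vec_eq_iff)
  then have "det R = 0" by (rule det_zero_row)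
  then have "\<not> (\<exists>B. B ** R = mat 1)"
    by (metis invertible_det_nz invertible_left_inverse)
  then obtain x where x: "R *v x = 0" "x \<noteq> 0"
    unfolding matrix_left_invertible_ker by blast
  have "cinner (u i) x = 0" if "i \<in> I" for i
  proof -
    have "(R *v x) $ i = cinner (u i) x" using that by (simp add: R_def matrix_vector_mult_def cinner_def)
    then show ?thesis using x by simp
  qed
  then have 3: "\<exists>x\<in>S. x \<noteq> 0" using x by (auto simp: S_def)
  have 1: "subspace S"
    unfolding S_def subspace_def
    by (auto simp: cinner_def algebra_simps sum.distrib scaleR_conv_of_real[where 'a=complex])
       (simp add: mult.left_commute flip: sum_distrib_left)
  have 2: "A *v x \<in> S" if "x \<in> S" for x
  proof -
    have "cinner (u i) (A *v x) = of_real (l i) * cinner (u i) x" if "i \<in> I" for i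
    proof -
      have "cinner (u i) (A *v x) = cinner (l i *\<^sub>R u i) x"
        using A u[OF that] by (simp add: cinner_adjoint hermitian_def)
      then show ?thesis by (simp add: cinner_def scaleR_conv_of_real[where 'a=complex] sum_distrib_left mult_ac)
    qed
    then show ?thesis using that by (simp add: S_def)
  qed
  obtain v r where v: "v \<in> S" "norm v = 1" "A *v v = (r::real) *\<^sub>R v"
    using eigenvector_in_invariant_subspace[OF A 1 2 3] by blast
  have vo: "cinner (u i) v = 0" "cinner v (u i) = 0" if "i \<in> I" for i
    using v that by (auto simp: S_def cinner_commute[of v])
  have vv: "cinner v v = 1" using v by (simp add: cinner_self)
  let ?u = "u(k := v)" and ?l = "l(k := r)"
  have "A *v ?u i = ?l i *\<^sub>R ?u i" if "i \<in> insert k I" for i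
    using u v that insert(2) by auto
  moreover have "cinner (?u i) (?u j) = (if i = j then 1 else 0)"
    if "i \<in> insert k I" "j \<in> insert k I" for i j
    using o vo vv that insert(2) by auto
  ultimately show ?case by blast
qed

lemma spectral_decomposition:
  fixes A :: "complex^'n^'n"
  assumes A: "hermitian A"
  obtains U and l :: "'n \<Rightarrow> real" where "unitary_mat U"
    "A = U ** diag_mat (\<lambda>i. complex_of_real (l i)) ** adjoint_mat U"
proof -
  obtain u :: "'n \<Rightarrow> complex^'n" and l :: "'n \<Rightarrow> real" where
    u: "\<And>i. A *v u i = l i *\<^sub>R u i"
    and o: "\<And>i j. cinner (u i) (u j) = (if i = j then 1 else 0)"
    using orthonormal_eigenvectors[OF A, of UNIV] by auto
  define U where "U = (\<chi> i j. u j $ i)"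
  have U1: "adjoint_mat U ** U = mat 1"
    using o by (simp add: vec_eq_iff matrix_matrix_mult_def U_def mat_def cinner_def)
  then have U2: "U ** adjoint_mat U = mat 1"
    using matrix_left_right_inverse by blast
  have "(A ** U) $ i $ j = (U ** diag_mat (\<lambda>i. complex_of_real (l i))) $ i $ j" for i j
  proof -
    have "(A ** U) $ i $ j = (A *v u j) $ i"
      by (simp add: matrix_matrix_mult_def U_def matrix_vector_mult_def)
    also have "\<dots> = (U ** diag_mat (\<lambda>i. complex_of_real (l i))) $ i $ j"
      unfolding u by (simp add: matrix_matrix_mult_def U_def diag_mat_def if_distrib
          scaleR_conv_of_real[where 'a=complex] mult.commute cong: if_cong)
    finally show ?thesis .
  qed
  then have "A ** U = U ** diag_mat (\<lambda>i. complex_of_real (l i))" by (simp add: vec_eq_iff)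
  then have "A = U ** diag_mat (\<lambda>i. complex_of_real (l i)) ** adjoint_mat U"
    by (metis U2 matrix_mul_assoc matrix_mul_rid)
  then show thesis using that U1 U2 unitary_mat_def by blast
qed

section \<open>Functional calculus, operator norm and Klein's inequality\<close>

definition spec_mat :: "complex^'n^'n \<Rightarrow> ('n \<Rightarrow> real) \<Rightarrow> complex^'n^'n" where
  "spec_mat U l = U ** diag_mat (\<lambda>i. complex_of_real (l i)) ** adjoint_mat U"

lemma hermitian_spec_mat: "hermitian (spec_mat U l)"
  by (simp add: hermitian_def spec_mat_def adjoint_mat_mult adjoint_diag_mat matrix_mul_assoc)

lemma matrix_mult_scaleR_left: "(r *\<^sub>R A) ** B = r *\<^sub>R (A ** B)" for A B :: "complex^'n^'n"
  by (simp add: vec_eq_iff matrix_matrix_mult_def scaleR_sum_right)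

lemma matrix_mult_scaleR_right: "A ** (r *\<^sub>R B) = r *\<^sub>R (A ** B)" for A B :: "complex^'n^'n"
  by (simp add: vec_eq_iff matrix_matrix_mult_def scaleR_sum_right)

lemma matrix_mult_diff_left: "(A - B) ** C = A ** C - B ** C" for A B C :: "complex^'n^'n"
  by (simp add: vec_eq_iff matrix_matrix_mult_def left_diff_distrib sum_subtractf)

lemma matrix_mult_diff_right: "C ** (A - B) = C ** A - C ** B" for A B C :: "complex^'n^'n"
  by (simp add: vec_eq_iff matrix_matrix_mult_def right_diff_distrib sum_subtractf)

lemma matrix_mult_add_left: "(A + B) ** C = A ** C + B ** C" for A B C :: "complex^'n^'n"
  by (simp add: vec_eq_iff matrix_matrix_mult_def distrib_right sum.distrib)

lemma matrix_mult_uminus_left: "(- A) ** B = - (A ** B)" for A B :: "complex^'n^'n"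
  by (simp add: vec_eq_iff matrix_matrix_mult_def sum_negf)

lemma matrix_mult_uminus_right: "A ** (- B) = - (A ** B)" for A B :: "complex^'n^'n"
  by (simp add: vec_eq_iff matrix_matrix_mult_def sum_negf)

lemmas matrix_mult_linear = matrix_mult_scaleR_left matrix_mult_scaleR_right matrix_mult_diff_left
  matrix_mult_diff_right matrix_mult_add_left matrix_add_ldistrib matrix_mult_uminus_left
  matrix_mult_uminus_right

lemma mat_vec_scaleR_left: "(r *\<^sub>R A) *v x = r *\<^sub>R (A *v x)" for A :: "complex^'n^'n"
  by (simp add: vec_eq_iff matrix_vector_mult_def scaleR_sum_right)

lemma mat_vec_uminus_left: "(- A) *v x = - (A *v x)" for A :: "complex^'n^'n"
  by (simp add: vec_eq_iff matrix_vector_mult_def sum_negf)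

lemmas mat_vec_linear = mat_vec_scaleR_left mat_vec_uminus_left matrix_vector_mult_add_rdistrib
  matrix_vector_mult_diff_rdistrib

lemma diag_mat_mult: "(diag_mat l ** A) $ i $ j = l i * A $ i $ j"
  by (simp add: diag_mat_def matrix_matrix_mult_def if_distrib[of "\<lambda>x. x * _"] cong: if_cong)

lemma mult_diag_mat: "(A ** diag_mat l) $ i $ j = A $ i $ j * l j"
  by (simp add: diag_mat_def matrix_matrix_mult_def if_distrib cong: if_cong)

lemma diag_mat_vec: "(diag_mat l *v x) $ i = l i * x $ i"
  by (simp add: diag_mat_def matrix_vector_mult_def if_distrib[of "\<lambda>x. x * _"] cong: if_cong)

lemma unitary_cancel:
  assumes "unitary_mat U"
  shows "U ** (adjoint_mat U ** B) = B" "adjoint_mat U ** (U ** B) = B"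
    "U ** adjoint_mat U = mat 1" "adjoint_mat U ** U = mat 1"
  using assms by (simp_all add: unitary_mat_def matrix_mul_assoc)

lemma spec_mat_mult:
  assumes "unitary_mat U"
  shows "spec_mat U k ** spec_mat U l = spec_mat U (\<lambda>i. k i * l i)"
proof -
  have "diag_mat (\<lambda>i. complex_of_real (k i)) ** diag_mat (\<lambda>i. complex_of_real (l i))
      = diag_mat (\<lambda>i. complex_of_real (k i * l i))"
    by (simp add: vec_eq_iff diag_mat_mult) (simp add: diag_mat_def)
  moreover have "spec_mat U k ** spec_mat U l =
      U ** (diag_mat (\<lambda>i. complex_of_real (k i)) ** diag_mat (\<lambda>i. complex_of_real (l i))) ** adjoint_mat U"
    unfolding spec_mat_def by (simp add: unitary_cancel[OF assms] flip: matrix_mul_assoc)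
  ultimately show ?thesis by (simp add: spec_mat_def)
qed

lemma spec_mat_add: "spec_mat U k + spec_mat U l = spec_mat U (\<lambda>i. k i + l i)"
proof -
  have "diag_mat (\<lambda>i. complex_of_real (k i + l i)) =
      diag_mat (\<lambda>i. complex_of_real (k i)) + diag_mat (\<lambda>i. complex_of_real (l i))"
    by (simp add: vec_eq_iff diag_mat_def)
  then show ?thesis
    by (simp add: spec_mat_def matrix_mult_linear)
qed

lemma spec_mat_scaleR: "r *\<^sub>R spec_mat U l = spec_mat U (\<lambda>i. r * l i)"
proof -
  have "diag_mat (\<lambda>i. complex_of_real (r * l i)) = r *\<^sub>R diag_mat (\<lambda>i. complex_of_real (l i))"
    by (simp add: vec_eq_iff diag_mat_def scaleR_conv_of_real[where 'a=complex])
  then show ?thesis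
    by (simp add: spec_mat_def matrix_mult_linear)
qed

lemma spec_mat_const: "unitary_mat U \<Longrightarrow> spec_mat U (\<lambda>i. c) = c *\<^sub>R mat 1"
proof -
  assume U: "unitary_mat U"
  have "diag_mat (\<lambda>i::'a. complex_of_real 1) = mat 1"
    by (simp add: vec_eq_iff diag_mat_def mat_def)
  then have "spec_mat U (\<lambda>i. 1) = mat 1"
    using U by (simp add: spec_mat_def unitary_mat_def)
  moreover have "spec_mat U (\<lambda>i. c) = c *\<^sub>R spec_mat U (\<lambda>i. 1)"
    by (simp add: spec_mat_scaleR)
  ultimately show ?thesis by simp
qed

text \<open>If \<open>U D U\<^sup>* = V E V\<^sup>*\<close>, then \<open>W = V\<^sup>* U\<close> intertwines \<open>D\<close> and \<open>E\<close>; since a nonzero entry of \<open>W\<close>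
  forces equal eigenvalues, it also intertwines \<open>f D\<close> and \<open>f E\<close>.\<close>
lemma spec_mat_unique:
  assumes U: "unitary_mat U" and V: "unitary_mat V" and eq: "spec_mat U k = spec_mat V l"
  shows "spec_mat U (\<lambda>i. f (k i)) = spec_mat V (\<lambda>i. f (l i))"
proof -
  define W where "W = adjoint_mat V ** U"
  have *: "W ** diag_mat (\<lambda>i. complex_of_real (a i)) = diag_mat (\<lambda>i. complex_of_real (b i)) ** W
     \<longleftrightarrow> spec_mat U a = spec_mat V b" for a b
  proof
    assume "W ** diag_mat (\<lambda>i. complex_of_real (a i)) = diag_mat (\<lambda>i. complex_of_real (b i)) ** W"
    then have "V ** (W ** diag_mat (\<lambda>i. complex_of_real (a i))) ** adjoint_mat U
        = V ** (diag_mat (\<lambda>i. complex_of_real (b i)) ** W) ** adjoint_mat U" by simp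
    then show "spec_mat U a = spec_mat V b"
      unfolding W_def spec_mat_def
      by (simp add: unitary_cancel[OF U] unitary_cancel[OF V] flip: matrix_mul_assoc)
  next
    assume "spec_mat U a = spec_mat V b"
    then have "adjoint_mat V ** spec_mat U a ** U = adjoint_mat V ** spec_mat V b ** U" by simp
    then show "W ** diag_mat (\<lambda>i. complex_of_real (a i)) = diag_mat (\<lambda>i. complex_of_real (b i)) ** W"
      unfolding W_def spec_mat_def
      by (simp add: unitary_cancel[OF U] unitary_cancel[OF V] flip: matrix_mul_assoc)
  qed
  have "W $ i $ j * complex_of_real (k j) = complex_of_real (l i) * W $ i $ j" for i j
    using eq[folded *] by (simp add: vec_eq_iff diag_mat_mult mult_diag_mat)
  then have "W $ i $ j = 0 \<or> k j = l i" for i j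
    by (metis mult.commute mult_left_cancel of_real_eq_iff)
  then have "W $ i $ j * complex_of_real (f (k j)) = complex_of_real (f (l i)) * W $ i $ j" for i j
    by (metis mult.commute mult_zero_left)
  then show ?thesis
    unfolding *[symmetric] by (simp add: vec_eq_iff diag_mat_mult mult_diag_mat)
qed

text \<open>Makes the choice operator in \<open>mat_fun\<close> harmless: all diagonalisations of
  one matrix give the same result, so any of them may be used for computing.\<close>

lemma mat_fun_spec_mat:
  assumes "unitary_mat U"
  shows "mat_fun f (spec_mat U l) = spec_mat U (\<lambda>i. f (l i))"
proof -
  have "(\<exists>V k. unitary_mat V \<and> spec_mat U l = spec_mat V k \<and> B = spec_mat V (\<lambda>i. f (k i)))
      \<longleftrightarrow> B = spec_mat U (\<lambda>i. f (l i))" for B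
    using assms spec_mat_unique by metis
  then have "mat_fun f (spec_mat U l) = (SOME B. B = spec_mat U (\<lambda>i. f (l i)))"
    unfolding mat_fun_def spec_mat_def by presburger
  then show ?thesis by simp
qed

lemma hermitian_obtain_spec_mat:
  assumes "hermitian A"
  obtains U l where "unitary_mat U" "A = spec_mat U l"
  using spectral_decomposition[OF assms] by (metis spec_mat_def)

lemma hermitian_mat_fun: "hermitian A \<Longrightarrow> hermitian (mat_fun f A)"
  by (metis hermitian_obtain_spec_mat hermitian_spec_mat mat_fun_spec_mat)

lemma mat_fun_mult:
  "hermitian A \<Longrightarrow> mat_fun f A ** mat_fun g A = mat_fun (\<lambda>x. f x * g x) A"
  by (erule hermitian_obtain_spec_mat) (simp add: mat_fun_spec_mat spec_mat_mult)

lemma mat_fun_add: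
  "hermitian A \<Longrightarrow> mat_fun f A + mat_fun g A = mat_fun (\<lambda>x. f x + g x) A"
  by (erule hermitian_obtain_spec_mat) (simp add: mat_fun_spec_mat spec_mat_add)

lemma mat_fun_scaleR:
  "hermitian A \<Longrightarrow> r *\<^sub>R mat_fun f A = mat_fun (\<lambda>x. r * f x) A"
  by (erule hermitian_obtain_spec_mat) (simp add: mat_fun_spec_mat spec_mat_scaleR)

lemma mat_fun_const: "hermitian A \<Longrightarrow> mat_fun (\<lambda>x. c) A = c *\<^sub>R mat 1"
  by (erule hermitian_obtain_spec_mat) (simp add: mat_fun_spec_mat spec_mat_const)

lemma mat_fun_ident: "hermitian A \<Longrightarrow> mat_fun (\<lambda>x. x) A = A"
  by (erule hermitian_obtain_spec_mat) (simp add: mat_fun_spec_mat)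

lemma mat_fun_compose: "hermitian A \<Longrightarrow> mat_fun f (mat_fun g A) = mat_fun (\<lambda>x. f (g x)) A"
  by (erule hermitian_obtain_spec_mat) (simp add: mat_fun_spec_mat)

lemma mat_fun_scaleR_arg: "hermitian A \<Longrightarrow> mat_fun f (r *\<^sub>R A) = mat_fun (\<lambda>x. f (r * x)) A"
  using mat_fun_compose[of A f "\<lambda>x. r * x"] mat_fun_scaleR[of A r "\<lambda>x. x"]
  by (simp add: mat_fun_ident)

lemma mat_fun_uminus: "hermitian A \<Longrightarrow> mat_fun f (- A) = mat_fun (\<lambda>x. f (- x)) A"
  using mat_fun_scaleR_arg[of A f "-1"] by simp

lemma mat_fun_uminus_fun: "hermitian A \<Longrightarrow> - mat_fun f A = mat_fun (\<lambda>x. - f x) A"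
  using mat_fun_scaleR[of A "-1" f] by simp

lemma mat_fun_exp_add_const:
  assumes A: "hermitian A"
  shows "mat_fun exp (A + c *\<^sub>R mat 1) = exp c *\<^sub>R mat_fun exp A"
proof -
  have "A + c *\<^sub>R mat 1 = mat_fun (\<lambda>x. x + c) A"
    using A by (simp flip: mat_fun_add add: mat_fun_ident mat_fun_const)
  then show ?thesis using A by (simp add: mat_fun_compose mat_fun_scaleR exp_add mult.commute)
qed

lemma mat_fun_quadratic:
  assumes A: "hermitian A"
  shows "mat_fun (\<lambda>x. 1 + x + x\<^sup>2 / 2) A = mat 1 + A + (1/2) *\<^sub>R (A ** A)"
proof -
  have "mat 1 + A + (1/2) *\<^sub>R (A ** A)
     = mat_fun (\<lambda>x. 1) A + mat_fun (\<lambda>x. x) A + (1/2) *\<^sub>R (mat_fun (\<lambda>x. x) A ** mat_fun (\<lambda>x. x) A)"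
    using A by (simp add: mat_fun_ident mat_fun_const)
  also have "\<dots> = mat_fun (\<lambda>x. 1 + x + x\<^sup>2 / 2) A"
    using A by (simp only: mat_fun_add mat_fun_mult mat_fun_scaleR) (simp add: power2_eq_square)
  finally show ?thesis ..
qed

lemma norm_unitary: 
  assumes "unitary_mat U"
  shows "norm (adjoint_mat U *v x) = norm x"
proof -
  have "inner (adjoint_mat U *v x) (adjoint_mat U *v x) = inner x x"
    using assms by (subst inner_adjoint) (simp add: matrix_vector_mul_assoc unitary_mat_def)
  then show ?thesis by (simp add: norm_eq_sqrt_inner)
qed

lemma inner_spec_mat:
  "inner x (spec_mat U l *v x) = (\<Sum>i\<in>UNIV. l i * (cmod ((adjoint_mat U *v x) $ i))\<^sup>2)"
proof -
  have "inner x (spec_mat U l *v x)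
     = inner (adjoint_mat U *v x) (diag_mat (\<lambda>i. complex_of_real (l i)) *v (adjoint_mat U *v x))"
    unfolding spec_mat_def by (simp add: inner_adjoint flip: matrix_vector_mul_assoc)
  also have "\<dots> = (\<Sum>i\<in>UNIV. l i * (cmod ((adjoint_mat U *v x) $ i))\<^sup>2)"
    unfolding inner_vec_def
    by (intro sum.cong refl)
      (simp add: diag_mat_vec inner_complex_def cmod_power2 distrib_left, simp add: power2_eq_square)
  finally show ?thesis .
qed

lemma norm_power2_unitary:
  assumes "unitary_mat U"
  shows "(\<Sum>i\<in>UNIV. (cmod ((adjoint_mat U *v x) $ i))\<^sup>2) = (norm x)\<^sup>2"
  using inner_spec_mat[of x U "\<lambda>_. 1"] assms
  by (simp add: spec_mat_const power2_norm_eq_inner)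

text \<open>In an eigenbasis both forms are sums of nonnegative weights times values of
  \<open>f\<close> and \<open>g\<close>. The Loewner order is expressed throughout by such real
  quadratic forms.\<close>

lemma mat_fun_mono:
  assumes A: "hermitian A" and "\<And>x. f x \<le> g x"
  shows "inner x (mat_fun f A *v x) \<le> inner x (mat_fun g A *v x)"
proof -
  obtain U l where U: "unitary_mat U" "A = spec_mat U l" using A by (rule hermitian_obtain_spec_mat)
  show ?thesis
    unfolding U(2) mat_fun_spec_mat[OF U(1)] inner_spec_mat
    by (intro sum_mono mult_right_mono assms) simp
qed

lemma norm_spec_mat_le:
  assumes U: "unitary_mat U" and s: "\<And>i. \<bar>l i\<bar> \<le> s"
  shows "norm (spec_mat U l *v x) \<le> s * norm x"
proof -
  have s0: "0 \<le> s" using s[of undefined] by linarith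
  have "(norm (spec_mat U l *v x))\<^sup>2 = inner x (spec_mat U l *v (spec_mat U l *v x))"
    by (metis hermitian_spec_mat inner_hermitian power2_norm_eq_inner)
  also have "\<dots> = (\<Sum>i\<in>UNIV. (l i * l i) * (cmod ((adjoint_mat U *v x) $ i))\<^sup>2)"
    by (simp add: matrix_vector_mul_assoc spec_mat_mult[OF U] inner_spec_mat)
  also have "\<dots> \<le> (\<Sum>i\<in>UNIV. s\<^sup>2 * (cmod ((adjoint_mat U *v x) $ i))\<^sup>2)"
  proof (intro sum_mono mult_right_mono)
    show "l i * l i \<le> s\<^sup>2" for i
      using s[of i] abs_le_square_iff[of "l i" s] s0 by (simp add: power2_eq_square)
  qed simp
  also have "\<dots> = (s * norm x)\<^sup>2"
    using norm_power2_unitary[OF U] by (simp flip: sum_distrib_left add: power_mult_distrib)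
  finally show ?thesis by (rule power2_le_imp_le) (simp add: s0)
qed

section \<open>The operator norm\<close>

lemma bounded_linear_mat_vec: "bounded_linear (\<lambda>x :: complex^'n. A *v x)"
  by (simp add: linear_conv_bounded_linear[symmetric])

lemma norm_mat_vec_le_opnorm: "norm (A *v x) \<le> opnorm A * norm x"
  unfolding opnorm_def by (rule onorm[OF bounded_linear_mat_vec])

lemma opnorm_nonneg: "0 \<le> opnorm A"
  unfolding opnorm_def by (rule onorm_pos_le[OF bounded_linear_mat_vec])

lemma opnorm_le_iff: "0 \<le> s \<Longrightarrow> opnorm A \<le> s \<longleftrightarrow> (\<forall>x. norm (A *v x) \<le> s * norm x)"
  by (metis norm_mat_vec_le_opnorm onorm_bound opnorm_def mult_right_mono norm_ge_zero order_trans)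

lemma opnorm_leI: "(\<And>x. norm (A *v x) \<le> s * norm x) \<Longrightarrow> 0 \<le> s \<Longrightarrow> opnorm A \<le> s"
  by (simp add: opnorm_le_iff)

lemma abs_inner_le_opnorm: "\<bar>inner x (A *v x)\<bar> \<le> opnorm A * (norm x)\<^sup>2"
proof -
  have "\<bar>inner x (A *v x)\<bar> \<le> norm x * norm (A *v x)" by (rule Cauchy_Schwarz_ineq2)
  also have "\<dots> \<le> norm x * (opnorm A * norm x)"
    by (intro mult_left_mono norm_mat_vec_le_opnorm) simp
  finally show ?thesis by (simp add: power2_eq_square mult_ac)
qed

lemma opnorm_add_le: "opnorm (A + B) \<le> opnorm A + opnorm B"
proof (rule opnorm_leI)
  fix x
  have "norm ((A + B) *v x) \<le> norm (A *v x) + norm (B *v x)"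
    by (simp add: mat_vec_linear norm_triangle_ineq)
  also have "\<dots> \<le> (opnorm A + opnorm B) * norm x"
    using norm_mat_vec_le_opnorm[of A x] norm_mat_vec_le_opnorm[of B x] by (simp add: algebra_simps)
  finally show "norm ((A + B) *v x) \<le> (opnorm A + opnorm B) * norm x" .
qed (simp add: opnorm_nonneg)

lemma opnorm_uminus: "opnorm (- A) = opnorm A"
  by (simp add: opnorm_def mat_vec_linear onorm_neg)

lemma opnorm_minus_commute: "opnorm (A - B) = opnorm (B - A)"
  by (metis minus_diff_eq opnorm_uminus)

lemma opnorm_scaleR: "opnorm (r *\<^sub>R A) = \<bar>r\<bar> * opnorm A"
  by (simp add: opnorm_def mat_vec_scaleR_left onorm_scaleR[OF bounded_linear_mat_vec])

lemma opnorm_mult_le: "opnorm (A ** B) \<le> opnorm A * opnorm B"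
proof (rule opnorm_leI)
  fix x
  have "norm (A ** B *v x) \<le> opnorm A * norm (B *v x)"
    by (metis matrix_vector_mul_assoc norm_mat_vec_le_opnorm)
  also have "\<dots> \<le> opnorm A * (opnorm B * norm x)"
    by (intro mult_left_mono norm_mat_vec_le_opnorm opnorm_nonneg)
  finally show "norm (A ** B *v x) \<le> opnorm A * opnorm B * norm x" by simp
qed (simp add: opnorm_nonneg)

lemma opnorm_triangle: "opnorm (A - C) \<le> opnorm (A - B) + opnorm (B - C)"
  using opnorm_add_le[of "A - B" "B - C"] by simp

lemma abs_eigenvalue_le_opnorm:
  assumes U: "unitary_mat U"
  shows "\<bar>l i\<bar> \<le> opnorm (spec_mat U l)"
proof -
  define x where "x = U *v axis i 1"
  have x: "adjoint_mat U *v x = axis i 1"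
    using U by (simp add: x_def matrix_vector_mul_assoc unitary_mat_def)
  have nx: "norm x = 1" using norm_unitary[OF U, of x] by (simp add: x)
  have "inner x (spec_mat U l *v x) = (\<Sum>j\<in>UNIV. if j = i then l i else 0)"
    unfolding inner_spec_mat x by (intro sum.cong) (auto simp: axis_def)
  then show ?thesis using abs_inner_le_opnorm[of x "spec_mat U l"] nx by simp
qed

section \<open>Trace inequalities\<close>

definition retrace :: "complex^'n^'n \<Rightarrow> real" where
  "retrace A = Re (trace A)"

lemma retrace_add: "retrace (A + B) = retrace A + retrace B"
  by (simp add: retrace_def trace_add)

lemma retrace_diff: "retrace (A - B) = retrace A - retrace B"
  by (simp add: retrace_def trace_sub)

lemma retrace_scaleR: "retrace (r *\<^sub>R A) = r * retrace A"
  by (simp add: retrace_def trace_def scaleR_conv_of_real[where 'a=complex] flip: sum_distrib_left)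

lemma retrace_one: "retrace (mat 1 :: complex^'n^'n) = real CARD('n)"
  by (simp add: retrace_def trace_I)

text \<open>The columns of \<open>U\<close> are the eigenvectors of the first factor. The trace
  becomes a weighted sum of quadratic forms of \<open>B\<close>, so trace inequalities reduce to
  scalar ones at each eigenvector.\<close>

lemma retrace_spec_mat_mult:
  "retrace (spec_mat U l ** B) = (\<Sum>i\<in>UNIV. l i * inner (column i U) (B *v column i U))"
proof -
  have "trace (spec_mat U l ** B) = trace (diag_mat (\<lambda>i. complex_of_real (l i)) ** (adjoint_mat U ** B ** U))"
    unfolding spec_mat_def by (metis matrix_mul_assoc trace_mul_sym)
  also have "\<dots> = (\<Sum>i\<in>UNIV. l i * (adjoint_mat U ** (B ** U)) $ i $ i)"
    by (simp add: trace_def diag_mat_mult flip: matrix_mul_assoc)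
  also have "\<dots> = (\<Sum>i\<in>UNIV. l i * cinner (column i U) (B *v column i U))"
    by (simp add: cinner_def column_def matrix_vector_mult_def matrix_matrix_mult_def)
  finally show ?thesis by (simp add: retrace_def flip: Re_cinner)
qed

lemma inner_column_unitary:
  assumes "unitary_mat U"
  shows "inner (column i U) (column i U) = 1"
proof -
  have "cinner (column i U) (column i U) = (adjoint_mat U ** U) $ i $ i"
    by (simp add: cinner_def column_def matrix_matrix_mult_def)
  then show ?thesis using assms by (simp add: unitary_mat_def mat_def flip: Re_cinner)
qed

lemma eigenvector_column:
  assumes "unitary_mat U"
  shows "inner (column i U) (spec_mat U l *v column i U) = l i"
proof -
  have "cinner (column i U) (spec_mat U l *v column i U) = (adjoint_mat U ** (spec_mat U l ** U)) $ i $ i"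
    by (simp add: cinner_def column_def matrix_vector_mult_def matrix_matrix_mult_def)
  also have "adjoint_mat U ** (spec_mat U l ** U) = diag_mat (\<lambda>i. complex_of_real (l i))"
    unfolding spec_mat_def by (simp add: unitary_cancel[OF assms] flip: matrix_mul_assoc)
  finally show ?thesis by (simp add: diag_mat_def flip: Re_cinner)
qed

lemma retrace_eq_sum_columns:
  "unitary_mat U \<Longrightarrow> retrace B = (\<Sum>i\<in>UNIV. inner (column i U) (B *v column i U))"
  using retrace_spec_mat_mult[of U "\<lambda>_. 1" B] by (simp add: spec_mat_const)

lemma retrace_spec_mat: "unitary_mat U \<Longrightarrow> retrace (spec_mat U l) = (\<Sum>i\<in>UNIV. l i)"
  by (simp add: retrace_eq_sum_columns eigenvector_column)

lemma retrace_mat_fun_mult_mono: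
  assumes A: "hermitian A" and f: "\<And>x. 0 \<le> f x"
    and le: "\<And>x. inner x (B *v x) \<le> inner x (C *v x)"
  shows "retrace (mat_fun f A ** B) \<le> retrace (mat_fun f A ** C)"
proof -
  obtain U l where U: "unitary_mat U" "A = spec_mat U l" using A by (rule hermitian_obtain_spec_mat)
  show ?thesis
    unfolding U(2) mat_fun_spec_mat[OF U(1)] retrace_spec_mat_mult
    by (intro sum_mono mult_left_mono le f)
qed

lemma retrace_mat_fun_nonneg:
  assumes A: "hermitian A" and f: "\<And>x. 0 \<le> f x"
  shows "0 \<le> retrace (mat_fun f A)"
proof -
  obtain U l where U: "unitary_mat U" "A = spec_mat U l" using A by (rule hermitian_obtain_spec_mat)
  show ?thesis
    unfolding U(2) mat_fun_spec_mat[OF U(1)] retrace_spec_mat[OF U(1)]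
    by (intro sum_nonneg f)
qed

text \<open>The tangent of \<open>exp\<close> at an eigenvalue of \<open>D\<close> lies below
  \<open>exp\<close>. This scalar inequality is applied to \<open>A\<close> through
  \<open>mat_fun_mono\<close>, tested on the corresponding eigenvector of \<open>D\<close>, and
  summed over the eigenvectors.\<close>

lemma Klein_inequality:
  assumes A: "hermitian A" and D: "hermitian D"
  shows "retrace (mat_fun exp D ** (mat 1 + (A - D))) \<le> retrace (mat_fun exp A)"
proof -
  obtain U d where U: "unitary_mat U" "D = spec_mat U d" using D by (rule hermitian_obtain_spec_mat)
  have "exp (d i) * inner (column i U) ((mat 1 + (A - D)) *v column i U)
      \<le> inner (column i U) (mat_fun exp A *v column i U)" (is "?L \<le> ?R") for i
  proof -
    have "mat_fun (\<lambda>x. exp (d i) * (1 - d i) + exp (d i) * x) A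
      = (exp (d i) * (1 - d i)) *\<^sub>R mat 1 + exp (d i) *\<^sub>R A"
      using A mat_fun_scaleR[of A "exp (d i)" "\<lambda>x. x"]
      by (simp flip: mat_fun_add add: mat_fun_ident mat_fun_const)
    then have "inner (column i U) (mat_fun (\<lambda>x. exp (d i) * (1 - d i) + exp (d i) * x) A *v column i U)
      = exp (d i) * (1 - d i) + exp (d i) * inner (column i U) (A *v column i U)"
      using inner_column_unitary[OF U(1), of i] by (simp add: mat_vec_linear inner_add_right)
    also have "\<dots> = ?L"
      using inner_column_unitary[OF U(1), of i] eigenvector_column[OF U(1), of i d]
      by (simp add: U(2) mat_vec_linear inner_add_right inner_diff_right) (simp add: algebra_simps)
    finally have "?L = inner (column i U) (mat_fun (\<lambda>x. exp (d i) * (1 - d i) + exp (d i) * x) A *v column i U)" ..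
    also have "\<dots> \<le> ?R"
    proof (rule mat_fun_mono[OF A])
      fix x :: real
      have "exp (d i) * (1 + (x - d i)) \<le> exp (d i) * exp (x - d i)"
        by (intro mult_left_mono exp_ge_add_one_self) simp
      then show "exp (d i) * (1 - d i) + exp (d i) * x \<le> exp x"
        by (simp add: algebra_simps flip: exp_add)
    qed
    finally show ?thesis .
  qed
  then show ?thesis
    unfolding U(2) mat_fun_spec_mat[OF U(1)] retrace_spec_mat_mult retrace_eq_sum_columns[OF U(1), of "mat_fun exp A"]
    by (intro sum_mono) (simp add: U(2))
qed

text \<open>The trace of the exponential is a sum of positive terms, one per eigenvalue, so it
  dominates each of them; \<open>A\<close> and \<open>- A\<close> bound the spectrum from both
  sides.\<close>

lemma opnorm_le_of_retrace_exp:
  assumes A: "hermitian A" and "retrace (mat_fun exp A) \<le> exp s" "retrace (mat_fun exp (- A)) \<le> exp s"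
  shows "opnorm A \<le> s"
proof -
  obtain U l where U: "unitary_mat U" "A = spec_mat U l" using A by (rule hermitian_obtain_spec_mat)
  have "exp (l i) \<le> (\<Sum>i\<in>UNIV. exp (l i))" "exp (- l i) \<le> (\<Sum>i\<in>UNIV. exp (- l i))" for i
    by (rule member_le_sum; simp)+
  moreover have "(\<Sum>i\<in>UNIV. exp (l i)) \<le> exp s" "(\<Sum>i\<in>UNIV. exp (- l i)) \<le> exp s"
    using assms(2,3) unfolding mat_fun_uminus[OF A]
    unfolding U(2) mat_fun_spec_mat[OF U(1)] retrace_spec_mat[OF U(1)] .
  ultimately have "exp (l i) \<le> exp s" "exp (- l i) \<le> exp s" for i
    using order_trans by blast+
  then have "\<bar>l i\<bar> \<le> s" for i by (simp add: abs_le_iff)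
  then show ?thesis
    unfolding U(2) using norm_spec_mat_le[OF U(1)] by (intro opnorm_leI) (force, meson abs_ge_zero order_trans)
qed

section \<open>The Golden--Thompson inequality\<close>

text \<open>\<open>msq k A\<close> is the power \<open>A ^ (2 ^ k)\<close>.\<close>
primrec msq :: "nat \<Rightarrow> complex^'n^'n \<Rightarrow> complex^'n^'n" where
  "msq 0 A = A"
| "msq (Suc k) A = msq k (A ** A)"

lemma msq_Suc_right: "msq (Suc k) A = msq k A ** msq k A"
  by (induction k arbitrary: A) auto

lemma hermitian_msq: "hermitian A \<Longrightarrow> hermitian (msq k A)"
  by (induction k arbitrary: A) (auto intro: hermitian_square)

text \<open>The square of \<open>A ** B\<close> is \<open>A\<close> times
  \<open>B ** A ** B\<close>; moving \<open>A\<close> to the other end by the induction hypothesis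
  gives the square of \<open>B ** A\<close>.\<close>

lemma trace_msq_commute: "trace (msq k (A ** B)) = trace (msq k (B ** A))"
proof (induction k arbitrary: A B)
  case 0
  show ?case unfolding msq.simps by (rule trace_mul_sym)
next
  case (Suc k)
  have "trace (msq k (A ** (B ** A ** B))) = trace (msq k ((B ** A ** B) ** A))" by (rule Suc)
  then show ?case by (simp add: matrix_mul_assoc)
qed

lemma retrace_msq_commute: "retrace (msq k (A ** B)) = retrace (msq k (B ** A))"
  unfolding retrace_def by (subst trace_msq_commute) (rule refl)

lemma retrace_mult_adjoint: "retrace (A ** adjoint_mat A) = (\<Sum>i\<in>UNIV. \<Sum>j\<in>UNIV. (cmod (A $ i $ j))\<^sup>2)"
  unfolding retrace_def trace_def matrix_matrix_mult_def cmod_power2 by (simp add: power2_eq_square)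

text \<open>The trace is a sum over index pairs, to which the scalar Cauchy--Schwarz inequality
  applies; the right-hand factors are squared Hilbert--Schmidt norms.\<close>

lemma trace_Cauchy_Schwarz:
  "(cmod (trace (A ** B)))\<^sup>2 \<le> retrace (A ** adjoint_mat A) * retrace (B ** adjoint_mat B)"
proof -
  let ?I = "UNIV \<times> UNIV :: ('a \<times> 'a) set"
  have "cmod (trace (A ** B)) \<le> (\<Sum>(i,j)\<in>?I. cmod (A $ i $ j) * cmod (B $ j $ i))"
    unfolding trace_def matrix_matrix_mult_def sum.cartesian_product[symmetric]
    by (simp flip: norm_mult) (intro sum_norm_le order_refl)
  then have "(cmod (trace (A ** B)))\<^sup>2 \<le> (\<Sum>p\<in>?I. cmod (A $ fst p $ snd p) * cmod (B $ snd p $ fst p))\<^sup>2"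
    by (simp add: case_prod_beta power_mono)
  also have "\<dots> \<le> (\<Sum>p\<in>?I. (cmod (A $ fst p $ snd p))\<^sup>2) * (\<Sum>p\<in>?I. (cmod (B $ snd p $ fst p))\<^sup>2)"
    by (rule Cauchy_Schwarz_ineq_sum)
  also have "(\<Sum>p\<in>?I. (cmod (A $ fst p $ snd p))\<^sup>2) = retrace (A ** adjoint_mat A)"
    by (simp add: retrace_mult_adjoint sum.cartesian_product case_prod_beta)
  also have "(\<Sum>p\<in>?I. (cmod (B $ snd p $ fst p))\<^sup>2) = retrace (B ** adjoint_mat B)"
    unfolding retrace_mult_adjoint by (subst sum.swap) (simp add: sum.cartesian_product case_prod_beta)
  finally show ?thesis .
qed

lemma retrace_mult_adjoint_nonneg: "0 \<le> retrace (A ** adjoint_mat A)"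
  by (simp add: retrace_mult_adjoint sum_nonneg)

text \<open>One half of a simultaneous induction: \<open>trace_msq_le\<close> enters as a hypothesis
  for the exponents below \<open>k\<close>. It replaces \<open>P ** Q\<close> by its product with
  its adjoint, which is P Q Q P; cyclicity turns this into P P Q Q, and the exponent has been
  halved.\<close>

lemma trace_msq_le_aux:
  fixes P Q :: "complex^'n^'n"
  assumes "\<And>j (M :: complex^'n^'n). j < k \<Longrightarrow> cmod (trace (msq (Suc j) M)) \<le> retrace (msq j (M ** adjoint_mat M))"
    and "hermitian P" "hermitian Q"
  shows "cmod (trace (msq k (P ** Q))) \<le> cmod (trace (msq k P ** msq k Q))"
  using assms
proof (induction k arbitrary: P Q)
  case 0
  then show ?case by simp
next
  case (Suc k)
  have "cmod (trace (msq (Suc k) (P ** Q))) \<le> retrace (msq k ((P ** Q) ** adjoint_mat (P ** Q)))"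
    using Suc.prems(1)[of k "P ** Q"] by (simp del: msq.simps)
  also have "(P ** Q) ** adjoint_mat (P ** Q) = (P ** (Q ** Q)) ** P"
    using Suc.prems(2,3) by (simp add: adjoint_mat_mult hermitian_def matrix_mul_assoc)
  also have "retrace (msq k \<dots>) = retrace (msq k (P ** (P ** (Q ** Q))))"
    by (rule retrace_msq_commute)
  also have "\<dots> \<le> cmod (trace (msq k ((P ** P) ** (Q ** Q))))"
    unfolding retrace_def by (simp add: complex_Re_le_cmod matrix_mul_assoc)
  also have "\<dots> \<le> cmod (trace (msq k (P ** P) ** msq k (Q ** Q)))"
    using Suc.prems by (intro Suc.IH hermitian_square) auto
  finally show ?case by simp
qed

text \<open>For \<open>k = 0\<close> this is Cauchy--Schwarz. Otherwise the induction hypothesis for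
  \<open>M ** M\<close> and cyclicity lead to a power of \<open>P ** Q\<close>, with
  \<open>P\<close> and \<open>Q\<close> the two products of \<open>M\<close> and its adjoint. The
  auxiliary lemma separates the factors, and Cauchy--Schwarz finishes because all powers of
  \<open>P\<close> and \<open>Q\<close> have equal traces.\<close>

lemma trace_msq_le:
  "cmod (trace (msq (Suc k) M)) \<le> retrace (msq k (M ** adjoint_mat M))"
proof (induction k arbitrary: M rule: less_induct)
  case (less k)
  show ?case
  proof (cases k)
    case 0
    have "(cmod (trace (M ** M)))\<^sup>2 \<le> (retrace (M ** adjoint_mat M))\<^sup>2"
      using trace_Cauchy_Schwarz[of M M] by (simp add: power2_eq_square)
    then show ?thesis
      unfolding 0 msq.simps by (rule power2_le_imp_le) (rule retrace_mult_adjoint_nonneg)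
  next
    case (Suc k')
    define P Q where "P = adjoint_mat M ** M" and "Q = M ** adjoint_mat M"
    have h: "hermitian P" "hermitian Q" by (simp_all add: P_def Q_def hermitian_def adjoint_mat_mult)
    have "cmod (trace (msq (Suc k') (M ** M)))
        \<le> retrace (msq k' ((M ** M) ** adjoint_mat (M ** M)))"
      using Suc by (intro less.IH) simp
    also have "(M ** M) ** adjoint_mat (M ** M) = (M ** M ** adjoint_mat M) ** adjoint_mat M"
      by (simp add: adjoint_mat_mult matrix_mul_assoc)
    also have "retrace (msq k' \<dots>) = retrace (msq k' (adjoint_mat M ** (M ** M ** adjoint_mat M)))"
      by (rule retrace_msq_commute)
    also have "\<dots> \<le> cmod (trace (msq k' (P ** Q)))"
      unfolding retrace_def by (simp add: complex_Re_le_cmod matrix_mul_assoc P_def Q_def)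
    also have "\<dots> \<le> cmod (trace (msq k' P ** msq k' Q))"
      using less.IH Suc h by (intro trace_msq_le_aux) (auto simp del: msq.simps)
    also have "\<dots> \<le> retrace (msq (Suc k') Q)"
    proof (rule power2_le_imp_le)
      have "(cmod (trace (msq k' P ** msq k' Q)))\<^sup>2
          \<le> retrace (msq k' P ** adjoint_mat (msq k' P)) * retrace (msq k' Q ** adjoint_mat (msq k' Q))"
        by (rule trace_Cauchy_Schwarz)
      also have "\<dots> = retrace (msq (Suc k') P) * retrace (msq (Suc k') Q)"
        using h[THEN hermitian_msq[of _ k']] by (simp only: msq_Suc_right hermitian_def)
      also have "retrace (msq (Suc k') P) = retrace (msq (Suc k') Q)"
        unfolding P_def Q_def by (rule retrace_msq_commute)
      finally show "(cmod (trace (msq k' P ** msq k' Q)))\<^sup>2 \<le> (retrace (msq (Suc k') Q))\<^sup>2"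
        by (simp add: power2_eq_square)
      show "0 \<le> retrace (msq (Suc k') Q)"
        using retrace_mult_adjoint_nonneg[of "msq k' Q"] h(2)[THEN hermitian_msq[of _ k']]
        by (simp only: msq_Suc_right hermitian_def)
    qed
    finally show ?thesis by (simp add: Suc Q_def)
  qed
qed

lemma retrace_msq_mult_le:
  assumes "hermitian P" "hermitian Q"
  shows "retrace (msq k (P ** Q)) \<le> cmod (trace (msq k P ** msq k Q))"
  unfolding retrace_def by (rule order_trans[OF complex_Re_le_cmod trace_msq_le_aux[OF trace_msq_le assms]])

text \<open>The Lipschitz estimate N K^(N - 1) for the power N = 2^k. Squaring costs a factor 2 K,
  since X X - Y Y = X (X - Y) + (X - Y) Y.\<close>

lemma opnorm_msq_diff_le:
  assumes "opnorm X \<le> K" "opnorm Y \<le> K"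
  shows "opnorm (msq k X - msq k Y) \<le> 2 ^ k * K ^ (2 ^ k - 1) * opnorm (X - Y)"
  using assms
proof (induction k arbitrary: X Y K)
  case 0
  then show ?case by simp
next
  case (Suc k)
  have K0: "0 \<le> K" using Suc.prems opnorm_nonneg order_trans by blast
  have sq: "opnorm (Z ** Z) \<le> K\<^sup>2" if "opnorm Z \<le> K" for Z :: "complex^'a^'a"
    using opnorm_mult_le[of Z Z] mult_mono[OF that that K0 opnorm_nonneg] by (simp add: power2_eq_square)
  have "X ** X - Y ** Y = X ** (X - Y) + (X - Y) ** Y" by (simp add: matrix_mult_linear)
  then have "opnorm (X ** X - Y ** Y) \<le> opnorm X * opnorm (X - Y) + opnorm (X - Y) * opnorm Y"
    using opnorm_add_le[of "X ** (X - Y)" "(X - Y) ** Y"] opnorm_mult_le[of X "X - Y"] opnorm_mult_le[of "X - Y" Y]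
    by simp
  also have "\<dots> \<le> K * opnorm (X - Y) + opnorm (X - Y) * K"
    by (intro add_mono mult_left_mono mult_right_mono Suc.prems opnorm_nonneg)
  finally have d: "opnorm (X ** X - Y ** Y) \<le> 2 * K * opnorm (X - Y)" by simp
  have "opnorm (msq (Suc k) X - msq (Suc k) Y) \<le> 2 ^ k * (K\<^sup>2) ^ (2 ^ k - 1) * opnorm (X ** X - Y ** Y)"
    unfolding msq.simps by (rule Suc.IH) (intro sq Suc.prems)+
  also have "\<dots> \<le> 2 ^ k * (K\<^sup>2) ^ (2 ^ k - 1) * (2 * K * opnorm (X - Y))"
    by (intro mult_left_mono d) simp
  also have "(K\<^sup>2) ^ (2 ^ k - 1) * K = K ^ (2 ^ Suc k - 1)"
  proof -
    have "2 * (2 ^ k - 1) + 1 = (2 ^ Suc k - 1 :: nat)"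
      using one_le_power[of "2::nat" k] unfolding power_Suc by linarith
    then show ?thesis by (metis power_add power_mult power_one_right)
  qed
  then have "2 ^ k * (K\<^sup>2) ^ (2 ^ k - 1) * (2 * K * opnorm (X - Y)) = 2 ^ Suc k * K ^ (2 ^ Suc k - 1) * opnorm (X - Y)"
    by (simp add: mult_ac)
  finally show ?case .
qed

lemma opnorm_mat_fun_le:
  assumes A: "hermitian A" and f: "\<And>x. \<bar>x\<bar> \<le> opnorm A \<Longrightarrow> \<bar>f x\<bar> \<le> s"
  shows "opnorm (mat_fun f A) \<le> s"
proof -
  obtain U l where U: "unitary_mat U" "A = spec_mat U l" using A by (rule hermitian_obtain_spec_mat)
  have *: "\<bar>f (l i)\<bar> \<le> s" for i using f abs_eigenvalue_le_opnorm[OF U(1)] U(2) by blast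
  show ?thesis
    unfolding U(2) mat_fun_spec_mat[OF U(1)]
    using norm_spec_mat_le[OF U(1), of "\<lambda>i. f (l i)", OF *] *[of undefined]
    by (intro opnorm_leI) (blast, linarith)
qed

lemma opnorm_exp_le: "hermitian A \<Longrightarrow> opnorm (mat_fun exp A) \<le> exp (opnorm A)"
  by (rule opnorm_mat_fun_le) auto

lemma abs_exp_minus_linear_le:
  fixes x :: real
  assumes "\<bar>x\<bar> \<le> 1"
  shows "\<bar>exp x - 1 - x\<bar> \<le> x\<^sup>2"
proof -
  have "0 \<le> exp x - 1 - x" using exp_ge_add_one_self[of x] by linarith
  moreover have "exp x \<le> 1 + x + x\<^sup>2"
  proof (cases "0 \<le> x")
    case True
    then show ?thesis using exp_bound[of x] assms by simp
  next
    case False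
    \<comment> \<open>For negative \<open>x\<close> the claim is multiplied by
      \<open>exp (- x)\<close>, which is at least its quadratic Taylor polynomial since
      \<open>- x\<close> is positive.\<close>
    have "1 \<le> (1 + x + x\<^sup>2) * (1 - x + x\<^sup>2 / 2)"
    proof -
      have "(1 + x + x\<^sup>2) * (1 - x + x\<^sup>2 / 2) = 1 + x\<^sup>2 / 2 - x ^ 3 / 2 + x ^ 4 / 2"
        by (simp add: power2_eq_square power3_eq_cube power4_eq_xxxx field_simps)
      moreover have "x ^ 3 \<le> 0" using False by (simp add: power_le_zero_eq)
      moreover have "0 \<le> x\<^sup>2" "0 \<le> x ^ 4" by simp_all
      ultimately show ?thesis by linarith
    qed
    moreover have "1 - x + x\<^sup>2 / 2 \<le> exp (- x)"
      using exp_lower_Taylor_quadratic[of "- x"] False by simp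
    ultimately have "1 \<le> (1 + x + x\<^sup>2) * exp (- x)"
      using mult_left_mono[of "1 - x + x\<^sup>2 / 2" "exp (- x)" "1 + x + x\<^sup>2"] assms False
        by (smt (verit) zero_le_power2)
    then show ?thesis by (simp add: exp_minus field_simps)
  qed
  ultimately show ?thesis by simp
qed

lemma opnorm_exp_minus_linear_le:
  assumes A: "hermitian A" and e: "0 \<le> e" "e * opnorm A \<le> 1"
  shows "opnorm (mat_fun exp (e *\<^sub>R A) - mat 1 - e *\<^sub>R A) \<le> e\<^sup>2 * (opnorm A)\<^sup>2"
proof -
  have "mat_fun exp (e *\<^sub>R A) - mat 1 - e *\<^sub>R A = mat_fun (\<lambda>x. exp (e * x) + (- 1 + (- e) * x)) A"
  proof -
    have "mat_fun (\<lambda>x. exp (e * x) + (- 1 + (- e) * x)) A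
        = mat_fun (\<lambda>x. exp (e * x)) A + (mat_fun (\<lambda>x. - 1) A + (- e) *\<^sub>R mat_fun (\<lambda>x. x) A)"
      by (simp only: mat_fun_add[OF A] mat_fun_scaleR[OF A])
    then show ?thesis by (simp add: mat_fun_const[OF A] mat_fun_ident[OF A] mat_fun_scaleR_arg[OF A])
  qed
  also have "opnorm \<dots> \<le> e\<^sup>2 * (opnorm A)\<^sup>2"
  proof (rule opnorm_mat_fun_le[OF A])
    fix x assume x: "\<bar>x\<bar> \<le> opnorm A"
    have "\<bar>e * x\<bar> \<le> e * opnorm A" using x e by (simp add: abs_mult mult_left_mono)
    moreover from this have "(e * x)\<^sup>2 \<le> (e * opnorm A)\<^sup>2"
      using e by (simp add: abs_le_square_iff[symmetric] opnorm_nonneg)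
    ultimately show "\<bar>exp (e * x) + (- 1 + - e * x)\<bar> \<le> e\<^sup>2 * (opnorm A)\<^sup>2"
      using abs_exp_minus_linear_le[of "e * x"] e by (simp add: power_mult_distrib)
  qed
  finally show ?thesis .
qed

lemma abs_retrace_le: "\<bar>retrace (A :: complex^'n^'n)\<bar> \<le> real CARD('n) * opnorm A"
proof -
  have u: "unitary_mat (mat 1 :: complex^'n^'n)" by (simp add: unitary_mat_def adjoint_mat_one)
  have "norm (column i (mat 1 :: complex^'n^'n)) = 1" for i
    using inner_column_unitary[OF u, of i] by (simp add: norm_eq_1)
  then have "\<bar>inner (column i (mat 1)) (A *v column i (mat 1))\<bar> \<le> opnorm A" for i
    using abs_inner_le_opnorm[of "column i (mat 1)" A] by simp
  then have "\<bar>retrace A\<bar> \<le> (\<Sum>i\<in>(UNIV :: 'n set). opnorm A)"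
    unfolding retrace_eq_sum_columns[OF u] by (intro order_trans[OF sum_abs] sum_mono)
  then show ?thesis by simp
qed

text \<open>The trace of a product of two Hermitian matrices is real, and it is nonnegative when
  both are positive. This removes the modulus that the power inequalities leave behind.\<close>

lemma trace_exp_mult:
  fixes A B :: "complex^'n^'n"
  assumes A: "hermitian A" and B: "hermitian B"
  shows "cmod (trace (mat_fun exp A ** mat_fun exp B)) = retrace (mat_fun exp A ** mat_fun exp B)"
proof -
  let ?P = "mat_fun exp A" and ?Q = "mat_fun exp B"
  have h: "hermitian ?P" "hermitian ?Q" using assms by (auto intro: hermitian_mat_fun)
  have "cnj (trace (?P ** ?Q)) = trace (adjoint_mat (?P ** ?Q))"
    by (simp add: trace_def)
  also have "\<dots> = trace (?Q ** ?P)" using h by (simp add: adjoint_mat_mult hermitian_def)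
  also have "\<dots> = trace (?P ** ?Q)" by (rule trace_mul_sym)
  finally have "Im (trace (?P ** ?Q)) = 0" by (simp add: complex_eq_iff)
  moreover have "0 \<le> Re (trace (?P ** ?Q))"
  proof -
    have "inner x ((0 :: complex^'n^'n) *v x) \<le> inner x (?Q *v x)" for x
      using mat_fun_mono[OF B, of "\<lambda>_. 0" exp x] mat_fun_const[OF B, of 0] by simp
    from retrace_mat_fun_mult_mono[OF A _ this, of exp]
    show ?thesis by (simp add: retrace_def trace_def matrix_matrix_mult_def)
  qed
  ultimately show ?thesis by (simp add: retrace_def cmod_eq_Re)
qed

lemma msq_exp: "hermitian A \<Longrightarrow> msq k (mat_fun exp ((1 / 2 ^ k) *\<^sub>R A)) = mat_fun exp A"
proof (induction k arbitrary: A)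
  case 0
  then show ?case by simp
next
  case (Suc k)
  let ?B = "(1 / 2 ^ Suc k) *\<^sub>R A"
  have "mat_fun exp ?B ** mat_fun exp ?B = mat_fun exp ((1 / 2 ^ k) *\<^sub>R A)"
    using Suc.prems by (simp add: mat_fun_scaleR_arg mat_fun_mult flip: exp_add)
  then show ?case using Suc by simp
qed

text \<open>With e = 1 / 2^k a single factor differs from \<open>exp (e (A + B))\<close> by order
  e^2, and raising to the power 2^k multiplies the error by order 2^k. Only the independence of the
  constant from \<open>k\<close> matters. The condition on \<open>k\<close> makes the quadratic
  remainder of \<open>exp\<close> applicable to all three factors.\<close>

lemma Lie_Trotter_bound:
  assumes A: "hermitian A" and B: "hermitian B"
    and k: "opnorm A + opnorm B + opnorm (A + B) \<le> 2 ^ k"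
  shows "opnorm (msq k (mat_fun exp ((1 / 2 ^ k) *\<^sub>R A) ** mat_fun exp ((1 / 2 ^ k) *\<^sub>R B)) - mat_fun exp (A + B))
    \<le> (opnorm A * opnorm B + opnorm A * (opnorm B)\<^sup>2 + (opnorm A)\<^sup>2 * exp (opnorm B) + (opnorm B)\<^sup>2 + (opnorm (A + B))\<^sup>2)
       * exp (opnorm A + opnorm B + opnorm (A + B)) / 2 ^ k"
proof -
  define e :: real where "e = 1 / 2 ^ k"
  define a b c where "a = opnorm A" and "b = opnorm B" and "c = opnorm (A + B)"
  have abc: "0 \<le> a" "0 \<le> b" "0 \<le> c" by (simp_all add: a_def b_def c_def opnorm_nonneg)
  have e: "0 < e" "e \<le> 1" by (simp_all add: e_def)
  have e3: "e * (a + b + c) \<le> 1" using k by (simp add: e_def a_def b_def c_def)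
  then have ea: "e * a \<le> 1" and eb: "e * b \<le> 1" and ec: "e * c \<le> 1"
    using abc e by (auto simp: distrib_left intro: order_trans[rotated])
  have AB: "hermitian (A + B)" using A B by (rule hermitian_add)
  define X Y Z where "X = mat_fun exp (e *\<^sub>R A)" and "Y = mat_fun exp (e *\<^sub>R B)" and "Z = mat_fun exp (e *\<^sub>R (A + B))"
  define RA RB RC where "RA = X - mat 1 - e *\<^sub>R A" and "RB = Y - mat 1 - e *\<^sub>R B" and "RC = Z - mat 1 - e *\<^sub>R (A + B)"
  have R: "opnorm RA \<le> e\<^sup>2 * a\<^sup>2" "opnorm RB \<le> e\<^sup>2 * b\<^sup>2" "opnorm RC \<le> e\<^sup>2 * c\<^sup>2"
    unfolding RA_def RB_def RC_def X_def Y_def Z_def a_def b_def c_def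
    using ea eb ec e A B AB unfolding a_def b_def c_def by (intro opnorm_exp_minus_linear_le; simp)+
  have N: "opnorm X \<le> exp (e * a)" "opnorm Y \<le> exp (e * b)" "opnorm Z \<le> exp (e * c)"
    unfolding X_def Y_def Z_def a_def b_def c_def
    using opnorm_exp_le[OF hermitian_scaleR[OF A, of e]] opnorm_exp_le[OF hermitian_scaleR[OF B, of e]]
      opnorm_exp_le[OF hermitian_scaleR[OF AB, of e]] e by (simp_all add: opnorm_scaleR)
  have "exp (e * b) \<le> exp b" using e abc by (simp add: mult_left_le_one_le)
  then have Y: "opnorm Y \<le> exp b" using N(2) by linarith
  let ?K = "exp (e * (a + b + c))"
  have K1: "opnorm (X ** Y) \<le> ?K"
  proof -
    have "opnorm (X ** Y) \<le> exp (e * a) * exp (e * b)"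
      using opnorm_mult_le[of X Y] mult_mono[OF N(1,2)] by (simp add: opnorm_nonneg)
    also have "\<dots> \<le> ?K" using abc e by (simp add: algebra_simps flip: exp_add)
    finally show ?thesis .
  qed
  have K2: "opnorm Z \<le> ?K"
    using N(3) abc e by (rule_tac order_trans[OF N(3)]) (simp add: algebra_simps)
  \<comment> \<open>The terms of order 0 and 1 in e cancel; every remaining term carries a factor
    e^2 or a remainder bounded by a multiple of e^2.\<close>
  have XYZ: "X ** Y - Z = e\<^sup>2 *\<^sub>R (A ** B) + (e *\<^sub>R (A ** RB) + (RA ** Y + (RB + (- RC))))"
  proof -
    have "X ** Y = (mat 1 + e *\<^sub>R A + RA) ** Y" by (simp add: RA_def)
    also have "\<dots> = Y + e *\<^sub>R (A ** Y) + RA ** Y" by (simp add: matrix_mult_linear)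
    also have "A ** Y = A ** (mat 1 + e *\<^sub>R B + RB)" by (simp add: RB_def)
    also have "\<dots> = A + e *\<^sub>R (A ** B) + A ** RB" by (simp add: matrix_mult_linear)
    finally show ?thesis
      by (simp add: RB_def RC_def scaleR_add_right power2_eq_square algebra_simps)
  qed
  have "opnorm (X ** Y - Z) \<le> opnorm (e\<^sup>2 *\<^sub>R (A ** B)) + (opnorm (e *\<^sub>R (A ** RB)) + (opnorm (RA ** Y) + (opnorm RB + opnorm (- RC))))"
    unfolding XYZ by (intro order_trans[OF opnorm_add_le] add_left_mono order_refl)
  also have "\<dots> \<le> e\<^sup>2 * (a * b) + (e\<^sup>2 * (a * b\<^sup>2) + (e\<^sup>2 * (a\<^sup>2 * exp b) + (e\<^sup>2 * b\<^sup>2 + e\<^sup>2 * c\<^sup>2)))"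
  proof (intro add_mono)
    show "opnorm (e\<^sup>2 *\<^sub>R (A ** B)) \<le> e\<^sup>2 * (a * b)"
      using opnorm_mult_le[of A B] by (simp add: opnorm_scaleR a_def b_def mult_left_mono)
    have "opnorm (A ** RB) \<le> a * (e\<^sup>2 * b\<^sup>2)"
      using opnorm_mult_le[of A RB] mult_left_mono[OF R(2) abc(1)] by (simp add: a_def)
    then have "opnorm (e *\<^sub>R (A ** RB)) \<le> e * (a * (e\<^sup>2 * b\<^sup>2))"
      using e by (simp add: opnorm_scaleR mult_left_mono)
    also have "\<dots> \<le> 1 * (a * (e\<^sup>2 * b\<^sup>2))"
      using e abc by (intro mult_right_mono) auto
    finally show "opnorm (e *\<^sub>R (A ** RB)) \<le> e\<^sup>2 * (a * b\<^sup>2)" by (simp add: mult_ac)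
    show "opnorm (RA ** Y) \<le> e\<^sup>2 * (a\<^sup>2 * exp b)"
      using opnorm_mult_le[of RA Y] mult_mono[OF R(1) Y] by (simp add: opnorm_nonneg mult.assoc)
  qed (use R in \<open>simp_all add: opnorm_uminus\<close>)
  also have "\<dots> = e\<^sup>2 * (a * b + a * b\<^sup>2 + a\<^sup>2 * exp b + b\<^sup>2 + c\<^sup>2)" (is "_ = e\<^sup>2 * ?C")
    by (simp add: algebra_simps)
  finally have d: "opnorm (X ** Y - Z) \<le> e\<^sup>2 * ?C" .
  have KK: "?K ^ (2 ^ k - 1) \<le> exp (a + b + c)"
  proof -
    have "?K ^ (2 ^ k - 1) \<le> ?K ^ (2 ^ k)"
      using abc e by (intro power_increasing) auto
    also have "\<dots> = exp (a + b + c)" by (simp add: e_def flip: exp_of_nat_mult)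
    finally show ?thesis .
  qed
  have "mat_fun exp (A + B) = msq k Z" unfolding Z_def e_def by (simp add: msq_exp[OF AB])
  then have "opnorm (msq k (X ** Y) - mat_fun exp (A + B)) \<le> 2 ^ k * ?K ^ (2 ^ k - 1) * opnorm (X ** Y - Z)"
    using opnorm_msq_diff_le[OF K1 K2] by simp
  also have "\<dots> \<le> 2 ^ k * exp (a + b + c) * (e\<^sup>2 * ?C)"
    by (intro mult_mono KK d) (auto simp: opnorm_nonneg)
  also have "\<dots> = ?C * exp (a + b + c) / 2 ^ k"
    by (simp add: e_def power2_eq_square field_simps)
  finally show ?thesis unfolding X_def Y_def e_def a_def b_def c_def .
qed

text \<open>\<open>retrace_msq_mult_le\<close> is applied to the exponentials of \<open>A\<close>
  and \<open>B\<close> scaled by 1 / 2^k. The right side is then independent of \<open>k\<close>,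
  and the left side tends to the trace of \<open>exp (A + B)\<close>.\<close>

theorem Golden_Thompson:
  fixes A B :: "complex^'n^'n"
  assumes A: "hermitian A" and B: "hermitian B"
  shows "retrace (mat_fun exp (A + B)) \<le> retrace (mat_fun exp A ** mat_fun exp B)"
proof -
  define m where "m = opnorm A + opnorm B + opnorm (A + B)"
  define C where "C = real CARD('n) * ((opnorm A * opnorm B + opnorm A * (opnorm B)\<^sup>2
    + (opnorm A)\<^sup>2 * exp (opnorm B) + (opnorm B)\<^sup>2 + (opnorm (A + B))\<^sup>2) * exp m)"
  have *: "retrace (mat_fun exp (A + B)) \<le> retrace (mat_fun exp A ** mat_fun exp B) + C * (1 / 2) ^ k"
    if k: "m \<le> 2 ^ k" for k
  proof -
    let ?X = "mat_fun exp ((1 / 2 ^ k) *\<^sub>R A)" and ?Y = "mat_fun exp ((1 / 2 ^ k) *\<^sub>R B)"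
    have "retrace (msq k (?X ** ?Y)) \<le> cmod (trace (msq k ?X ** msq k ?Y))"
      using A B by (intro retrace_msq_mult_le hermitian_mat_fun hermitian_scaleR)
    also have "\<dots> = retrace (mat_fun exp A ** mat_fun exp B)"
      using A B by (simp add: msq_exp trace_exp_mult)
    finally have 1: "retrace (msq k (?X ** ?Y)) \<le> retrace (mat_fun exp A ** mat_fun exp B)" .
    have "\<bar>retrace (msq k (?X ** ?Y) - mat_fun exp (A + B))\<bar>
        \<le> real CARD('n) * opnorm (msq k (?X ** ?Y) - mat_fun exp (A + B))"
      by (rule abs_retrace_le)
    also have "\<dots> \<le> C * (1 / 2) ^ k"
      using mult_left_mono[OF Lie_Trotter_bound[OF A B k[unfolded m_def]], of "real CARD('n)"]
      by (simp add: C_def m_def power_divide mult_ac)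
    finally show ?thesis using 1 by (simp add: retrace_diff)
  qed
  have ev: "eventually (\<lambda>k. m \<le> 2 ^ k) sequentially"
  proof -
    obtain N where N: "m < 2 ^ N" using real_arch_pow[of 2 m] by auto
    have "m \<le> 2 ^ k" if "N \<le> k" for k
    proof -
      have "(2::real) ^ N \<le> 2 ^ k" using that by (intro power_increasing) auto
      then show ?thesis using N by linarith
    qed
    then show ?thesis unfolding eventually_sequentially by blast
  qed
  have "(\<lambda>k. retrace (mat_fun exp A ** mat_fun exp B) + C * (1 / 2) ^ k)
      \<longlonglongrightarrow> retrace (mat_fun exp A ** mat_fun exp B) + C * 0"
    by (intro tendsto_intros LIMSEQ_realpow_zero) auto
  then show ?thesis
    using * ev by (intro tendsto_lowerbound[where F=sequentially]) (auto elim: eventually_mono)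
qed

section \<open>Measurability of the functional calculus\<close>

lemma borel_measurable_vecI:
  fixes X :: "'a \<Rightarrow> ('b::euclidean_space)^'n"
  assumes "\<And>i. (\<lambda>\<omega>. X \<omega> $ i) \<in> borel_measurable M"
  shows "X \<in> borel_measurable M"
  unfolding borel_measurable_euclidean_space[of X]
proof
  fix b :: "'b^'n" assume "b \<in> Basis"
  then obtain i e where b: "b = axis i e" by (auto simp: Basis_vec_def)
  show "(\<lambda>\<omega>. X \<omega> \<bullet> b) \<in> borel_measurable M"
    unfolding b using assms by (auto simp: inner_axis intro!: borel_measurable_inner)
qed

lemma borel_measurable_vec_nth:
  fixes X :: "'a \<Rightarrow> ('b::euclidean_space)^'n"
  assumes "X \<in> borel_measurable M"
  shows "(\<lambda>\<omega>. X \<omega> $ i) \<in> borel_measurable M"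
  by (rule measurable_compose[OF assms borel_measurable_continuous_onI]) (intro continuous_intros)

lemma borel_measurable_mat_nth:
  fixes X :: "'a \<Rightarrow> complex^'n^'m"
  assumes "X \<in> borel_measurable M"
  shows "(\<lambda>\<omega>. X \<omega> $ i $ j) \<in> borel_measurable M"
  by (intro borel_measurable_vec_nth assms)

lemma borel_measurable_matI:
  fixes X :: "'a \<Rightarrow> complex^'n^'m"
  assumes "\<And>i j. (\<lambda>\<omega>. X \<omega> $ i $ j) \<in> borel_measurable M"
  shows "X \<in> borel_measurable M"
  by (intro borel_measurable_vecI assms)

lemma borel_measurable_mat_mult [measurable (raw)]:
  fixes X Y :: "'a \<Rightarrow> complex^'n^'n"
  assumes "X \<in> borel_measurable M" "Y \<in> borel_measurable M"
  shows "(\<lambda>\<omega>. X \<omega> ** Y \<omega>) \<in> borel_measurable M"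
  using assms[THEN borel_measurable_mat_nth]
  by (intro borel_measurable_matI) (simp add: matrix_matrix_mult_def)

lemma borel_measurable_retrace [measurable]: "retrace \<in> borel_measurable borel"
  unfolding retrace_def trace_def by (intro borel_measurable_continuous_onI continuous_intros)

text \<open>A sublevel set is an intersection of closed conditions, one for each vector, and hence
  closed.\<close>

lemma borel_measurable_opnorm [measurable]: "(opnorm :: complex^'n^'n \<Rightarrow> real) \<in> borel_measurable borel"
  unfolding borel_measurable_iff_le
proof
  fix s :: real
  show "{A \<in> space (borel :: (complex^'n^'n) measure). opnorm A \<le> s} \<in> sets borel"
  proof (cases "0 \<le> s")
    case True
    have *: "continuous_on UNIV (\<lambda>A :: complex^'n^'n. A *v x)" for x
    proof -
      have "continuous_on UNIV (\<lambda>A :: complex^'n^'n. \<chi> i. \<Sum>j\<in>UNIV. A $ i $ j * x $ j)"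
        by (rule continuous_on_vec_lambda) (intro continuous_intros)
      then show ?thesis unfolding matrix_vector_mult_def .
    qed
    have "closed {A :: complex^'n^'n. \<forall>x. norm (A *v x) \<le> s * norm x}"
      by (intro closed_Collect_all closed_Collect_le continuous_intros *)
    from borel_closed[OF this] show ?thesis using True by (simp add: opnorm_le_iff)
  next
    case False
    then have "\<not> opnorm A \<le> s" for A :: "complex^'n^'n"
      using opnorm_nonneg[of A] by linarith
    then show ?thesis by simp
  qed
qed

lemma closed_hermitian: "closed {A :: complex^'n^'n. hermitian A}"
proof -
  have "{A :: complex^'n^'n. hermitian A} = {A. \<forall>i j. cnj (A $ j $ i) = A $ i $ j}"
    by (simp add: hermitian_def vec_eq_iff)
  also have "closed \<dots>"
    by (intro closed_Collect_all closed_Collect_eq continuous_intros)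
  finally show ?thesis .
qed

lemma tendsto_spec_mat:
  assumes "\<And>i. (\<lambda>k. g k i) \<longlonglongrightarrow> l i"
  shows "(\<lambda>k. spec_mat U (g k)) \<longlonglongrightarrow> spec_mat U l"
proof -
  have *: "spec_mat U l $ i $ j = (\<Sum>k\<in>UNIV. U $ i $ k * complex_of_real (l k) * cnj (U $ j $ k))" for l i j
    unfolding spec_mat_def matrix_matrix_mult_def[of "U ** _"] by (simp add: mult_diag_mat)
  show ?thesis
    by (intro vec_tendstoI) (unfold *, intro tendsto_intros assms)
qed

text \<open>\<open>mat_fun\<close> is an arbitrary value off the Hermitian matrices; with 0 there
  instead, sums, products and limits of functions pass to matrix functions on the whole
  space.\<close>

definition hfun :: "(real \<Rightarrow> real) \<Rightarrow> complex^'n^'n \<Rightarrow> complex^'n^'n" where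
  "hfun f A = (if hermitian A then mat_fun f A else 0)"

abbreviation hmeas :: "'n::finite itself \<Rightarrow> (real \<Rightarrow> real) \<Rightarrow> bool" where
  "hmeas T f \<equiv> (hfun f :: complex^'n^'n \<Rightarrow> complex^'n^'n) \<in> borel_measurable borel"

lemma hfun_measurable_mult:
  assumes "hmeas TYPE('n::finite) f" "hmeas TYPE('n::finite) g"
  shows "hmeas TYPE('n::finite) (\<lambda>x. f x * g x)"
proof -
  have "hfun (\<lambda>x. f x * g x) = (\<lambda>A :: complex^'n^'n. hfun f A ** (hfun g A :: complex^'n^'n))"
    by (auto simp: hfun_def mat_fun_mult)
  then show ?thesis using borel_measurable_mat_mult[OF assms] by simp
qed

lemma hfun_measurable_add:
  assumes "hmeas TYPE('n::finite) f" "hmeas TYPE('n::finite) g"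
  shows "hmeas TYPE('n::finite) (\<lambda>x. f x + g x)"
proof -
  have "hfun (\<lambda>x. f x + g x) = (\<lambda>A :: complex^'n^'n. hfun f A + hfun g A)"
    by (auto simp: hfun_def mat_fun_add)
  then show ?thesis using borel_measurable_add[OF assms] by simp
qed

lemma hfun_measurable_if:
  assumes "g \<in> borel_measurable borel"
  shows "(\<lambda>A :: complex^'n^'n. if hermitian A then g A else (0 :: complex^'n^'n)) \<in> borel_measurable borel"
  using assms borel_closed[OF closed_hermitian] by (intro measurable_If) auto

lemma hfun_measurable_const: "hmeas TYPE('n::finite) (\<lambda>x. c)"
proof -
  have "hfun (\<lambda>x. c) = (\<lambda>A :: complex^'n^'n. if hermitian A then c *\<^sub>R mat 1 else (0 :: complex^'n^'n))"
    by (auto simp: hfun_def mat_fun_const)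
  then show ?thesis using hfun_measurable_if[of "\<lambda>_ :: complex^'n^'n. c *\<^sub>R mat 1"] by simp
qed

lemma hfun_measurable_ident: "hmeas TYPE('n::finite) (\<lambda>x. x)"
proof -
  have "hfun (\<lambda>x. x) = (\<lambda>A :: complex^'n^'n. if hermitian A then A else (0 :: complex^'n^'n))"
    by (auto simp: hfun_def mat_fun_ident)
  then show ?thesis using hfun_measurable_if[of "\<lambda>A :: complex^'n^'n. A"] by simp
qed

text \<open>Pointwise convergence on the reals is enough, because a fixed matrix evaluates the
  functions only at its finitely many eigenvalues.\<close>

lemma hfun_measurable_LIMSEQ:
  assumes m: "\<And>k :: nat. hmeas TYPE('n::finite) (f k)" and lim: "\<And>x. (\<lambda>k. f k x) \<longlonglongrightarrow> g x"
  shows "hmeas TYPE('n::finite) g"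
proof (rule borel_measurable_LIMSEQ_metric[OF m])
  fix A :: "complex^'n^'n"
  show "(\<lambda>k. hfun (f k) A) \<longlonglongrightarrow> hfun g A"
  proof (cases "hermitian A")
    case True
    then obtain U l where U: "unitary_mat U" "A = spec_mat U l" by (rule hermitian_obtain_spec_mat)
    show ?thesis
  unfolding hfun_def using True by (simp add: U mat_fun_spec_mat tendsto_spec_mat lim)
  qed (simp add: hfun_def)
qed

lemma hfun_measurable_polynomial:
  "real_polynomial_function f \<Longrightarrow> hmeas TYPE('n::finite) f"
proof (induction rule: real_polynomial_function.induct)
  case (linear f)
  then obtain c where "f = (\<lambda>x. x * c)" by (auto simp: real_bounded_linear)
  then show ?case using hfun_measurable_mult[OF hfun_measurable_ident hfun_measurable_const] by simp
qed (auto intro: hfun_measurable_const hfun_measurable_add hfun_measurable_mult)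

text \<open>Weierstrass approximation on [- k, k] with error below 1 / (k + 1) makes
  \<open>f\<close> a pointwise limit of polynomials on the whole line.\<close>

lemma hfun_measurable_continuous:
  assumes f: "continuous_on UNIV f"
  shows "hmeas TYPE('n::finite) f"
proof -
  have "\<exists>p. real_polynomial_function p \<and> (\<forall>x\<in>{- real k..real k}. \<bar>f x - p x\<bar> < 1 / (real k + 1))" for k
  proof -
    have "continuous_on {- real k..real k} f" using f continuous_on_subset by blast
    then obtain p where "real_polynomial_function p" "\<And>x. x \<in> {- real k..real k} \<Longrightarrow> \<bar>f x - p x\<bar> < 1 / (real k + 1)"
      by (rule Stone_Weierstrass_real_polynomial_function[OF compact_Icc, of _ _ _ "1 / (real k + 1)"]) auto
    then show ?thesis by blast
  qed
  then obtain p where p: "\<And>k. real_polynomial_function (p k)"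
    and b: "\<And>k x. x \<in> {- real k..real k} \<Longrightarrow> \<bar>f x - p k x\<bar> < 1 / (real k + 1)" by metis
  show ?thesis
  proof (rule hfun_measurable_LIMSEQ[OF hfun_measurable_polynomial[OF p]])
    fix x :: real
    obtain N where N: "\<bar>x\<bar> \<le> real N" using real_arch_simple by blast
    have "norm (p k x - f x) \<le> 1 / (real k + 1)" if "N \<le> k" for k
    proof -
      have "real N \<le> real k" using that by simp
      then have "x \<in> {- real k..real k}" using N by auto
      from b[OF this] show ?thesis by (simp add: abs_minus_commute)
    qed
    then have "eventually (\<lambda>k. norm (p k x - f x) \<le> 1 / (real k + 1)) sequentially"
      unfolding eventually_sequentially by blast
    moreover have "(\<lambda>k. 1 / (real k + 1)) \<longlonglongrightarrow> 0"
      using LIMSEQ_inverse_real_of_nat unfolding inverse_eq_divide of_nat_Suc by (simp add: add.commute)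
    ultimately show "(\<lambda>k. p k x) \<longlonglongrightarrow> f x"
      by (rule LIM_zero_cancel[OF Lim_null_comparison])
  qed
qed

text \<open>The sets with this property contain the open half-lines and form a sigma-algebra:
  complements are affine in the indicator, finite unions follow by inclusion-exclusion, and
  countable unions are limits of these.\<close>

lemma hfun_measurable_indicator:
  assumes "S \<in> sets borel"
  shows "hmeas TYPE('n::finite) (indicat_real S)"
proof -
  have "S \<in> sigma_sets UNIV (range (\<lambda>a::real. {a<..}))"
    using assms by (simp add: borel_Ioi)
  then show ?thesis
  proof induction
    case (Basic S)
    then obtain a where S: "S = {a<..}" by auto
    \<comment> \<open>Ramps of slope \<open>k\<close> starting at \<open>a\<close>, clipped to
      [0, 1]: continuous functions that converge pointwise to the indicator of the open
      half-line.\<close>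
    define f where "f = (\<lambda>(k::nat) x. min 1 (max 0 (real k * (x - a))))"
    have lim: "(\<lambda>k. f k x) \<longlonglongrightarrow> indicator {a<..} x" for x
    proof (cases "a < x")
      case True
      obtain N where N: "1 / (x - a) \<le> real N" using real_arch_simple by blast
      have "f k x = 1" if "N \<le> k" for k
      proof -
        have "1 \<le> real N * (x - a)" using N True by (simp add: field_simps)
        also have "\<dots> \<le> real k * (x - a)" using that True by (intro mult_right_mono) auto
        finally show ?thesis by (simp add: f_def)
      qed
      then have "eventually (\<lambda>k. f k x = 1) sequentially"
        unfolding eventually_sequentially by blast
      then show ?thesis using True by (simp add: tendsto_eventually)
    next
      case False
      then have "f k x = 0" for k by (simp add: f_def mult_nonneg_nonpos)
      then show ?thesis using False by simp
    qed
    have "continuous_on UNIV (f k)" for k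
      unfolding f_def by (intro continuous_intros)
    then show ?case
      unfolding S by (intro hfun_measurable_LIMSEQ[OF hfun_measurable_continuous lim])
  next
    case Empty
    then show ?case using hfun_measurable_const[of 0] by simp
  next
    case (Compl S)
    have "indicat_real (UNIV - S) = (\<lambda>x. 1 + (- 1) * indicator S x)"
      by (auto simp: indicator_def)
    then show ?case
      using hfun_measurable_add[OF hfun_measurable_const hfun_measurable_mult[OF hfun_measurable_const Compl.IH],
          of 1 "-1"] by simp
  next
    case (Union S)
    have fin: "hmeas TYPE('n::finite) (indicat_real (\<Union>i<n. S i))" for n :: nat
    proof (induction n)
      case 0
      then show ?case using hfun_measurable_const[of 0] by simp
    next
      case (Suc n)
      have "indicat_real (\<Union>i<Suc n. S i) = (\<lambda>x. indicator (\<Union>i<n. S i) x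
          + (indicator (S n) x + (- 1) * (indicator (\<Union>i<n. S i) x * indicator (S n) x)))"
        by (auto simp: lessThan_Suc fun_eq_iff split: split_indicator)
      then show ?case
        using hfun_measurable_add[OF Suc hfun_measurable_add[OF Union.IH[of n]
              hfun_measurable_mult[OF hfun_measurable_const hfun_measurable_mult[OF Suc Union.IH[of n]]]], of "-1"]
        by simp
    qed
    show ?case
      by (rule hfun_measurable_LIMSEQ[OF fin]) (rule LIMSEQ_indicator_UN)
  qed
qed

lemma hfun_measurable:
  assumes "f \<in> borel_measurable borel"
  shows "hmeas TYPE('n::finite) f"
proof -
  have pos: "hmeas TYPE('n::finite) f" if "f \<in> borel_measurable borel" "\<And>x. 0 \<le> f x" for f
    using that
  proof (induction rule: borel_measurable_induct_real)
    case (set A)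
    then show ?case by (rule hfun_measurable_indicator)
  next
    case (mult u c)
    then show ?case by (intro hfun_measurable_mult hfun_measurable_const)
  next
    case (add u v)
    then show ?case by (intro hfun_measurable_add)
  next
    case (seq U)
    show ?case by (rule hfun_measurable_LIMSEQ[where f = U, OF seq.IH]) (simp add: seq.hyps)
  qed
  have "f = (\<lambda>x. max 0 (f x) + (- 1) * max 0 (- f x))" by auto
  moreover have "hmeas TYPE('n::finite) (\<lambda>x. max 0 (f x) + (- 1) * max 0 (- f x))"
    using assms by (intro hfun_measurable_add hfun_measurable_mult hfun_measurable_const pos) auto
  ultimately show ?thesis by simp
qed

lemma borel_measurable_mat_fun:
  assumes "f \<in> borel_measurable borel"
  shows "(mat_fun f :: complex^'n^'n \<Rightarrow> _) \<in> borel_measurable borel"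
proof -
  \<comment> \<open>Off the Hermitian matrices the predicate chosen from in \<open>mat_fun\<close>
    is unsatisfiable, so the choice there is one and the same constant matrix.\<close>
  define B0 :: "complex^'n^'n" where "B0 = (SOME B. False)"
  have "mat_fun f A = B0" if "\<not> hermitian A" for A :: "complex^'n^'n"
  proof -
    have "A \<noteq> U ** diag_mat (\<lambda>i. complex_of_real (l i)) ** adjoint_mat U" for U l
      using that hermitian_spec_mat[of U l] unfolding spec_mat_def by metis
    then show ?thesis unfolding mat_fun_def B0_def by simp
  qed
  then have "mat_fun f = (\<lambda>A. if hermitian A then hfun f A else B0)"
    by (auto simp: hfun_def)
  then show ?thesis
    using hfun_measurable[OF assms] borel_closed[OF closed_hermitian] by (auto intro!: measurable_If)
qed

lemma borel_measurable_mat_fun_comp [measurable (raw)]: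
  fixes X :: "'a \<Rightarrow> complex^'n^'n"
  assumes "f \<in> borel_measurable borel" "X \<in> borel_measurable M"
  shows "(\<lambda>\<omega>. mat_fun f (X \<omega>)) \<in> borel_measurable M"
  using measurable_compose[OF assms(2) borel_measurable_mat_fun[OF assms(1)]] .

section \<open>The trace moment generating function\<close>

lemma integrable_matI:
  fixes X :: "'a \<Rightarrow> complex^'n^'m"
  assumes "\<And>i j. integrable M (\<lambda>\<omega>. X \<omega> $ i $ j)"
  shows "integrable M X"
proof (rule Bochner_Integration.integrable_bound)
  show "integrable M (\<lambda>\<omega>. \<Sum>i\<in>UNIV. \<Sum>j\<in>UNIV. cmod (X \<omega> $ i $ j))"
    by (intro Bochner_Integration.integrable_sum integrable_norm assms)
  show "X \<in> borel_measurable M"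
    by (intro borel_measurable_matI borel_measurable_integrable assms)
  have "norm A \<le> (\<Sum>i\<in>UNIV. \<Sum>j\<in>UNIV. cmod (A $ i $ j))" for A :: "complex^'n^'m"
    unfolding norm_vec_def by (intro order_trans[OF L2_set_le_sum] sum_mono) (auto simp: L2_set_le_sum)
  then show "AE \<omega> in M. norm (X \<omega>) \<le> norm (\<Sum>i\<in>UNIV. \<Sum>j\<in>UNIV. cmod (X \<omega> $ i $ j))"
    by (intro AE_I2) (simp add: sum_nonneg)
qed

lemma integrable_linear:
  fixes f :: "'b::euclidean_space \<Rightarrow> 'c::euclidean_space"
  assumes "linear f" "integrable M X"
  shows "integrable M (\<lambda>\<omega>. f (X \<omega>))" "(\<integral>\<omega>. f (X \<omega>) \<partial>M) = f (\<integral>\<omega>. X \<omega> \<partial>M)"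
  using assms by (auto simp: linear_conv_bounded_linear integrable_bounded_linear integral_bounded_linear)

lemma linear_mat_nth: "linear (\<lambda>A :: complex^'n^'m. A $ i $ j)"
  by (rule linearI) auto

lemma integrable_mat_nth:
  fixes X :: "'a \<Rightarrow> complex^'n^'m"
  assumes "integrable M X"
  shows "integrable M (\<lambda>\<omega>. X \<omega> $ i $ j)" "(\<integral>\<omega>. X \<omega> $ i $ j \<partial>M) = (\<integral>\<omega>. X \<omega> \<partial>M) $ i $ j"
  using integrable_linear[OF linear_mat_nth assms] by auto

lemma mat_expect_eq_integral: "integrable M X \<Longrightarrow> mat_expect M X = (\<integral>\<omega>. X \<omega> \<partial>M)"
  by (simp add: mat_expect_def vec_eq_iff integrable_mat_nth)

lemma hermitian_integral:
  assumes "integrable M X" "\<And>\<omega>. \<omega> \<in> space M \<Longrightarrow> hermitian (X \<omega>)"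
  shows "hermitian (\<integral>\<omega>. X \<omega> \<partial>M)"
proof -
  have "linear (adjoint_mat :: complex^'b^'b \<Rightarrow> _)"
    by (rule linearI) (simp_all add: adjoint_mat_add adjoint_mat_scaleR)
  then have "adjoint_mat (\<integral>\<omega>. X \<omega> \<partial>M) = (\<integral>\<omega>. adjoint_mat (X \<omega>) \<partial>M)"
    using integrable_linear(2)[OF _ assms(1), of adjoint_mat] by simp
  also have "\<dots> = (\<integral>\<omega>. X \<omega> \<partial>M)"
    using assms(2) by (intro Bochner_Integration.integral_cong) (auto simp: hermitian_def)
  finally show ?thesis by (simp add: hermitian_def)
qed

lemma linear_mult_right: "linear (\<lambda>A :: complex^'n^'n. A ** B)" for B :: "complex^'n^'n"
  by (rule linearI) (simp_all add: matrix_mult_linear)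

lemma linear_mult_left: "linear (\<lambda>A :: complex^'n^'n. B ** A)" for B :: "complex^'n^'n"
  by (rule linearI) (simp_all add: matrix_mult_linear)

lemma linear_retrace_mult: "linear (\<lambda>A :: complex^'n^'n. retrace (A ** B))"
  by (rule linearI) (simp_all add: retrace_add retrace_scaleR matrix_mult_linear)

text \<open>Golden--Thompson and the crude bound of \<open>exp (- C)\<close> by
  \<open>exp (opnorm C)\<close>. The loss is harmless, since this only supplies integrability of the
  shifted exponential.\<close>

lemma retrace_exp_diff_le:
  assumes A: "hermitian A" and C: "hermitian C"
  shows "retrace (mat_fun exp (A - C)) \<le> exp (opnorm C) * retrace (mat_fun exp A)"
proof -
  have nC: "hermitian (- C)" using C by (rule hermitian_uminus)
  have "retrace (mat_fun exp (A - C)) \<le> retrace (mat_fun exp A ** mat_fun exp (- C))"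
    using Golden_Thompson[OF A nC] by simp
  also have "\<dots> \<le> retrace (mat_fun exp A ** (exp (opnorm C) *\<^sub>R mat 1))"
  proof (rule retrace_mat_fun_mult_mono[OF A])
    fix v :: "complex^'a"
    have "\<bar>inner v (mat_fun exp (- C) *v v)\<bar> \<le> opnorm (mat_fun exp (- C)) * (norm v)\<^sup>2"
      by (rule abs_inner_le_opnorm)
    also have "\<dots> \<le> exp (opnorm C) * (norm v)\<^sup>2"
      using opnorm_exp_le[OF nC] by (intro mult_right_mono) (simp_all add: opnorm_uminus)
    finally show "inner v (mat_fun exp (- C) *v v) \<le> inner v ((exp (opnorm C) *\<^sub>R mat 1) *v v)"
      by (simp add: mat_vec_linear power2_norm_eq_inner)
  qed simp
  finally show ?thesis by (simp add: matrix_mult_linear retrace_scaleR)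
qed

text \<open>An entry is bounded by the largest eigenvalue, and that by the sum of the positive
  eigenvalues. Integrability of the trace thus controls every entry.\<close>

lemma entry_exp_le_retrace:
  assumes A: "hermitian A"
  shows "cmod (mat_fun exp A $ i $ j) \<le> retrace (mat_fun exp A)"
proof -
  obtain U l where U: "unitary_mat U" "A = spec_mat U l" using A by (rule hermitian_obtain_spec_mat)
  have "mat_fun exp A $ i $ j = (mat_fun exp A *v axis j 1) $ i"
    by (simp add: matrix_vector_mult_def axis_def if_distrib cong: if_cong)
  then have "cmod (mat_fun exp A $ i $ j) \<le> norm (mat_fun exp A *v axis j 1)"
    using Finite_Cartesian_Product.norm_nth_le[of "mat_fun exp A *v axis j 1" i] by simp
  also have "\<dots> \<le> (\<Sum>i\<in>UNIV. exp (l i)) * norm (axis j 1 :: complex^'a)"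
    unfolding U(2) mat_fun_spec_mat[OF U(1)]
    by (intro norm_spec_mat_le U(1)) (simp, intro member_le_sum, auto)
  also have "\<dots> = retrace (mat_fun exp A)"
    unfolding U(2) mat_fun_spec_mat[OF U(1)] by (simp add: retrace_spec_mat[OF U(1)])
  finally show ?thesis .
qed

lemma integrable_mat_exp:
  assumes X: "X \<in> borel_measurable M" "\<And>\<omega>. \<omega> \<in> space M \<Longrightarrow> hermitian (X \<omega>)"
    and int: "integrable M (\<lambda>\<omega>. retrace (mat_fun exp (X \<omega>)))"
  shows "integrable M (\<lambda>\<omega>. mat_fun exp (X \<omega>))"
proof (intro integrable_matI Bochner_Integration.integrable_bound[OF int])
  show "(\<lambda>\<omega>. mat_fun exp (X \<omega>) $ i $ j) \<in> borel_measurable M" for i j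
    using X(1) by (intro borel_measurable_mat_nth borel_measurable_mat_fun_comp) auto
  show "AE \<omega> in M. norm (mat_fun exp (X \<omega>) $ i $ j) \<le> norm (retrace (mat_fun exp (X \<omega>)))" for i j
    using X(2) by (intro AE_I2) (auto intro: order_trans[OF entry_exp_le_retrace])
qed

text \<open>Klein's inequality is applied to \<open>A + w\<close> and \<open>A - C\<close>: this shift is what turns the \<open>w\<close> in
  \<open>1 + C + w\<close> into the factor \<open>exp w\<close>.\<close>
lemma (in prob_space) trace_mgf_bound:
  fixes V :: "'i \<Rightarrow> 'a \<Rightarrow> complex^'n^'n" and x q :: "complex^'n^'n \<Rightarrow> complex^'n^'n"
  assumes "finite I" and indep: "indep_vars (\<lambda>_. borel) V I"
    and meas: "x \<in> borel_measurable borel" "q \<in> borel_measurable borel"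
    and C: "hermitian C"
    and herm: "\<And>i \<omega>. i \<in> I \<Longrightarrow> \<omega> \<in> space M \<Longrightarrow> hermitian (x (V i \<omega>))"
    and q: "\<And>i \<omega> v. i \<in> I \<Longrightarrow> \<omega> \<in> space M \<Longrightarrow> inner v (mat_fun exp (x (V i \<omega>)) *v v) \<le> inner v (q (V i \<omega>) *v v)"
    and qi: "\<And>i. i \<in> I \<Longrightarrow> integrable M (\<lambda>\<omega>. q (V i \<omega>))"
    and qe: "\<And>i v. i \<in> I \<Longrightarrow> inner v ((\<integral>\<omega>. q (V i \<omega>) \<partial>M) *v v) \<le> inner v ((mat 1 + C + w *\<^sub>R mat 1) *v v)"
  shows "integrable M (\<lambda>\<omega>. retrace (mat_fun exp ((\<Sum>i\<in>I. x (V i \<omega>)) - real (card I) *\<^sub>R C))) \<and>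
    (\<integral>\<omega>. retrace (mat_fun exp ((\<Sum>i\<in>I. x (V i \<omega>)) - real (card I) *\<^sub>R C)) \<partial>M) \<le> real CARD('n) * exp (real (card I) * w)"
  using \<open>finite I\<close> indep herm q qi qe
proof (induction I)
  case empty
  have "mat_fun exp (0 :: complex^'n^'n) = mat_fun (\<lambda>x. exp (0 * x)) 0"
    using mat_fun_scaleR_arg[OF hermitian_zero, of exp 0] by (simp only: scaleR_zero_left)
  also have "\<dots> = mat 1"
    using mat_fun_const[OF hermitian_zero, of 1] by (simp only: mult_zero_left exp_zero scaleR_one)
  finally have "mat_fun exp (0 :: complex^'n^'n) = mat 1" .
  then show ?case by (simp add: retrace_one prob_space)
next
  case (insert k I)
  note [measurable] = meas
  have rv [measurable]: "V i \<in> borel_measurable M" if "i \<in> insert k I" for i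
    using insert.prems(1) that by (auto simp: indep_vars_def)
  have IH: "integrable M (\<lambda>\<omega>. retrace (mat_fun exp ((\<Sum>i\<in>I. x (V i \<omega>)) - real (card I) *\<^sub>R C)))"
    "(\<integral>\<omega>. retrace (mat_fun exp ((\<Sum>i\<in>I. x (V i \<omega>)) - real (card I) *\<^sub>R C)) \<partial>M) \<le> real CARD('n) * exp (real (card I) * w)"
    using insert.IH insert.prems indep_vars_subset[OF insert.prems(1), of I] by auto
  define A where "A = (\<lambda>\<omega>. (\<Sum>i\<in>I. x (V i \<omega>)) - real (card I) *\<^sub>R C)"
  define P where "P = (\<lambda>\<omega>. mat_fun exp (A \<omega> - C))"
  define Q where "Q = (\<lambda>\<omega>. q (V k \<omega>))"
  define B where "B = (\<integral>\<omega>. Q \<omega> \<partial>M)"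
  have Ah: "hermitian (A \<omega>)" if "\<omega> \<in> space M" for \<omega>
    unfolding A_def using insert.prems(2) that C by (intro hermitian_intros) auto
  have xh: "hermitian (x (V k \<omega>))" if "\<omega> \<in> space M" for \<omega> using insert.prems(2) that by auto
  have Am [measurable]: "A \<in> borel_measurable M"
    unfolding A_def using rv by (auto intro!: borel_measurable_diff borel_measurable_sum)
  have xm [measurable]: "(\<lambda>\<omega>. x (V k \<omega>)) \<in> borel_measurable M" using rv[of k] by simp
  have Pint: "integrable M P"
    unfolding P_def
  proof (rule integrable_mat_exp)
    show "(\<lambda>\<omega>. A \<omega> - C) \<in> borel_measurable M" by simp
    show "hermitian (A \<omega> - C)" if "\<omega> \<in> space M" for \<omega> using Ah[OF that] C by (rule hermitian_diff)
    show "integrable M (\<lambda>\<omega>. retrace (mat_fun exp (A \<omega> - C)))"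
    proof (rule Bochner_Integration.integrable_bound)
      show "integrable M (\<lambda>\<omega>. exp (opnorm C) * retrace (mat_fun exp (A \<omega>)))"
        using IH(1) unfolding A_def by simp
      show "(\<lambda>\<omega>. retrace (mat_fun exp (A \<omega> - C))) \<in> borel_measurable M"
        by measurable
      show "AE \<omega> in M. norm (retrace (mat_fun exp (A \<omega> - C))) \<le> norm (exp (opnorm C) * retrace (mat_fun exp (A \<omega>)))"
        using Ah C by (intro AE_I2)
          (auto simp: retrace_mat_fun_nonneg hermitian_diff abs_of_nonneg retrace_exp_diff_le)
    qed
  qed
  have Qint: "integrable M Q" unfolding Q_def using insert.prems(4) by auto
  \<comment> \<open>\<open>P\<close> depends on the old summands only and \<open>Q\<close> on the
    new one. Independence is passed to scalar entries so that the expectation of each product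
    factorises, which makes the expected trace of \<open>P ** Q\<close> the trace of the product of
    the expectations.\<close>
  have ind: "indep_var borel (\<lambda>\<omega>. P \<omega> $ a $ b) borel (\<lambda>\<omega>. Q \<omega> $ b $ a)" for a b
  proof -
    define g where "g = (\<lambda>v. mat_fun exp ((\<Sum>i\<in>I. x (v i)) - real (card I) *\<^sub>R C - C) $ a $ b)"
    define h where "h = (\<lambda>v. q (v k) $ b $ a)"
    have expm: "(exp :: real \<Rightarrow> real) \<in> borel_measurable borel"
      by (intro borel_measurable_continuous_onI continuous_intros)
    have comp: "(\<lambda>v. y (v i)) \<in> borel_measurable (PiM J (\<lambda>_. borel))"
      if "i \<in> J" "y \<in> borel_measurable borel" for i J and y :: "complex^'n^'n \<Rightarrow> complex^'n^'n"
      by (rule measurable_compose[OF measurable_component_singleton[OF that(1)] that(2)])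
    have "indep_var (PiM I (\<lambda>_. borel)) (\<lambda>\<omega>. restrict (\<lambda>i. V i \<omega>) I)
       (PiM {k} (\<lambda>_. borel)) (\<lambda>\<omega>. restrict (\<lambda>i. V i \<omega>) {k})"
      using insert.hyps by (intro indep_var_restrict[OF insert.prems(1)]) auto
    moreover have "g \<in> borel_measurable (PiM I (\<lambda>_. borel))"
      unfolding g_def by (intro borel_measurable_mat_nth borel_measurable_mat_fun_comp borel_measurable_diff
        borel_measurable_sum borel_measurable_const comp meas(1)
        expm) auto
    moreover have "h \<in> borel_measurable (PiM {k} (\<lambda>_. borel))"
      unfolding h_def
      by (intro borel_measurable_mat_nth comp meas(2)) auto
    ultimately have "indep_var borel (g \<circ> (\<lambda>\<omega>. restrict (\<lambda>i. V i \<omega>) I)) borel (h \<circ> (\<lambda>\<omega>. restrict (\<lambda>i. V i \<omega>) {k}))"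
      by (rule indep_var_compose)
    moreover have "g \<circ> (\<lambda>\<omega>. restrict (\<lambda>i. V i \<omega>) I) = (\<lambda>\<omega>. P \<omega> $ a $ b)"
      by (auto simp: g_def P_def A_def fun_eq_iff cong: sum.cong)
    moreover have "h \<circ> (\<lambda>\<omega>. restrict (\<lambda>i. V i \<omega>) {k}) = (\<lambda>\<omega>. Q \<omega> $ b $ a)"
      by (auto simp: h_def Q_def)
    ultimately show ?thesis by simp
  qed
  have tr: "retrace (P \<omega> ** Q \<omega>) = Re (\<Sum>a\<in>UNIV. \<Sum>b\<in>UNIV. P \<omega> $ a $ b * Q \<omega> $ b $ a)" for \<omega>
    by (simp add: retrace_def trace_def matrix_matrix_mult_def)
  have PQi: "integrable M (\<lambda>\<omega>. P \<omega> $ a $ b * Q \<omega> $ b $ a)" for a b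
    using indep_var_integrable[OF ind] integrable_mat_nth(1)[OF Pint] integrable_mat_nth(1)[OF Qint] by blast
  have PQ: "integrable M (\<lambda>\<omega>. retrace (P \<omega> ** Q \<omega>))"
    unfolding tr by (intro integrable_Re Bochner_Integration.integrable_sum PQi)
  have "(\<integral>\<omega>. retrace (P \<omega> ** Q \<omega>) \<partial>M) = Re (\<Sum>a\<in>UNIV. \<Sum>b\<in>UNIV. (\<integral>\<omega>. P \<omega> $ a $ b * Q \<omega> $ b $ a \<partial>M))"
    unfolding tr by (subst integral_Re) (auto intro!: Bochner_Integration.integrable_sum PQi simp: Bochner_Integration.integral_sum PQi)
  also have "\<dots> = Re (\<Sum>a\<in>UNIV. \<Sum>b\<in>UNIV. (\<integral>\<omega>. P \<omega> \<partial>M) $ a $ b * B $ b $ a)"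
    using indep_var_lebesgue_integral[OF ind] integrable_mat_nth[OF Pint] integrable_mat_nth[OF Qint]
    by (simp add: B_def)
  also have "\<dots> = retrace ((\<integral>\<omega>. P \<omega> \<partial>M) ** B)"
    by (simp add: retrace_def trace_def matrix_matrix_mult_def)
  also have "\<dots> = (\<integral>\<omega>. retrace (P \<omega> ** B) \<partial>M)"
    using integrable_linear(2)[OF linear_retrace_mult Pint] by simp
  also have "\<dots> \<le> (\<integral>\<omega>. exp w * retrace (mat_fun exp (A \<omega>)) \<partial>M)"
  proof (rule integral_mono)
    show "integrable M (\<lambda>\<omega>. retrace (P \<omega> ** B))" by (rule integrable_linear(1)[OF linear_retrace_mult Pint])
    show "integrable M (\<lambda>\<omega>. exp w * retrace (mat_fun exp (A \<omega>)))" using IH(1) unfolding A_def by simp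
    fix \<omega> assume \<omega>: "\<omega> \<in> space M"
    have AC: "hermitian (A \<omega> - C)" using Ah[OF \<omega>] C by (rule hermitian_diff)
    have Aw: "hermitian (A \<omega> + w *\<^sub>R mat 1)" using Ah[OF \<omega>] by (intro hermitian_intros)
    have "retrace (P \<omega> ** B) \<le> retrace (P \<omega> ** (mat 1 + C + w *\<^sub>R mat 1))"
      unfolding P_def B_def Q_def using insert.prems(5) by (intro retrace_mat_fun_mult_mono AC) auto
    also have "mat 1 + C + w *\<^sub>R mat 1 = mat 1 + ((A \<omega> + w *\<^sub>R mat 1) - (A \<omega> - C))" by simp
    also have "retrace (P \<omega> ** \<dots>) \<le> retrace (mat_fun exp (A \<omega> + w *\<^sub>R mat 1))"
      unfolding P_def by (rule Klein_inequality[OF Aw AC])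
    also have "\<dots> = exp w * retrace (mat_fun exp (A \<omega>))"
      using Ah[OF \<omega>] by (simp add: mat_fun_exp_add_const retrace_scaleR)
    finally show "retrace (P \<omega> ** B) \<le> exp w * retrace (mat_fun exp (A \<omega>))" .
  qed
  also have "\<dots> \<le> exp w * (real CARD('n) * exp (real (card I) * w))"
    using IH(2) by (simp add: A_def)
  also have "\<dots> = real CARD('n) * exp (real (card (insert k I)) * w)"
    using insert.hyps by (simp add: algebra_simps exp_add)
  finally have E: "(\<integral>\<omega>. retrace (P \<omega> ** Q \<omega>) \<partial>M) \<le> real CARD('n) * exp (real (card (insert k I)) * w)" .
  have eq: "(\<Sum>i\<in>insert k I. x (V i \<omega>)) - real (card (insert k I)) *\<^sub>R C = A \<omega> - C + x (V k \<omega>)" for \<omega>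
    using insert.hyps by (simp add: A_def algebra_simps)
  have le: "retrace (mat_fun exp (A \<omega> - C + x (V k \<omega>))) \<le> retrace (P \<omega> ** Q \<omega>)" if \<omega>: "\<omega> \<in> space M" for \<omega>
  proof -
    have AC: "hermitian (A \<omega> - C)" using Ah[OF \<omega>] C by (rule hermitian_diff)
    have "retrace (mat_fun exp (A \<omega> - C + x (V k \<omega>))) \<le> retrace (P \<omega> ** mat_fun exp (x (V k \<omega>)))"
      unfolding P_def by (rule Golden_Thompson[OF AC xh[OF \<omega>]])
    also have "\<dots> \<le> retrace (P \<omega> ** Q \<omega>)"
      unfolding P_def Q_def using insert.prems(3) \<omega> by (intro retrace_mat_fun_mult_mono AC) auto
    finally show ?thesis .
  qed
  have pos: "0 \<le> retrace (mat_fun exp (A \<omega> - C + x (V k \<omega>)))" if \<omega>: "\<omega> \<in> space M" for \<omega>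
    using Ah[OF \<omega>] xh[OF \<omega>] C by (intro retrace_mat_fun_nonneg hermitian_intros) auto
  have int: "integrable M (\<lambda>\<omega>. retrace (mat_fun exp (A \<omega> - C + x (V k \<omega>))))"
  proof (rule Bochner_Integration.integrable_bound[OF PQ])
    show "(\<lambda>\<omega>. retrace (mat_fun exp (A \<omega> - C + x (V k \<omega>)))) \<in> borel_measurable M"
      by measurable
    show "AE \<omega> in M. norm (retrace (mat_fun exp (A \<omega> - C + x (V k \<omega>)))) \<le> norm (retrace (P \<omega> ** Q \<omega>))"
      using le pos by (intro AE_I2) (smt (verit) real_norm_def)
  qed
  have "(\<integral>\<omega>. retrace (mat_fun exp (A \<omega> - C + x (V k \<omega>))) \<partial>M) \<le> (\<integral>\<omega>. retrace (P \<omega> ** Q \<omega>) \<partial>M)"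
    by (intro integral_mono int PQ le)
  then show ?case unfolding eq using int E by linarith
qed

section \<open>Deviation bounds and Lepski's selection rule\<close>

text \<open>Markov's inequality for the trace moment. The sign of \<open>r\<close> is free and
  \<open>\<phi>\<close> obeys only an upper bound, so that both tails are instances:
  \<open>\<psi>\<close> with \<open>\<theta>\<close>, and its reflection with
  \<open>- \<theta>\<close>.\<close>

lemma (in prob_space) trace_exp_tail:
  fixes V :: "'i \<Rightarrow> 'a \<Rightarrow> complex^'n^'n" and Y0 :: "'a \<Rightarrow> complex^'n^'n"
  assumes "finite I" and indep: "indep_vars (\<lambda>_. borel) V I"
    and herm: "\<And>i \<omega>. i \<in> I \<Longrightarrow> \<omega> \<in> space M \<Longrightarrow> hermitian (V i \<omega>)"
    and ident: "\<And>i. i \<in> I \<Longrightarrow> distr M borel (V i) = distr M borel Y0"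
    and Y0_herm: "\<And>\<omega>. \<omega> \<in> space M \<Longrightarrow> hermitian (Y0 \<omega>)"
    and Y0: "integrable M Y0" "integrable M (\<lambda>\<omega>. Y0 \<omega> ** Y0 \<omega>)"
    and S: "hermitian S"
    and \<phi>: "\<phi> \<in> borel_measurable borel" "\<And>x. exp (\<phi> x) \<le> 1 + x + x\<^sup>2 / 2"
    and var: "\<And>v. inner v ((\<integral>\<omega>. (Y0 \<omega> - S) ** (Y0 \<omega> - S) \<partial>M) *v v) \<le> \<tau>\<^sup>2 * (norm v)\<^sup>2"
  shows "prob {\<omega> \<in> space M. exp a \<le> retrace (mat_fun exp ((\<Sum>i\<in>I. mat_fun \<phi> (r *\<^sub>R (V i \<omega> - S)))
      - real (card I) *\<^sub>R (r *\<^sub>R ((\<integral>\<omega>. Y0 \<omega> \<partial>M) - S))))}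
    \<le> real CARD('n) * exp (real (card I) * (r\<^sup>2 * \<tau>\<^sup>2 / 2) - a)" (is "prob {\<omega> \<in> space M. _ \<le> ?f \<omega>} \<le> _")
proof -
  define EY where "EY = (\<integral>\<omega>. Y0 \<omega> \<partial>M)"
  define x where "x = (\<lambda>y. mat_fun \<phi> (r *\<^sub>R (y - S)))"
  \<comment> \<open>The quadratic that dominates \<open>exp (\<phi> z)\<close> at
    \<open>z = r *\<^sub>R (y - S)\<close>; its expectation involves only the mean and the second
    moment.\<close>
  define q where "q = (\<lambda>y. mat 1 + r *\<^sub>R (y - S) + (r\<^sup>2 / 2) *\<^sub>R ((y - S) ** (y - S)))"
  note [measurable] = borel_measurable_integrable[OF Y0(1)]
  have xm [measurable]: "x \<in> borel_measurable borel"
    unfolding x_def by (intro borel_measurable_mat_fun_comp \<phi>) simp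
  have qm [measurable]: "q \<in> borel_measurable borel"
    unfolding q_def by measurable
  have rv [measurable]: "V i \<in> borel_measurable M" if "i \<in> I" for i
    using indep that by (auto simp: indep_vars_def)
  have sq_eq: "(y - S) ** (y - S) = y ** y - y ** S - S ** y + S ** S" for y
    by (simp add: matrix_mult_linear)
  have sq: "integrable M (\<lambda>\<omega>. (Y0 \<omega> - S) ** (Y0 \<omega> - S))"
    unfolding sq_eq using Y0 integrable_linear(1)[OF linear_mult_right Y0(1)] integrable_linear(1)[OF linear_mult_left Y0(1)]
    by (intro Bochner_Integration.integrable_add Bochner_Integration.integrable_diff) auto
  have q0: "integrable M (\<lambda>\<omega>. q (Y0 \<omega>))"
    unfolding q_def using Y0 sq by auto
  have q0E: "(\<integral>\<omega>. q (Y0 \<omega>) \<partial>M) = mat 1 + r *\<^sub>R (EY - S) + (r\<^sup>2 / 2) *\<^sub>R (\<integral>\<omega>. (Y0 \<omega> - S) ** (Y0 \<omega> - S) \<partial>M)"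
    unfolding q_def EY_def using Y0 sq by (simp add: prob_space)
  have EYh: "hermitian EY" unfolding EY_def by (rule hermitian_integral[OF Y0(1) Y0_herm])
  have "integrable M ?f \<and> (\<integral>\<omega>. ?f \<omega> \<partial>M) \<le> real CARD('n) * exp (real (card I) * (r\<^sup>2 * \<tau>\<^sup>2 / 2))"
    unfolding EY_def[symmetric] x_def[symmetric, THEN fun_cong]
  proof (rule trace_mgf_bound[OF \<open>finite I\<close> indep xm qm])
    show "hermitian (r *\<^sub>R (EY - S))" using EYh S by (intro hermitian_intros)
    fix i assume i: "i \<in> I"
    show "hermitian (x (V i \<omega>))" if "\<omega> \<in> space M" for \<omega>
      unfolding x_def using herm[OF i that] S by (intro hermitian_mat_fun hermitian_intros)
    show "inner v (mat_fun exp (x (V i \<omega>)) *v v) \<le> inner v (q (V i \<omega>) *v v)" if "\<omega> \<in> space M" for \<omega> v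
    proof -
      have h: "hermitian (r *\<^sub>R (V i \<omega> - S))" using herm[OF i that] S by (intro hermitian_intros)
      have "q (V i \<omega>) = mat_fun (\<lambda>x. 1 + x + x\<^sup>2 / 2) (r *\<^sub>R (V i \<omega> - S))"
        unfolding mat_fun_quadratic[OF h] q_def by (simp add: matrix_mult_linear power2_eq_square scaleR_diff_right)
      then show ?thesis
        unfolding x_def using mat_fun_mono[OF h \<phi>(2)] by (simp add: mat_fun_compose[OF h])
    qed
    have "integrable (distr M borel (V i)) q" "(\<integral>y. q y \<partial>distr M borel (V i)) = (\<integral>\<omega>. q (Y0 \<omega>) \<partial>M)"
      unfolding ident[OF i] using q0 by (simp_all add: integrable_distr_eq integral_distr)
    then show "integrable M (\<lambda>\<omega>. q (V i \<omega>))"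
      and "inner v ((\<integral>\<omega>. q (V i \<omega>) \<partial>M) *v v)
        \<le> inner v ((mat 1 + r *\<^sub>R (EY - S) + (r\<^sup>2 * \<tau>\<^sup>2 / 2) *\<^sub>R mat 1) *v v)" for v
      using rv[OF i] mult_left_mono[OF var[of v], of "r\<^sup>2 / 2"]
      by (auto simp: integrable_distr_eq integral_distr q0E mat_vec_linear inner_add_right power2_norm_eq_inner mult_ac)
  qed
  then have int: "integrable M ?f" and le: "(\<integral>\<omega>. ?f \<omega> \<partial>M) \<le> real CARD('n) * exp (real (card I) * (r\<^sup>2 * \<tau>\<^sup>2 / 2))"
    by auto
  have pos: "0 \<le> ?f \<omega>" if "\<omega> \<in> space M" for \<omega>
    using herm that S EYh unfolding EY_def[symmetric]
    by (intro retrace_mat_fun_nonneg hermitian_intros hermitian_mat_fun) auto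
  have "prob {\<omega> \<in> space M. exp a \<le> ?f \<omega>} \<le> (\<integral>\<omega>. ?f \<omega> \<partial>M) / exp a"
    by (rule integral_Markov_inequality_measure[OF int sets.empty_sets]) (use pos in auto)
  also have "\<dots> \<le> real CARD('n) * exp (real (card I) * (r\<^sup>2 * \<tau>\<^sup>2 / 2)) / exp a"
    using le by (rule divide_right_mono) simp
  finally show ?thesis by (simp add: exp_diff)
qed

text \<open>The level \<open>s\<close> stays independent of \<open>\<theta>\<close>, because
  different grid points will be used with different levels, not with the level optimal for their
  truncation.\<close>

lemma (in prob_space) opnorm_deviation:
  fixes V :: "'i \<Rightarrow> 'a \<Rightarrow> complex^'n^'n" and Y0 :: "'a \<Rightarrow> complex^'n^'n"
  assumes "finite I" "I \<noteq> {}" and indep: "indep_vars (\<lambda>_. borel) V I"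
    and herm: "\<And>i \<omega>. i \<in> I \<Longrightarrow> \<omega> \<in> space M \<Longrightarrow> hermitian (V i \<omega>)"
    and ident: "\<And>i. i \<in> I \<Longrightarrow> distr M borel (V i) = distr M borel Y0"
    and Y0_herm: "\<And>\<omega>. \<omega> \<in> space M \<Longrightarrow> hermitian (Y0 \<omega>)"
    and Y0: "integrable M Y0" "integrable M (\<lambda>\<omega>. Y0 \<omega> ** Y0 \<omega>)"
    and S: "hermitian S"
    and \<psi>: "\<psi> \<in> borel_measurable borel" "\<And>x. exp (\<psi> x) \<le> 1 + x + x\<^sup>2 / 2" "\<And>x. exp (- \<psi> x) \<le> 1 - x + x\<^sup>2 / 2"
    and var: "\<And>v. inner v ((\<integral>\<omega>. (Y0 \<omega> - S) ** (Y0 \<omega> - S) \<partial>M) *v v) \<le> \<tau>\<^sup>2 * (norm v)\<^sup>2"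
    and \<theta>: "0 < \<theta>"
  shows "prob {\<omega> \<in> space M. \<not> opnorm ((1 / (real (card I) * \<theta>)) *\<^sub>R (\<Sum>i\<in>I. mat_fun \<psi> (\<theta> *\<^sub>R (V i \<omega> - S)))
      - ((\<integral>\<omega>. Y0 \<omega> \<partial>M) - S)) \<le> s}
    \<le> 2 * real CARD('n) * exp (real (card I) * (\<theta>\<^sup>2 * \<tau>\<^sup>2 / 2) - real (card I) * \<theta> * s)"
proof -
  define EY where "EY = (\<integral>\<omega>. Y0 \<omega> \<partial>M)"
  define m where "m = real (card I)"
  have m: "0 < m" using assms(1,2) by (simp add: m_def card_gt_0_iff)
  define H where "H = (\<lambda>\<phi> r \<omega>. (\<Sum>i\<in>I. mat_fun \<phi> (r *\<^sub>R (V i \<omega> - S))) - m *\<^sub>R (r *\<^sub>R (EY - S)))"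
  \<comment> \<open>The lower bound on \<open>\<psi>\<close> is the upper bound on this reflection.
    With \<open>- \<theta>\<close> in place of \<open>\<theta>\<close> it produces exactly the
    negative of the centred sum.\<close>
  define \<phi> where "\<phi> = (\<lambda>x. - \<psi> (- x))"
  have \<phi>: "\<phi> \<in> borel_measurable borel" "\<And>x. exp (\<phi> x) \<le> 1 + x + x\<^sup>2 / 2"
    using \<psi>(1) \<psi>(3)[of "- x" for x] by (auto simp: \<phi>_def)
  have EYh: "hermitian EY" unfolding EY_def by (rule hermitian_integral[OF Y0(1) Y0_herm])
  have Hm: "H f r \<in> borel_measurable M" if "f \<in> borel_measurable borel" for f r
    unfolding H_def
  proof (intro borel_measurable_diff borel_measurable_sum borel_measurable_mat_fun_comp that)
    fix i assume "i \<in> I"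
    then have [measurable]: "V i \<in> borel_measurable M" using indep by (auto simp: indep_vars_def)
    show "(\<lambda>\<omega>. r *\<^sub>R (V i \<omega> - S)) \<in> borel_measurable M" by simp
  qed simp
  have expm: "(exp :: real \<Rightarrow> real) \<in> borel_measurable borel"
    by (intro borel_measurable_continuous_onI continuous_intros)
  define B where "B = (\<lambda>f r. {\<omega> \<in> space M. exp (m * \<theta> * s) \<le> retrace (mat_fun exp (H f r \<omega>))})"
  have Bm: "B f r \<in> events" if "f \<in> borel_measurable borel" for f r
  proof -
    have "(\<lambda>\<omega>. retrace (mat_fun exp (H f r \<omega>))) \<in> borel_measurable M"
      using measurable_compose[OF borel_measurable_mat_fun_comp[OF expm Hm[OF that]] borel_measurable_retrace] .
    then show ?thesis unfolding B_def by measurable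
  qed
  have P1: "prob (B \<psi> \<theta>) \<le> real CARD('n) * exp (m * (\<theta>\<^sup>2 * \<tau>\<^sup>2 / 2) - m * \<theta> * s)"
    unfolding B_def H_def EY_def m_def
    using trace_exp_tail[OF assms(1) indep herm ident Y0_herm Y0 S \<psi>(1,2) var] by blast
  have P2: "prob (B \<phi> (- \<theta>)) \<le> real CARD('n) * exp (m * (\<theta>\<^sup>2 * \<tau>\<^sup>2 / 2) - m * \<theta> * s)"
    unfolding B_def H_def EY_def m_def
    using trace_exp_tail[OF assms(1) indep herm ident Y0_herm Y0 S \<phi> var, of "real (card I) * \<theta> * s" "- \<theta>"] by simp
  have "prob {\<omega> \<in> space M. \<not> opnorm ((1 / (m * \<theta>)) *\<^sub>R (\<Sum>i\<in>I. mat_fun \<psi> (\<theta> *\<^sub>R (V i \<omega> - S))) - (EY - S)) \<le> s}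
      \<le> prob (B \<psi> \<theta> \<union> B \<phi> (- \<theta>))"
  proof (rule finite_measure_mono)
    show "B \<psi> \<theta> \<union> B \<phi> (- \<theta>) \<in> events" using Bm \<psi>(1) \<phi>(1) by auto
    show "{\<omega> \<in> space M. \<not> opnorm ((1 / (m * \<theta>)) *\<^sub>R (\<Sum>i\<in>I. mat_fun \<psi> (\<theta> *\<^sub>R (V i \<omega> - S))) - (EY - S)) \<le> s}
        \<subseteq> B \<psi> \<theta> \<union> B \<phi> (- \<theta>)"
    proof (rule subsetI, rule ccontr)
      fix \<omega>
      assume "\<omega> \<in> {\<omega> \<in> space M. \<not> opnorm ((1 / (m * \<theta>)) *\<^sub>R (\<Sum>i\<in>I. mat_fun \<psi> (\<theta> *\<^sub>R (V i \<omega> - S))) - (EY - S)) \<le> s}"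
      then have \<omega>: "\<omega> \<in> space M" and n: "\<not> opnorm ((1 / (m * \<theta>)) *\<^sub>R (\<Sum>i\<in>I. mat_fun \<psi> (\<theta> *\<^sub>R (V i \<omega> - S))) - (EY - S)) \<le> s"
        by auto
      assume "\<omega> \<notin> B \<psi> \<theta> \<union> B \<phi> (- \<theta>)"
      then have b: "retrace (mat_fun exp (H \<psi> \<theta> \<omega>)) \<le> exp (m * \<theta> * s)"
        "retrace (mat_fun exp (H \<phi> (- \<theta>) \<omega>)) \<le> exp (m * \<theta> * s)"
        using \<omega> by (auto simp: B_def)
      have Vh: "hermitian (\<theta> *\<^sub>R (V i \<omega> - S))" if "i \<in> I" for i
        using herm[OF that \<omega>] S by (intro hermitian_intros)
      have "mat_fun \<phi> ((- \<theta>) *\<^sub>R (V i \<omega> - S)) = - mat_fun \<psi> (\<theta> *\<^sub>R (V i \<omega> - S))" if "i \<in> I" for i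
        using mat_fun_uminus[OF Vh[OF that], of \<phi>] mat_fun_uminus_fun[OF Vh[OF that], of \<psi>]
        by (simp add: \<phi>_def)
      then have neg: "H \<phi> (- \<theta>) \<omega> = - H \<psi> \<theta> \<omega>"
        by (simp add: H_def sum_negf)
      have "hermitian (H \<psi> \<theta> \<omega>)"
        unfolding H_def using Vh S EYh
        by (intro hermitian_diff hermitian_sum hermitian_scaleR[of "_ *\<^sub>R _"] hermitian_scaleR[of "EY - S"] hermitian_mat_fun) auto
      then have le: "opnorm (H \<psi> \<theta> \<omega>) \<le> m * \<theta> * s"
        using b unfolding neg by (rule opnorm_le_of_retrace_exp)
      have "(1 / (m * \<theta>)) *\<^sub>R (\<Sum>i\<in>I. mat_fun \<psi> (\<theta> *\<^sub>R (V i \<omega> - S))) - (EY - S) = (1 / (m * \<theta>)) *\<^sub>R H \<psi> \<theta> \<omega>"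
        using m \<theta> by (simp add: H_def scaleR_diff_right)
      then have "opnorm ((1 / (m * \<theta>)) *\<^sub>R (\<Sum>i\<in>I. mat_fun \<psi> (\<theta> *\<^sub>R (V i \<omega> - S))) - (EY - S)) \<le> (1 / (m * \<theta>)) * (m * \<theta> * s)"
        using le m \<theta> by (simp add: opnorm_scaleR field_simps)
      then show False using n m \<theta> by simp
    qed
  qed
  also have "\<dots> \<le> prob (B \<psi> \<theta>) + prob (B \<phi> (- \<theta>))"
    using Bm \<psi>(1) \<phi>(1) by (intro measure_Un_le) auto
  also have "\<dots> \<le> 2 * real CARD('n) * exp (m * (\<theta>\<^sup>2 * \<tau>\<^sup>2 / 2) - m * \<theta> * s)"
    using P1 P2 by simp
  finally show ?thesis unfolding EY_def m_def .
qed

text \<open>Takes the place of conditioning on \<open>X\<close>: independence makes the joint law a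
  product measure, and integrating the sections over the law of \<open>X\<close> preserves a bound
  that is uniform on \<open>G\<close>.\<close>

lemma (in prob_space) indep_var_prob_section_le:
  assumes ind: "indep_var N1 X N2 Y"
    and B: "B \<in> sets (N1 \<Otimes>\<^sub>M N2)" and G: "G \<in> sets N1"
    and le: "\<And>x. x \<in> G \<Longrightarrow> prob {\<omega> \<in> space M. (x, Y \<omega>) \<in> B} \<le> c" and c: "0 \<le> c"
  shows "prob {\<omega> \<in> space M. X \<omega> \<in> G \<and> (X \<omega>, Y \<omega>) \<in> B} \<le> c"
proof -
  have X [measurable]: "X \<in> measurable M N1" and Y [measurable]: "Y \<in> measurable M N2"
    using indep_var_rv1[OF ind] indep_var_rv2[OF ind] by auto
  interpret DX: prob_space "distr M N1 X" by (rule prob_space_distr[OF X])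
  interpret DY: prob_space "distr M N2 Y" by (rule prob_space_distr[OF Y])
  \<comment> \<open>Sections at points outside \<open>G\<close> become empty, so the bound is
    required on \<open>G\<close> only.\<close>
  define B' where "B' = B \<inter> (G \<times> space N2)"
  have B'm: "B' \<in> sets (N1 \<Otimes>\<^sub>M N2)" unfolding B'_def using B G by auto
  have "emeasure M {\<omega> \<in> space M. X \<omega> \<in> G \<and> (X \<omega>, Y \<omega>) \<in> B} = emeasure (distr M (N1 \<Otimes>\<^sub>M N2) (\<lambda>\<omega>. (X \<omega>, Y \<omega>))) B'"
    using measurable_space[OF Y] B'm
    by (subst emeasure_distr) (auto simp: B'_def intro!: arg_cong[where f="emeasure M"])
  also have "\<dots> = emeasure (distr M N1 X \<Otimes>\<^sub>M distr M N2 Y) B'"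
    using ind by (simp add: indep_var_distribution_eq)
  also have "\<dots> = (\<integral>\<^sup>+x. emeasure (distr M N2 Y) (Pair x -` B') \<partial>distr M N1 X)"
    using B'm by (intro DY.emeasure_pair_measure_alt) simp
  also have "\<dots> \<le> (\<integral>\<^sup>+x. ennreal c \<partial>distr M N1 X)"
  proof (rule nn_integral_mono)
    fix x
    show "emeasure (distr M N2 Y) (Pair x -` B') \<le> ennreal c"
    proof (cases "x \<in> G")
      case True
      have "emeasure (distr M N2 Y) (Pair x -` B') = emeasure M (Y -` (Pair x -` B') \<inter> space M)"
        using sets_Pair1[OF B'm] by (intro emeasure_distr) auto
      also have "Y -` (Pair x -` B') \<inter> space M = {\<omega> \<in> space M. (x, Y \<omega>) \<in> B}"
        using True measurable_space[OF Y] by (auto simp: B'_def)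
      finally show ?thesis using le[OF True] by (simp add: emeasure_eq_measure ennreal_leI)
    next
      case False
      then have "Pair x -` B' = {}" by (auto simp: B'_def)
      then show ?thesis by simp
    qed
  qed
  also have "\<dots> = ennreal c" using DX.emeasure_space_1 by simp
  finally show ?thesis using c by (simp add: emeasure_eq_measure)
qed

text \<open>The deterministic core of Lepski's method. The oracle \<open>j\<close> passes its own
  test by the triangle inequality, so the selected index \<open>i\<close> is at most
  \<open>j\<close>. Since \<open>i\<close> passed its test against \<open>j\<close>, its estimate is
  within \<open>h j\<close> of the one at \<open>j\<close>, whose error is
  \<open>e j\<close>.\<close>

lemma Lepski_oracle:
  fixes T :: "int \<Rightarrow> complex^'n^'n"
  assumes J: "finite J" "j \<in> J"
    and err: "\<And>k. k \<in> J \<Longrightarrow> j \<le> k \<Longrightarrow> opnorm (T k - E) \<le> e k"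
    and thr: "\<And>k. k \<in> J \<Longrightarrow> j < k \<Longrightarrow> e j + e k \<le> h k"
    and R: "h j + e j \<le> R" "0 \<le> h j"
  shows "opnorm (T (Min {i \<in> J. \<forall>k\<in>J. k > i \<longrightarrow> opnorm (T k - T i) \<le> h k}) - E) \<le> R"
proof -
  let ?S = "{i \<in> J. \<forall>k\<in>J. k > i \<longrightarrow> opnorm (T k - T i) \<le> h k}"
  have "opnorm (T k - T j) \<le> h k" if "k \<in> J" "j < k" for k
    using opnorm_triangle[of "T k" "T j" E] err[of k] err[of j] thr[of k] that J(2)
    by (simp add: opnorm_minus_commute[of E])
  then have j: "j \<in> ?S" using J by auto
  have fin: "finite ?S" using J by auto
  define i where "i = Min ?S"
  have i: "i \<in> ?S" unfolding i_def using fin j by (intro Min_in) auto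
  have "i \<le> j" unfolding i_def using fin j by simp
  show ?thesis
  proof (cases "i = j")
    case True
    then show ?thesis using err[OF J(2)] R unfolding i_def by simp
  next
    case False
    then have "opnorm (T j - T i) \<le> h j" using i \<open>i \<le> j\<close> J(2) by auto
    then show ?thesis
      using opnorm_triangle[of "T i" E "T j"] err[OF J(2)] R unfolding i_def[symmetric]
      by (simp add: opnorm_minus_commute[of "T i"])
  qed
qed

definition scale_grid :: "real \<Rightarrow> real \<Rightarrow> int set" where
  "scale_grid s0 s1 = {j. s0 \<le> 2 powr (real_of_int j) * s0 \<and> 2 powr (real_of_int j) * s0 < 2 * s1}"

lemma scale_grid_card:
  assumes "0 < s0" "s0 \<le> s1"
  shows "finite (scale_grid s0 s1)" "real (card (scale_grid s0 s1)) \<le> 2 + log 2 (s1 / s0)"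
proof -
  define L where "L = log 2 (s1 / s0)"
  have L: "0 \<le> L" using assms by (simp add: L_def)
  have sub: "scale_grid s0 s1 \<subseteq> {0..\<lceil>L\<rceil>}"
  proof
    fix j assume "j \<in> scale_grid s0 s1"
    then have 1: "1 \<le> 2 powr (real_of_int j)" and 2: "2 powr (real_of_int j) < 2 * (s1 / s0)"
      using assms by (auto simp: scale_grid_def field_simps)
    have "0 \<le> real_of_int j" using 1 powr_le_cancel_iff[of 2 0 "real_of_int j"] by simp
    \<comment> \<open>Strictness at the upper end of the grid matters: \<open>j < 1 + L\<close>
      gives at most \<open>\<lceil>L\<rceil> + 1\<close> indices, hence at most
      \<open>2 + L\<close>.\<close>
    moreover have "real_of_int j < log 2 (2 * (s1 / s0))" using 2 assms by (simp add: less_log_iff)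
    then have "real_of_int j < 1 + L" using assms log_mult[of 2 2 "s1 / s0"] by (simp add: L_def)
    then have "j \<le> \<lceil>L\<rceil>" by linarith
    ultimately show "j \<in> {0..\<lceil>L\<rceil>}" by simp
  qed
  then show "finite (scale_grid s0 s1)" using finite_subset by blast
  have "card (scale_grid s0 s1) \<le> card {0..\<lceil>L\<rceil>}" using sub by (intro card_mono) auto
  also have "\<dots> = nat (\<lceil>L\<rceil> + 1)" by simp
  finally have "real (card (scale_grid s0 s1)) \<le> real (nat (\<lceil>L\<rceil> + 1))" by simp
  also have "\<dots> \<le> 2 + L" using L by linarith
  finally show "real (card (scale_grid s0 s1)) \<le> 2 + log 2 (s1 / s0)" by (simp add: L_def)
qed

text \<open>The factor \<open>13/10\<close> puts \<open>\<tau> / \<sigma>\<^sub>j\<close> into \<open>[0.65, 1.3]\<close>, where both Lepski inequalities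
  leave room for deviations of probability \<open>exp (- 3 t / 2)\<close> instead of \<open>exp (- t)\<close>, for every
  \<open>c\<^sup>2 = n / (2 m)\<close> that an unequal split of the sample can produce.\<close>
lemma scale_grid_oracle:
  fixes s0 s1 \<tau> c u :: real
  assumes s: "0 < s0" "s0 \<le> \<tau>" "\<tau> \<le> s1" and c: "0 < c" "3 / 4 \<le> c\<^sup>2" "c\<^sup>2 \<le> 3 / 2" and u: "0 \<le> u"
  defines "\<sigma> \<equiv> \<lambda>j::int. 2 powr (real_of_int j) * s0"
  defines "e \<equiv> \<lambda>j. \<sigma> j * u * (3 * c\<^sup>2 / 2 + (\<tau> / \<sigma> j)\<^sup>2) / 2"
  obtains j where "j \<in> scale_grid s0 s1"
    "\<And>k. j < k \<Longrightarrow> e j + e k \<le> 2 * \<sigma> k * (u * c)"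
    "2 * \<sigma> j * (u * c) + e j \<le> 6 * \<tau> * u"
proof -
  have \<tau>: "0 < \<tau>" using s by linarith
  \<comment> \<open>The next two facts are rational enclosures of sqrt (3 / 4) and sqrt (3 / 2), the
    extreme values of \<open>c\<close>.\<close>
  have c1: "13 / 15 \<le> c + 1/1000"
  proof (rule ccontr)
    assume "\<not> ?thesis"
    then have "c < 866/1000" by simp
    then have "c * c < (866/1000) * (866/1000)" using c by (intro mult_strict_mono) auto
    then show False using c by (simp add: power2_eq_square)
  qed
  have c2: "c \<le> 1225/1000"
  proof (rule ccontr)
    assume "\<not> ?thesis"
    then have "(1225/1000) * (1225/1000) < c * c" by (intro mult_strict_mono) auto
    then show False using c by (simp add: power2_eq_square)
  qed
  \<comment> \<open>Minimality of \<open>N\<close> gives the lower bound 0.65 on \<tau> /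
    \<sigma>_j, half of the upper bound 1.3. For \<open>N = 0\<close> that bound comes from
    \<open>s0 \<le> \<tau>\<close> instead. It also keeps the index below the upper end of the
    grid.\<close>
  define N where "N = (LEAST n :: nat. \<tau> \<le> 13 / 10 * (2 ^ n * s0))"
  have "\<exists>n :: nat. \<tau> \<le> 13 / 10 * (2 ^ n * s0)"
  proof -
    obtain n where "\<tau> / s0 < 2 ^ n" using real_arch_pow[of 2 "\<tau> / s0"] by auto
    then have "\<tau> \<le> 2 ^ n * s0" using s by (simp add: field_simps)
    then show ?thesis using s \<tau> by (intro exI[of _ n]) linarith
  qed
  then have N1: "\<tau> \<le> 13 / 10 * (2 ^ N * s0)" unfolding N_def by (rule LeastI_ex)
  have N2: "13 / 20 * (2 ^ N * s0) \<le> \<tau> \<and> 2 ^ N * s0 < 2 * s1"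
  proof (cases N)
    case 0
    then show ?thesis using s by simp
  next
    case (Suc n)
    then have "n < N" by simp
    then have "\<not> \<tau> \<le> 13 / 10 * (2 ^ n * s0)" unfolding N_def by (rule not_less_Least)
    moreover have "(2::real) ^ N * s0 = 2 * (2 ^ n * s0)" by (simp add: Suc)
    ultimately show ?thesis using s \<tau> by linarith
  qed
  define j where "j = int N"
  have \<sigma>j: "\<sigma> j = 2 ^ N * s0" by (simp add: \<sigma>_def j_def powr_realpow)
  then have \<sigma>j0: "0 < \<sigma> j" using s by simp
  define b where "b = \<tau> / \<sigma> j"
  have b: "13 / 20 \<le> b" "b \<le> 13 / 10"
    using N1 N2 \<sigma>j0 unfolding \<sigma>j[symmetric] b_def by (simp_all add: field_simps)
  have \<tau>b: "\<tau> = b * \<sigma> j" using \<sigma>j0 by (simp add: b_def)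
  show thesis
  proof
    have "(1::real) \<le> 2 ^ N" by simp
    then have "s0 \<le> 2 ^ N * s0" using s by simp
    then show "j \<in> scale_grid s0 s1" using N2 by (simp add: scale_grid_def j_def powr_realpow)
  next
    fix k assume k: "j < k"
    have \<sigma>k: "2 * \<sigma> j \<le> \<sigma> k"
    proof -
      have "2 powr (1 + real_of_int j) \<le> 2 powr (real_of_int k)" using k by (intro powr_mono) auto
      then show ?thesis using s by (simp add: \<sigma>_def powr_add)
    qed
    define x where "x = \<sigma> j / \<sigma> k"
    have \<sigma>k0: "0 < \<sigma> k" using \<sigma>k \<sigma>j0 by linarith
    have x: "0 < x" "x \<le> 1 / 2" "\<sigma> j = x * \<sigma> k" using \<sigma>k \<sigma>j0 \<sigma>k0 by (simp_all add: x_def field_simps)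
    have bb: "b\<^sup>2 \<le> 169 / 100" using power_mono[OF b(2), of 2] b by (simp add: power2_eq_square)
    \<comment> \<open>The worst case \<open>x = 1 / 2\<close>, \<open>b = 13 / 10\<close> of the
      threshold inequality. A parabola lies below its chord between the two enclosures of
      \<open>c\<close>, which makes the inequality linear.\<close>
    have cc: "9 / 8 * c\<^sup>2 + 3 / 8 * (169 / 100) \<le> 2 * c"
    proof -
      have "0 \<le> (c - 865/1000) * (1225/1000 - c)" using c1 c2 by (intro mult_nonneg_nonneg) auto
      moreover have "(c - 865/1000) * (1225/1000 - c) = 2090/1000 * c - 1059625/1000000 - c\<^sup>2"
        by (simp add: power2_eq_square field_simps)
      ultimately have "c\<^sup>2 \<le> 2090/1000 * c - 1059625/1000000" by linarith
      then show ?thesis using c2 by linarith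
    qed
    have "x * (3 * c\<^sup>2 / 2 + b\<^sup>2) / 2 + (3 * c\<^sup>2 / 2 + (b * x)\<^sup>2) / 2 \<le> 2 * c"
    proof -
      have "x * (3 * c\<^sup>2 / 2 + b\<^sup>2) \<le> 1 / 2 * (3 * c\<^sup>2 / 2 + b\<^sup>2)"
        using x by (intro mult_right_mono) auto
      moreover have "(b * x)\<^sup>2 \<le> (b * (1 / 2))\<^sup>2"
        using x b by (intro power_mono mult_left_mono) auto
      then have "(b * x)\<^sup>2 \<le> b\<^sup>2 / 4" by (simp add: power_mult_distrib power2_eq_square)
      moreover have "y / 2 + (3 * c\<^sup>2 / 2 + z) / 2 \<le> 2 * c"
        if "y \<le> 1 / 2 * (3 * c\<^sup>2 / 2 + b\<^sup>2)" "z \<le> b\<^sup>2 / 4" for y z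
        using that bb cc by (simp add: field_simps)
      ultimately show ?thesis by blast
    qed
    then have "(u * \<sigma> k) * (x * (3 * c\<^sup>2 / 2 + b\<^sup>2) / 2 + (3 * c\<^sup>2 / 2 + (b * x)\<^sup>2) / 2) \<le> (u * \<sigma> k) * (2 * c)"
      using u \<sigma>k0 by (intro mult_left_mono) auto
    moreover have "\<tau> / \<sigma> k = b * x" by (simp add: \<tau>b x_def)
    ultimately show "e j + e k \<le> 2 * \<sigma> k * (u * c)"
      unfolding e_def b_def[symmetric] by (simp add: x(3) algebra_simps)
  next
    \<comment> \<open>Nearly tight at \<open>b = 13 / 20\<close> and the largest \<open>c\<close>,
      about 3.79 against 3.9; this end limits how small \<tau> / \<sigma>_j may be. The chord bound
      again linearises the square.\<close>
    have "2 * c + (3 * c\<^sup>2 / 2 + b\<^sup>2) / 2 \<le> 6 * b"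
    proof -
      have "0 \<le> (b - 13 / 20) * (13 / 10 - b)" using b by (intro mult_nonneg_nonneg) auto
      then have "b\<^sup>2 \<le> 39 / 20 * b - 169 / 200" by (simp add: power2_eq_square algebra_simps)
      then show ?thesis using b c2 c(3) by (simp add: field_simps)
    qed
    then have "(u * \<sigma> j) * (2 * c + (3 * c\<^sup>2 / 2 + b\<^sup>2) / 2) \<le> (u * \<sigma> j) * (6 * b)"
      using u \<sigma>j0 by (intro mult_left_mono) auto
    then show "2 * \<sigma> j * (u * c) + e j \<le> 6 * \<tau> * u"
      unfolding e_def b_def[symmetric] \<tau>b by (simp add: algebra_simps)
  qed
qed

section \<open>The two-stage estimator\<close>

text \<open>The estimator as a deterministic function of the sample vector \<open>v\<close>, so that
  it can be studied on product spaces.\<close>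

definition trunc_mean ::
  "(real \<Rightarrow> real) \<Rightarrow> real \<Rightarrow> nat set \<Rightarrow> complex^'n^'n \<Rightarrow> (nat \<Rightarrow> complex^'n^'n) \<Rightarrow> complex^'n^'n" where
  "trunc_mean \<psi> \<theta> I S v = (1 / (real (card I) * \<theta>)) *\<^sub>R (\<Sum>i\<in>I. mat_fun \<psi> (\<theta> *\<^sub>R (v i - S)))"

definition lepski_index :: "(int \<Rightarrow> complex^'n^'n) \<Rightarrow> int set \<Rightarrow> (int \<Rightarrow> real) \<Rightarrow> int" where
  "lepski_index T J h = Min {j \<in> J. \<forall>k\<in>J. k > j \<longrightarrow> opnorm (T k - T j) \<le> h k}"

text \<open>The set of admissible indices is a measurable map into the finite space
  \<open>Pow J\<close>, so its minimum is a measurable index; selecting from countably many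
  measurable maps by such an index is measurable.\<close>

lemma measurable_lepski_select:
  fixes T :: "int \<Rightarrow> 'a \<Rightarrow> complex^'n^'n"
  assumes J: "finite J" and T [measurable]: "\<And>j. T j \<in> borel_measurable N"
  shows "(\<lambda>x. T (lepski_index (\<lambda>j. T j x) J h) x) \<in> borel_measurable N"
proof (rule measurable_compose_countable[where f = T, OF T])
  define K where "K = (\<lambda>x. {j \<in> J. \<forall>k\<in>J. k > j \<longrightarrow> opnorm (T k x - T j x) \<le> h k})"
  have P [measurable]: "{x \<in> space N. j \<in> K x} \<in> sets N" for j
  proof (cases "j \<in> J")
    case True
    then have "{x \<in> space N. j \<in> K x} = {x \<in> space N. \<forall>k\<in>J. k > j \<longrightarrow> opnorm (T k x - T j x) \<le> h k}"
      by (auto simp: K_def)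
    also have "\<dots> \<in> sets N"
    proof (rule sets.sets_Collect_finite_All'[OF _ J])
      fix k
      have "(\<lambda>x. opnorm (T k x - T j x)) \<in> borel_measurable N"
        by (rule measurable_compose[OF borel_measurable_diff[OF T T] borel_measurable_opnorm])
      then have "{x \<in> space N. opnorm (T k x - T j x) \<le> h k} \<in> sets N" by measurable
      then show "{x \<in> space N. k > j \<longrightarrow> opnorm (T k x - T j x) \<le> h k} \<in> sets N"
        by (cases "k > j") auto
    next
      show "J \<noteq> {}" using True by blast
    qed
    finally show ?thesis .
  next
    case False
    then have "{x \<in> space N. j \<in> K x} = {}" by (auto simp: K_def)
    then show ?thesis by (metis sets.empty_sets)
  qed
  have "K \<in> measurable N (count_space (Pow J))"
    unfolding measurable_count_space_eq2[OF finite_Pow_iff[THEN iffD2, OF J]]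
  proof (intro conjI ballI)
    show "K \<in> space N \<rightarrow> Pow J" by (auto simp: K_def)
    fix A assume A: "A \<in> Pow J"
    have "K -` {A} \<inter> space N = {x \<in> space N. \<forall>j\<in>J. j \<in> K x \<longleftrightarrow> j \<in> A}"
      using A by (auto simp: K_def)
    also have "\<dots> \<in> sets N"
    proof (rule sets.sets_Collect_finite_All[OF _ J])
      show "{x \<in> space N. j \<in> K x \<longleftrightarrow> j \<in> A} \<in> sets N" for j
        using P[of j] sets.sets_Collect_neg[OF P[of j]] by (cases "j \<in> A") auto
    qed
    finally show "K -` {A} \<inter> space N \<in> sets N" .
  qed
  then have "(\<lambda>x. Min (K x)) \<in> measurable N (count_space UNIV)"
    by (rule measurable_compose) simp
  then show "(\<lambda>x. lepski_index (\<lambda>j. T j x) J h) \<in> measurable N (count_space UNIV)"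
    unfolding lepski_index_def K_def .
qed

lemma trunc_mean_restrict: "trunc_mean \<psi> \<theta> I S (restrict v I) = trunc_mean \<psi> \<theta> I S v"
  unfolding trunc_mean_def by (intro arg_cong[where f = "scaleR _"] sum.cong) auto

lemma hermitian_trunc_mean:
  "(\<And>i. i \<in> I \<Longrightarrow> hermitian (v i)) \<Longrightarrow> hermitian S \<Longrightarrow> hermitian (trunc_mean \<psi> \<theta> I S v)"
  unfolding trunc_mean_def
  by (intro hermitian_scaleR[of "sum _ _"] hermitian_sum hermitian_mat_fun hermitian_scaleR[of "_ - _"] hermitian_diff) auto

lemma measurable_trunc_mean:
  fixes f :: "'a \<Rightarrow> complex^'n^'n"
  assumes \<psi>: "\<psi> \<in> borel_measurable borel" and f: "f \<in> borel_measurable N"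
    and g: "\<And>i. i \<in> I \<Longrightarrow> (\<lambda>x. g x i) \<in> borel_measurable N"
  shows "(\<lambda>x. trunc_mean \<psi> \<theta> I (f x) (g x)) \<in> borel_measurable N"
  unfolding trunc_mean_def
  by (intro borel_measurable_scaleR borel_measurable_const borel_measurable_sum borel_measurable_mat_fun_comp
      borel_measurable_diff \<psi> f g)

text \<open>Covers both stages: the first with \<open>S = 0\<close> and the second-moment bound, the
  second with \<open>S\<close> a fixed value of the first estimate. By the last assumption
  \<open>u * c\<close> is sqrt (2 t / card I), the factor in the thresholds.\<close>

lemma (in prob_space) lepski_stage:
  fixes V :: "nat \<Rightarrow> 'a \<Rightarrow> complex^'n^'n" and Y0 :: "'a \<Rightarrow> complex^'n^'n"
  assumes I: "finite I" "I \<noteq> {}" and indep: "indep_vars (\<lambda>_. borel) V I"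
    and herm: "\<And>i \<omega>. i \<in> I \<Longrightarrow> \<omega> \<in> space M \<Longrightarrow> hermitian (V i \<omega>)"
    and ident: "\<And>i. i \<in> I \<Longrightarrow> distr M borel (V i) = distr M borel Y0"
    and Y0_herm: "\<And>\<omega>. \<omega> \<in> space M \<Longrightarrow> hermitian (Y0 \<omega>)"
    and Y0: "integrable M Y0" "integrable M (\<lambda>\<omega>. Y0 \<omega> ** Y0 \<omega>)"
    and S: "hermitian S"
    and \<psi>: "\<psi> \<in> borel_measurable borel" "\<And>x. exp (\<psi> x) \<le> 1 + x + x\<^sup>2 / 2" "\<And>x. exp (- \<psi> x) \<le> 1 - x + x\<^sup>2 / 2"
    and var: "\<And>v. inner v ((\<integral>\<omega>. (Y0 \<omega> - S) ** (Y0 \<omega> - S) \<partial>M) *v v) \<le> \<tau>\<^sup>2 * (norm v)\<^sup>2"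
    and s: "0 < s0" "s0 \<le> \<tau>" "\<tau> \<le> s1"
    and c: "0 < c" "3 / 4 \<le> c\<^sup>2" "c\<^sup>2 \<le> 3 / 2" and u: "0 < u" and t: "real (card I) * u\<^sup>2 * c\<^sup>2 = 2 * t"
  defines "\<sigma> \<equiv> \<lambda>j::int. 2 powr (real_of_int j) * s0"
  defines "T \<equiv> \<lambda>j \<omega>. trunc_mean \<psi> (u / \<sigma> j) I S (\<lambda>i. V i \<omega>)"
  shows "prob {\<omega> \<in> space M. \<not> opnorm (S + T (lepski_index (\<lambda>j. T j \<omega>) (scale_grid s0 s1) (\<lambda>k. 2 * \<sigma> k * (u * c))) \<omega>
      - (\<integral>\<omega>. Y0 \<omega> \<partial>M)) \<le> 6 * \<tau> * u}
    \<le> 2 * real CARD('n) * (2 + log 2 (s1 / s0)) * exp (- (3 / 2 * t))"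
proof -
  define EY where "EY = (\<integral>\<omega>. Y0 \<omega> \<partial>M)"
  \<comment> \<open>Solved from the deviation bound: at every grid point the variance term cancels
    and the exponent is - (3 / 4) card(I) u^2 c^2 = - 3 t / 2.\<close>
  define e where "e = (\<lambda>j. \<sigma> j * u * (3 * c\<^sup>2 / 2 + (\<tau> / \<sigma> j)\<^sup>2) / 2)"
  let ?J = "scale_grid s0 s1"
  have s01: "s0 \<le> s1" using s by linarith
  note J = scale_grid_card[OF s(1) s01]
  obtain j where j: "j \<in> ?J" "\<And>k. j < k \<Longrightarrow> e j + e k \<le> 2 * \<sigma> k * (u * c)" "2 * \<sigma> j * (u * c) + e j \<le> 6 * \<tau> * u"
    using scale_grid_oracle[OF s c less_imp_le[OF u]] unfolding e_def \<sigma>_def by blast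
  have \<sigma>: "0 < \<sigma> k" for k using s by (simp add: \<sigma>_def)
  define B where "B = (\<lambda>k. {\<omega> \<in> space M. \<not> opnorm (T k \<omega> - (EY - S)) \<le> e k})"
  have rv: "V i \<in> borel_measurable M" if "i \<in> I" for i using indep that by (auto simp: indep_vars_def)
  have Tm [measurable]: "T k \<in> borel_measurable M" for k
    unfolding T_def by (intro measurable_trunc_mean \<psi>(1) borel_measurable_const rv)
  have Bm: "B k \<in> events" for k
  proof -
    have "(\<lambda>\<omega>. opnorm (T k \<omega> - (EY - S))) \<in> borel_measurable M"
      by (rule measurable_compose[OF _ borel_measurable_opnorm]) simp
    then show ?thesis unfolding B_def by measurable
  qed
  have PB: "prob (B k) \<le> 2 * real CARD('n) * exp (- (3 / 2 * t))" for k
  proof -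
    have "prob (B k) \<le> 2 * real CARD('n) * exp (real (card I) * ((u / \<sigma> k)\<^sup>2 * \<tau>\<^sup>2 / 2) - real (card I) * (u / \<sigma> k) * e k)"
      unfolding B_def T_def trunc_mean_def EY_def
      by (rule opnorm_deviation[OF I indep herm ident Y0_herm Y0 S \<psi> var]) (use u \<sigma> in auto)
    also have "real (card I) * ((u / \<sigma> k)\<^sup>2 * \<tau>\<^sup>2 / 2) - real (card I) * (u / \<sigma> k) * e k
        = - (3 / 4 * (real (card I) * u\<^sup>2 * c\<^sup>2))"
    proof -
      have "real (card I) * (u / \<sigma> k) * e k = real (card I) * u\<^sup>2 * ((3 * c\<^sup>2 / 2 + (\<tau> / \<sigma> k)\<^sup>2) / 2)"
        using \<sigma>[of k] by (simp add: e_def power2_eq_square)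
      then show ?thesis by (simp add: power_divide field_simps)
    qed
    finally show ?thesis by (simp add: t)
  qed
  have "{\<omega> \<in> space M. \<not> opnorm (S + T (lepski_index (\<lambda>j. T j \<omega>) ?J (\<lambda>k. 2 * \<sigma> k * (u * c))) \<omega> - EY) \<le> 6 * \<tau> * u}
      \<subseteq> (\<Union>k\<in>?J. B k)"
  proof (rule subsetI, rule ccontr)
    fix \<omega>
    assume 1: "\<omega> \<in> {\<omega> \<in> space M. \<not> opnorm (S + T (lepski_index (\<lambda>j. T j \<omega>) ?J (\<lambda>k. 2 * \<sigma> k * (u * c))) \<omega> - EY) \<le> 6 * \<tau> * u}"
      and 2: "\<omega> \<notin> (\<Union>k\<in>?J. B k)"
    have "opnorm (T k \<omega> - (EY - S)) \<le> e k" if "k \<in> ?J" for k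
      using 1 2 that by (auto simp: B_def)
    then have "opnorm (T (lepski_index (\<lambda>j. T j \<omega>) ?J (\<lambda>k. 2 * \<sigma> k * (u * c))) \<omega> - (EY - S)) \<le> 6 * \<tau> * u"
      unfolding lepski_index_def
      using j u c \<sigma>[of j] by (intro Lepski_oracle[where e = e and j = j and T = "\<lambda>j. T j \<omega>"] J(1)) auto
    then show False using 1 by (simp add: algebra_simps)
  qed
  then have "prob {\<omega> \<in> space M. \<not> opnorm (S + T (lepski_index (\<lambda>j. T j \<omega>) ?J (\<lambda>k. 2 * \<sigma> k * (u * c))) \<omega> - EY) \<le> 6 * \<tau> * u}
      \<le> prob (\<Union>k\<in>?J. B k)"
    using Bm J(1) by (intro finite_measure_mono) auto
  also have "\<dots> \<le> (\<Sum>k\<in>?J. prob (B k))"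
    using Bm J(1) by (intro measure_UNION_le) auto
  also have "\<dots> \<le> real (card ?J) * (2 * real CARD('n) * exp (- (3 / 2 * t)))"
    using sum_mono[of ?J "\<lambda>k. prob (B k)" "\<lambda>k. 2 * real CARD('n) * exp (- (3 / 2 * t))"] PB by simp
  also have "\<dots> \<le> (2 + log 2 (s1 / s0)) * (2 * real CARD('n) * exp (- (3 / 2 * t)))"
    using J(2) by (intro mult_right_mono) auto
  also have "\<dots> = 2 * real CARD('n) * (2 + log 2 (s1 / s0)) * exp (- (3 / 2 * t))" by simp
  finally show ?thesis unfolding EY_def .
qed

text \<open>For n >= 2 the floor of n / 2 is at least n / 3, so each group has between one and two
  thirds of the sample. Both extremes occur at n = 3.\<close>

lemma split_ratio_bounds:
  fixes m n :: nat
  assumes "0 < m" "m < n" "n div 2 \<le> m" "n div 2 \<le> n - m"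
  shows "3 / 4 \<le> real n / (2 * real m)" "real n / (2 * real m) \<le> 3 / 2"
proof -
  have "3 * m \<le> 2 * n" "n \<le> 3 * m" using assms by linarith+
  then have "3 * real m \<le> 2 * real n" "real n \<le> 3 * real m" by linarith+
  then show "3 / 4 \<le> real n / (2 * real m)" "real n / (2 * real m) \<le> 3 / 2"
    using assms(1) by (simp_all add: field_simps)
qed

text \<open>The two grids together have up to 4 + L1 + L2 points, while the claim allows 2 + L1 +
  L2. A nontrivial claim forces exp (- t / 2) < 1 / 2, and half of the first number is at most the
  second.\<close>

lemma final_probability_bound:
  fixes t L1 L2 d :: real
  assumes "1 \<le> d" "0 \<le> L1" "0 \<le> L2" "0 < 1 - 2 * d * (2 + L1 + L2) * exp (- t)"
  shows "2 * d * (2 + L1) * exp (- (3 / 2 * t)) + 2 * d * (2 + L2) * exp (- (3 / 2 * t))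
    \<le> 2 * d * (2 + L1 + L2) * exp (- t)"
proof -
  have "4 * exp (- t) \<le> 2 * d * (2 + L1 + L2) * exp (- t)"
    using mult_mono[of 2 "2 * d" 2 "2 + L1 + L2"] assms by (intro mult_right_mono) auto
  then have "exp (- t) < 1 / 4" using assms(4) by linarith
  then have "(exp (- (t / 2)))\<^sup>2 < (1 / 2)\<^sup>2" by (simp add: power2_eq_square flip: exp_add)
  then have "exp (- (t / 2)) < 1 / 2" by (rule power2_less_imp_less) simp
  then have h: "exp (- (t / 2)) \<le> 1 / 2" by (rule less_imp_le)
  have "2 * d * (2 + L1) * exp (- (3 / 2 * t)) + 2 * d * (2 + L2) * exp (- (3 / 2 * t))
      = 2 * d * (4 + L1 + L2) * (exp (- t) * exp (- (t / 2)))"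
    by (simp add: algebra_simps flip: exp_add)
  also have "\<dots> \<le> 2 * d * (4 + L1 + L2) * (exp (- t) * (1 / 2))"
    using assms h by (intro mult_left_mono) auto
  also have "\<dots> = 2 * d * ((4 + L1 + L2) / 2) * exp (- t)" by simp
  also have "\<dots> \<le> 2 * d * (2 + L1 + L2) * exp (- t)"
    using assms by (intro mult_right_mono mult_left_mono) auto
  finally show ?thesis .
qed

text \<open>The probability bound is expressed by a measurable subset of the target event; the
  witness is the event that neither stage fails.\<close>

theorem theorem6p1:
  fixes M :: "'a measure"
    and Y :: "nat \<Rightarrow> 'a \<Rightarrow> complex^'d^'d"
    and Y0 :: "'a \<Rightarrow> complex^'d^'d"
    and \<psi> :: "real \<Rightarrow> real"
    and n m :: nat
    and t smin smax s0min s0max :: real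
  assumes M: "prob_space M"
    and psi_mono: "mono \<psi>"
    and psi_lb: "\<And>x. - ln (1 - x + x^2/2) \<le> \<psi> x"
    and psi_ub: "\<And>x. \<psi> x \<le> ln (1 + x + x^2/2)"
    and Y0_rv: "Y0 \<in> borel_measurable M"
    and Y0_herm: "\<And>\<omega>. \<omega> \<in> space M \<Longrightarrow> hermitian (Y0 \<omega>)"
    and Y0_sq: "\<And>i j. integrable M (\<lambda>\<omega>. (cmod (Y0 \<omega> $ i $ j))^2)"
    and Y_indep: "prob_space.indep_vars M (\<lambda>_. borel) Y {1..n}"
    and Y_ident: "\<And>i. i \<in> {1..n} \<Longrightarrow> distr M borel (Y i) = distr M borel Y0"
    and Y_herm: "\<And>i \<omega>. i \<in> {1..n} \<Longrightarrow> \<omega> \<in> space M \<Longrightarrow> hermitian (Y i \<omega>)"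
  defines "EY \<equiv> mat_expect M Y0"
  defines "\<sigma> \<equiv> sqrt (opnorm (mat_expect M (\<lambda>\<omega>. Y0 \<omega> ** Y0 \<omega>)))"
  defines "\<sigma>0 \<equiv> sqrt (opnorm (mat_expect M (\<lambda>\<omega>. (Y0 \<omega> - EY) ** (Y0 \<omega> - EY))))"
  assumes smin_pos: "0 < smin" and smin_le: "smin \<le> \<sigma>" and smax_ge: "\<sigma> \<le> smax"
    and s0min_pos: "0 < s0min" and s0min_le: "s0min \<le> \<sigma>0" and s0max_ge: "\<sigma>0 \<le> s0max"
    and t_pos: "0 < t"
    and m_pos: "0 < m" and m_lt: "m < n"
    and m_ge: "m \<ge> n div 2" and nm_ge: "n - m \<ge> n div 2"
  defines "sj \<equiv> (\<lambda>j::int. 2 powr (real_of_int j) * smin)"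
  defines "s0j \<equiv> (\<lambda>j::int. 2 powr (real_of_int j) * s0min)"
  defines "J1 \<equiv> {j::int. smin \<le> sj j \<and> sj j < 2 * smax}"
  defines "J2 \<equiv> {j::int. s0min \<le> s0j j \<and> s0j j < 2 * (s0max + 12 * smax * sqrt (t / real n))}"
  defines "\<theta> \<equiv> (\<lambda>j. sqrt (2 * t / (real n / 2)) * (1 / sj j))"
  defines "\<theta>0 \<equiv> (\<lambda>j. sqrt (2 * t / (real n / 2)) * (1 / s0j j))"
  defines "T1 \<equiv> (\<lambda>j S \<omega>. (1 / (real m * \<theta> j)) *\<^sub>R
              (\<Sum>i = 1..m. mat_fun \<psi> (\<theta> j *\<^sub>R (Y i \<omega> - S))))"
  defines "T2 \<equiv> (\<lambda>j S \<omega>. (1 / (real (n - m) * \<theta>0 j)) *\<^sub>R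
              (\<Sum>i = m+1..n. mat_fun \<psi> (\<theta>0 j *\<^sub>R (Y i \<omega> - S))))"
  defines "j1 \<equiv> (\<lambda>\<omega>. Min {j \<in> J1. \<forall>k \<in> J1. k > j \<longrightarrow>
              opnorm (T1 k 0 \<omega> - T1 j 0 \<omega>) \<le> 2 * sj k * sqrt (2 * t / real m)})"
  defines "T0 \<equiv> (\<lambda>\<omega>. T1 (j1 \<omega>) 0 \<omega>)"
  defines "j2 \<equiv> (\<lambda>\<omega>. Min {j \<in> J2. \<forall>k \<in> J2. k > j \<longrightarrow>
              opnorm (T2 k (T0 \<omega>) \<omega> - T2 j (T0 \<omega>) \<omega>) \<le> 2 * s0j k * sqrt (2 * t / real (n - m))})"
  defines "Tfin \<equiv> (\<lambda>\<omega>. T0 \<omega> + T2 (j2 \<omega>) (T0 \<omega>) \<omega>)"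
  shows "\<exists>A \<in> sets M. A \<subseteq> {\<omega> \<in> space M.
            opnorm (Tfin \<omega> - EY) \<le> 12 * (\<sigma>0 + 12 * \<sigma> * sqrt (t / real n)) * sqrt (t / real n)} \<and>
          measure M A \<ge> 1 - 2 * real CARD('d) * (2 + log 2 (smax / smin)
              + log 2 ((s0max + 12 * smax * sqrt (t / real n)) / s0min)) * exp (- t)"
proof -
  interpret prob_space M by (rule M)
  define d where "d = real CARD('d)"
  \<comment> \<open>\<open>u\<close> is the common numerator of all truncation levels, and
    \<open>u * c k\<close> equals sqrt (2 t / k), the threshold factor for a group of size
    \<open>k\<close>.\<close>
  define u where "u = sqrt (2 * t / (real n / 2))"
  define c where "c = (\<lambda>k::nat. sqrt (real n / (2 * real k)))"
  define s1max where "s1max = s0max + 12 * smax * sqrt (t / real n)"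
  define L1 where "L1 = log 2 (smax / smin)"
  define L2 where "L2 = log 2 (s1max / s0min)"
  define \<tau> where "\<tau> = \<sigma>0 + 12 * \<sigma> * sqrt (t / real n)"
  define R1 where "R1 = 12 * \<sigma> * sqrt (t / real n)"
  define R where "R = 12 * \<tau> * sqrt (t / real n)"
  have n: "0 < real n" and d1: "1 \<le> d" using m_lt by (auto simp: d_def Suc_leI)
  have u0: "0 < u" using t_pos n by (simp add: u_def)
  have u_sq: "u\<^sup>2 = 4 * t / real n" using t_pos n by (simp add: u_def)
  have u_eq: "u = 2 * sqrt (t / real n)"
  proof -
    have "2 * t / (real n / 2) = 2\<^sup>2 * (t / real n)" by simp
    then show ?thesis unfolding u_def by (simp only: real_sqrt_mult real_sqrt_abs abs_numeral)
  qed
  have \<sigma>s: "0 < \<sigma>" "0 < \<sigma>0" "0 < smax" "0 < s0max" using smin_pos smin_le smax_ge s0min_pos s0min_le s0max_ge by auto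
  have \<tau>: "s0min \<le> \<tau>" "\<tau> \<le> s1max"
  proof -
    have "0 \<le> 12 * \<sigma> * sqrt (t / real n)" using \<sigma>s t_pos n by simp
    then show "s0min \<le> \<tau>" using s0min_le by (simp add: \<tau>_def)
    have "12 * \<sigma> * sqrt (t / real n) \<le> 12 * smax * sqrt (t / real n)"
      using smax_ge t_pos n by (intro mult_right_mono) auto
    then show "\<tau> \<le> s1max" using s0max_ge by (simp add: \<tau>_def s1max_def)
  qed
  have L: "0 \<le> L1" "0 \<le> L2"
    using smin_pos smin_le smax_ge s0min_pos \<tau> by (simp_all add: L1_def L2_def)
  show ?thesis
  proof (cases "0 < 1 - 2 * d * (2 + L1 + L2) * exp (- t)")
    case False
    then show ?thesis
      by (intro bexI[of _ "{}"]) (auto simp: d_def L1_def L2_def s1max_def)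
  next
    case nontrivial: True

    \<comment> \<open>Scalar bounds, moments and variances\<close>
    have psi_m: "\<psi> \<in> borel_measurable borel" by (rule borel_measurable_mono[OF psi_mono])
    have psi_exp: "exp (\<psi> x) \<le> 1 + x + x\<^sup>2 / 2" "exp (- \<psi> x) \<le> 1 - x + x\<^sup>2 / 2" for x
    proof -
      \<comment> \<open>Completing the square shows that both arguments of the logarithm are
        positive, so that exponentiating undoes \<open>ln\<close>.\<close>
      have "1 + x + x\<^sup>2 / 2 = ((1 + x)\<^sup>2 + 1) / 2" "1 - x + x\<^sup>2 / 2 = ((1 - x)\<^sup>2 + 1) / 2"
        by (simp_all add: power2_eq_square field_simps)
      moreover have "0 < ((1 + x)\<^sup>2 + 1) / 2" "0 < ((1 - x)\<^sup>2 + 1) / 2"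
        by (simp_all add: add_nonneg_pos)
      ultimately have pos: "0 < 1 + x + x\<^sup>2 / 2" "0 < 1 - x + x\<^sup>2 / 2"
        by presburger+
      have "\<psi> x \<le> ln (1 + x + x\<^sup>2 / 2)" "- \<psi> x \<le> ln (1 - x + x\<^sup>2 / 2)"
        using psi_ub[of x] psi_lb[of x] by auto
      then show "exp (\<psi> x) \<le> 1 + x + x\<^sup>2 / 2" "exp (- \<psi> x) \<le> 1 - x + x\<^sup>2 / 2"
        using pos by (metis exp_le_cancel_iff exp_ln)+
    qed
    have Ysq: "integrable M (\<lambda>\<omega>. Y0 \<omega> $ i $ j * Y0 \<omega> $ k $ l)" for i j k l
    proof (rule Bochner_Integration.integrable_bound)
      show "integrable M (\<lambda>\<omega>. (cmod (Y0 \<omega> $ i $ j))\<^sup>2 + (cmod (Y0 \<omega> $ k $ l))\<^sup>2)"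
        using Y0_sq by simp
      show "(\<lambda>\<omega>. Y0 \<omega> $ i $ j * Y0 \<omega> $ k $ l) \<in> borel_measurable M"
        using borel_measurable_mat_nth[OF Y0_rv] by (intro borel_measurable_times)
      have "a * b \<le> a\<^sup>2 + b\<^sup>2" for a b :: real
        using sum_squares_bound[of a b] zero_le_power2[of a] zero_le_power2[of b] by linarith
      then show "AE \<omega> in M. norm (Y0 \<omega> $ i $ j * Y0 \<omega> $ k $ l)
          \<le> norm ((cmod (Y0 \<omega> $ i $ j))\<^sup>2 + (cmod (Y0 \<omega> $ k $ l))\<^sup>2)"
        by (intro AE_I2) (simp add: norm_mult)
    qed
    have Y2: "integrable M (\<lambda>\<omega>. Y0 \<omega> ** Y0 \<omega>)"
      by (intro integrable_matI) (simp add: matrix_matrix_mult_def Ysq)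
    have Y1: "integrable M Y0"
    proof (rule integrable_matI)
      show "integrable M (\<lambda>\<omega>. Y0 \<omega> $ i $ j)" for i j
        using square_integrable_imp_integrable[OF borel_measurable_mat_nth[OF Y0_rv] Ysq[of i j i j, folded power2_eq_square]]
        by simp
    qed
    have EY: "EY = (\<integral>\<omega>. Y0 \<omega> \<partial>M)" unfolding EY_def by (rule mat_expect_eq_integral[OF Y1])
    have EYh: "hermitian EY" unfolding EY by (rule hermitian_integral[OF Y1 Y0_herm])
    have sq_eq: "(y - S) ** (y - S) = y ** y - y ** S - S ** y + S ** S" for y S :: "complex^'d^'d"
      by (simp add: matrix_mult_linear)
    have sq_int: "integrable M (\<lambda>\<omega>. (Y0 \<omega> - S) ** (Y0 \<omega> - S))"
      and sq_E: "(\<integral>\<omega>. (Y0 \<omega> - S) ** (Y0 \<omega> - S) \<partial>M)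
        = (\<integral>\<omega>. Y0 \<omega> ** Y0 \<omega> \<partial>M) - EY ** S - S ** EY + S ** S" for S
      unfolding sq_eq EY
      using Y2 integrable_linear[OF linear_mult_right Y1, of S] integrable_linear[OF linear_mult_left Y1, of S]
      by (simp_all add: prob_space)
    have \<sigma>_sq: "\<sigma>\<^sup>2 = opnorm (\<integral>\<omega>. Y0 \<omega> ** Y0 \<omega> \<partial>M)"
      unfolding \<sigma>_def mat_expect_eq_integral[OF Y2] by (simp add: opnorm_nonneg)
    have \<sigma>0_sq: "\<sigma>0\<^sup>2 = opnorm (\<integral>\<omega>. (Y0 \<omega> - EY) ** (Y0 \<omega> - EY) \<partial>M)"
      unfolding \<sigma>0_def mat_expect_eq_integral[OF sq_int] by (simp add: opnorm_nonneg)
    have var1: "inner v ((\<integral>\<omega>. (Y0 \<omega> - 0) ** (Y0 \<omega> - 0) \<partial>M) *v v) \<le> \<sigma>\<^sup>2 * (norm v)\<^sup>2" for v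
      unfolding \<sigma>_sq using abs_inner_le_opnorm[of v "\<integral>\<omega>. Y0 \<omega> ** Y0 \<omega> \<partial>M"] by simp
    \<comment> \<open>Bias-variance decomposition: recentring at \<open>S\<close> adds the square of
      \<open>S - EY\<close>, and \<sigma>0^2 + R1^2 is at most (\<sigma>0 + R1)^2 =
      \<tau>^2.\<close>
    have var2: "inner v ((\<integral>\<omega>. (Y0 \<omega> - S) ** (Y0 \<omega> - S) \<partial>M) *v v) \<le> \<tau>\<^sup>2 * (norm v)\<^sup>2"
      if S: "hermitian S" "opnorm (S - EY) \<le> R1" for S v
    proof -
      have "(\<integral>\<omega>. (Y0 \<omega> - S) ** (Y0 \<omega> - S) \<partial>M)
          = (\<integral>\<omega>. (Y0 \<omega> - EY) ** (Y0 \<omega> - EY) \<partial>M) + (S - EY) ** (S - EY)"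
        unfolding sq_E by (simp add: matrix_mult_linear)
      moreover have "inner v (((S - EY) ** (S - EY)) *v v) = (norm ((S - EY) *v v))\<^sup>2"
        using inner_hermitian[OF hermitian_diff[OF S(1) EYh]]
        by (simp add: power2_norm_eq_inner flip: matrix_vector_mul_assoc)
      moreover have "(norm ((S - EY) *v v))\<^sup>2 \<le> (R1 * norm v)\<^sup>2"
        using norm_mat_vec_le_opnorm[of "S - EY" v] mult_right_mono[OF S(2), of "norm v"]
        by (intro power_mono) auto
      moreover have "inner v ((\<integral>\<omega>. (Y0 \<omega> - EY) ** (Y0 \<omega> - EY) \<partial>M) *v v) \<le> \<sigma>0\<^sup>2 * (norm v)\<^sup>2"
        unfolding \<sigma>0_sq using abs_inner_le_opnorm[of v] abs_le_D1 by blast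
      ultimately have "inner v ((\<integral>\<omega>. (Y0 \<omega> - S) ** (Y0 \<omega> - S) \<partial>M) *v v) \<le> (\<sigma>0\<^sup>2 + R1\<^sup>2) * (norm v)\<^sup>2"
        by (simp add: mat_vec_linear inner_add_right power_mult_distrib distrib_right)
      also have "\<dots> \<le> \<tau>\<^sup>2 * (norm v)\<^sup>2"
      proof (rule mult_right_mono)
        have "0 \<le> \<sigma>0 * R1" using \<sigma>s t_pos n by (simp add: R1_def)
        then show "\<sigma>0\<^sup>2 + R1\<^sup>2 \<le> \<tau>\<^sup>2"
          unfolding \<tau>_def R1_def[symmetric] power2_sum by (simp add: mult.commute)
      qed simp
      finally show ?thesis .
    qed
    have c: "0 < c k" "3 / 4 \<le> (c k)\<^sup>2" "(c k)\<^sup>2 \<le> 3 / 2" "real k * u\<^sup>2 * (c k)\<^sup>2 = 2 * t"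
      and uc: "sqrt (2 * t / real k) = u * c k" if "k = m \<or> k = n - m" for k
    proof -
      have "0 < k" "k < n" "n div 2 \<le> k" "n div 2 \<le> n - k"
        using that m_pos m_lt m_ge nm_ge by auto
      note k = this(1) split_ratio_bounds[OF this]
      show "0 < c k" "3 / 4 \<le> (c k)\<^sup>2" "(c k)\<^sup>2 \<le> 3 / 2" using n k by (simp_all add: c_def)
      show "real k * u\<^sup>2 * (c k)\<^sup>2 = 2 * t" using k n unfolding u_sq by (simp add: c_def)
      show "sqrt (2 * t / real k) = u * c k"
        unfolding u_def c_def real_sqrt_mult[symmetric] using n by simp
    qed

    \<comment> \<open>The estimators as functions of the two independent subsamples\<close>
    define I1 where "I1 = {1..m}"
    define I2 where "I2 = {m+1..n}"
    have I: "finite I1" "I1 \<noteq> {}" "finite I2" "I2 \<noteq> {}" "I1 \<inter> I2 = {}" "I1 \<subseteq> {1..n}" "I2 \<subseteq> {1..n}"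
      "card I1 = m" "card I2 = n - m"
      using m_pos m_lt by (auto simp: I1_def I2_def)
    define h1 where "h1 = (\<lambda>k. 2 * sj k * (u * c m))"
    define h2 where "h2 = (\<lambda>k. 2 * s0j k * (u * c (n - m)))"
    define E1 :: "(nat \<Rightarrow> complex^'d^'d) \<Rightarrow> complex^'d^'d"
      where "E1 = (\<lambda>v. trunc_mean \<psi> (u / sj (lepski_index (\<lambda>j. trunc_mean \<psi> (u / sj j) I1 0 v) J1 h1)) I1 0 v)"
    define E2 :: "complex^'d^'d \<Rightarrow> (nat \<Rightarrow> complex^'d^'d) \<Rightarrow> complex^'d^'d"
      where "E2 = (\<lambda>S v. trunc_mean \<psi> (u / s0j (lepski_index (\<lambda>j. trunc_mean \<psi> (u / s0j j) I2 S v) J2 h2)) I2 S v)"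
    define Yv where "Yv = (\<lambda>\<omega> i. Y i \<omega>)"
    have J1: "J1 = scale_grid smin smax" by (simp add: J1_def sj_def scale_grid_def)
    have J2: "J2 = scale_grid s0min s1max" by (simp add: J2_def s0j_def scale_grid_def s1max_def)
    have J1f: "finite J1" unfolding J1 using smin_pos smin_le smax_ge by (intro scale_grid_card) auto
    have J2f: "finite J2" unfolding J2 using s0min_pos \<tau> by (intro scale_grid_card) auto
    have T1: "T1 j 0 \<omega> = trunc_mean \<psi> (u / sj j) I1 0 (Yv \<omega>)" for j \<omega>
      by (simp add: T1_def trunc_mean_def \<theta>_def u_def I1_def Yv_def)
    have T2: "T2 j S \<omega> = trunc_mean \<psi> (u / s0j j) I2 S (Yv \<omega>)" for j S \<omega>
      using m_lt by (simp add: T2_def trunc_mean_def \<theta>0_def u_def I2_def Yv_def)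
    have T0: "T0 \<omega> = E1 (Yv \<omega>)" for \<omega>
      unfolding T0_def j1_def E1_def T1 lepski_index_def h1_def uc[OF disjI1[OF refl]] ..
    have Tfin: "Tfin \<omega> = T0 \<omega> + E2 (T0 \<omega>) (Yv \<omega>)" for \<omega>
      unfolding Tfin_def j2_def E2_def T2 lepski_index_def h2_def uc[OF disjI2[OF refl]] ..
    have E1m: "E1 \<in> borel_measurable (PiM I1 (\<lambda>_. borel))"
      unfolding E1_def
      by (intro measurable_lepski_select[where T = "\<lambda>j v. trunc_mean \<psi> (u / sj j) I1 0 v"] J1f
          measurable_trunc_mean psi_m borel_measurable_const measurable_component_singleton)
    have E2m: "(\<lambda>p. E2 (fst p) (snd p)) \<in> borel_measurable (borel \<Otimes>\<^sub>M PiM I2 (\<lambda>_. borel))"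
      unfolding E2_def
      by (intro measurable_lepski_select[where T = "\<lambda>j p. trunc_mean \<psi> (u / s0j j) I2 (fst p) (snd p)"] J2f
          measurable_trunc_mean psi_m measurable_fst
          measurable_compose[OF measurable_snd measurable_component_singleton])
    have E1r: "E1 (restrict v I1) = E1 v" for v by (simp add: E1_def trunc_mean_restrict)
    have E2r: "E2 S (restrict v I2) = E2 S v" for S v by (simp add: E2_def trunc_mean_restrict)
    define G2 where "G2 = (\<lambda>\<omega>. restrict (Yv \<omega>) I2)"
    define G1 where "G1 = (\<lambda>\<omega>. restrict (Yv \<omega>) I1)"
    have ind: "indep_var (PiM I1 (\<lambda>_. borel)) G1 (PiM I2 (\<lambda>_. borel)) G2"
      unfolding Yv_def G1_def G2_def by (rule indep_var_restrict[OF Y_indep I(5-7)])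
    have G1m: "G1 \<in> measurable M (PiM I1 (\<lambda>_. borel))" and G2m: "G2 \<in> measurable M (PiM I2 (\<lambda>_. borel))"
      using indep_var_rv1[OF ind] indep_var_rv2[OF ind] by auto
    have T0_G1: "T0 \<omega> = E1 (G1 \<omega>)" for \<omega> by (simp add: T0 G1_def E1r)
    have T0m [measurable]: "T0 \<in> borel_measurable M"
      unfolding T0_G1 by (rule measurable_compose[OF G1m E1m])
    have T0h: "hermitian (T0 \<omega>)" if "\<omega> \<in> space M" for \<omega>
      unfolding T0 E1_def Yv_def using Y_herm[OF _ that] I(6)
      by (intro hermitian_trunc_mean hermitian_zero) auto

    \<comment> \<open>Deviation of each stage and conditioning on the first\<close>
    have stage1: "prob {\<omega> \<in> space M. \<not> opnorm (T0 \<omega> - EY) \<le> R1} \<le> 2 * d * (2 + L1) * exp (- (3 / 2 * t))"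
    proof -
      have "prob {\<omega> \<in> space M. \<not> opnorm (0 + E1 (Yv \<omega>) - EY) \<le> 6 * \<sigma> * u} \<le> 2 * d * (2 + L1) * exp (- (3 / 2 * t))"
        unfolding E1_def Yv_def EY d_def L1_def h1_def J1 sj_def
        using c[of m]
        by (intro lepski_stage indep_vars_subset[OF Y_indep I(6)] Y_ident Y_herm Y0_herm Y1 Y2 hermitian_zero
            psi_m psi_exp var1 smin_pos smin_le smax_ge u0 I(1,2)) (use I(6,8) in auto)
      moreover have "6 * \<sigma> * u = R1" by (simp add: R1_def u_eq)
      ultimately show ?thesis by (simp add: T0)
    qed
    have stage2: "prob {\<omega> \<in> space M. \<not> opnorm (S + E2 S (Yv \<omega>) - EY) \<le> R} \<le> 2 * d * (2 + L2) * exp (- (3 / 2 * t))"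
      if S: "hermitian S" "opnorm (S - EY) \<le> R1" for S
    proof -
      have "prob {\<omega> \<in> space M. \<not> opnorm (S + E2 S (Yv \<omega>) - EY) \<le> 6 * \<tau> * u} \<le> 2 * d * (2 + L2) * exp (- (3 / 2 * t))"
        unfolding E2_def Yv_def EY d_def L2_def h2_def J2 s0j_def
        using c[of "n - m"]
        by (intro lepski_stage indep_vars_subset[OF Y_indep I(7)] Y_ident Y_herm Y0_herm Y1 Y2 S(1)
            psi_m psi_exp var2[OF S] s0min_pos \<tau> u0 I(3,4)) (use I(7,9) in auto)
      moreover have "6 * \<tau> * u = R" by (simp add: R_def u_eq)
      ultimately show ?thesis by simp
    qed
    \<comment> \<open>The first-stage outcomes for which \<open>stage2\<close> applies. Hermitian
      symmetry must be demanded explicitly, as points of the product space need not be Hermitian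
      samples; for actual samples it holds by \<open>T0h\<close>.\<close>
    define G where "G = {v \<in> space (PiM I1 (\<lambda>_. borel)). hermitian (E1 v) \<and> opnorm (E1 v - EY) \<le> R1}"
    define B where "B = {p \<in> space (PiM I1 (\<lambda>_. borel) \<Otimes>\<^sub>M PiM I2 (\<lambda>_. borel)).
      \<not> opnorm (E1 (fst p) + E2 (E1 (fst p)) (snd p) - EY) \<le> R}"
    have Gm: "G \<in> sets (PiM I1 (\<lambda>_. borel))"
    proof -
      have "(\<lambda>v. opnorm (E1 v - EY)) \<in> borel_measurable (PiM I1 (\<lambda>_. borel))"
        by (intro measurable_compose[OF _ borel_measurable_opnorm] borel_measurable_diff E1m borel_measurable_const)
      then have "{v \<in> space (PiM I1 (\<lambda>_. borel)). opnorm (E1 v - EY) \<le> R1} \<in> sets (PiM I1 (\<lambda>_. borel))"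
        by measurable
      moreover have "E1 -` {S. hermitian S} \<inter> space (PiM I1 (\<lambda>_. borel)) \<in> sets (PiM I1 (\<lambda>_. borel))"
        by (rule measurable_sets[OF E1m borel_closed[OF closed_hermitian]])
      moreover have "G = (E1 -` {S. hermitian S} \<inter> space (PiM I1 (\<lambda>_. borel)))
          \<inter> {v \<in> space (PiM I1 (\<lambda>_. borel)). opnorm (E1 v - EY) \<le> R1}" by (auto simp: G_def)
      ultimately show ?thesis by auto
    qed
    have Bm: "B \<in> sets (PiM I1 (\<lambda>_. borel) \<Otimes>\<^sub>M PiM I2 (\<lambda>_. borel))"
    proof -
      have E1f: "(\<lambda>p. E1 (fst p)) \<in> borel_measurable (PiM I1 (\<lambda>_. borel) \<Otimes>\<^sub>M PiM I2 (\<lambda>_. borel))"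
        by (rule measurable_compose[OF measurable_fst E1m])
      have "(\<lambda>p. E2 (E1 (fst p)) (snd p)) \<in> borel_measurable (PiM I1 (\<lambda>_. borel) \<Otimes>\<^sub>M PiM I2 (\<lambda>_. borel))"
        using measurable_compose[OF measurable_Pair[OF E1f measurable_snd] E2m] by simp
      then have "(\<lambda>p. opnorm (E1 (fst p) + E2 (E1 (fst p)) (snd p) - EY))
          \<in> borel_measurable (PiM I1 (\<lambda>_. borel) \<Otimes>\<^sub>M PiM I2 (\<lambda>_. borel))"
        by (intro measurable_compose[OF _ borel_measurable_opnorm] borel_measurable_diff borel_measurable_add
            E1f borel_measurable_const)
      then show ?thesis unfolding B_def by measurable
    qed
    have B_iff: "(v, G2 \<omega>) \<in> B \<longleftrightarrow> \<not> opnorm (E1 v + E2 (E1 v) (Yv \<omega>) - EY) \<le> R"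
      if "\<omega> \<in> space M" "v \<in> space (PiM I1 (\<lambda>_. borel))" for v \<omega>
      using measurable_space[OF G2m that(1)] that(2) by (auto simp: B_def space_pair_measure G2_def E2r)
    have cond: "prob {\<omega> \<in> space M. G1 \<omega> \<in> G \<and> (G1 \<omega>, G2 \<omega>) \<in> B} \<le> 2 * d * (2 + L2) * exp (- (3 / 2 * t))"
    proof (rule indep_var_prob_section_le[OF ind Bm Gm])
      fix v assume "v \<in> G"
      then show "prob {\<omega> \<in> space M. (v, G2 \<omega>) \<in> B} \<le> 2 * d * (2 + L2) * exp (- (3 / 2 * t))"
        using stage2[of "E1 v"] by (simp add: G_def B_iff cong: conj_cong)
    qed (use d1 L in auto)
    \<comment> \<open>Failure is split into a bad first estimate and a bad final estimate after a
      good first one; only the second part needs the product structure.\<close>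
    define F1 where "F1 = {\<omega> \<in> space M. \<not> opnorm (T0 \<omega> - EY) \<le> R1}"
    define F2 where "F2 = {\<omega> \<in> space M. G1 \<omega> \<in> G \<and> (G1 \<omega>, G2 \<omega>) \<in> B}"
    have F1m: "F1 \<in> events"
    proof -
      have "(\<lambda>\<omega>. opnorm (T0 \<omega> - EY)) \<in> borel_measurable M"
        by (rule measurable_compose[OF _ borel_measurable_opnorm]) simp
      then show ?thesis unfolding F1_def by measurable
    qed
    have F2m: "F2 \<in> events"
    proof -
      have "F2 = (G1 -` G \<inter> space M) \<inter> ((\<lambda>\<omega>. (G1 \<omega>, G2 \<omega>)) -` B \<inter> space M)" by (auto simp: F2_def)
      also have "\<dots> \<in> events"
        by (intro sets.Int measurable_sets[OF G1m Gm] measurable_sets[OF measurable_Pair[OF G1m G2m] Bm])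
      finally show ?thesis .
    qed
    define A where "A = space M - (F1 \<union> F2)"
    have "A \<in> events" unfolding A_def using F1m F2m by auto
    moreover have "A \<subseteq> {\<omega> \<in> space M. opnorm (Tfin \<omega> - EY) \<le> R}"
      using T0h measurable_space[OF G1m] by (auto simp: A_def F1_def F2_def G_def B_iff Tfin T0_G1)
    moreover have "1 - 2 * d * (2 + L1 + L2) * exp (- t) \<le> prob A"
    proof -
      have "prob A = 1 - prob (F1 \<union> F2)" unfolding A_def using F1m F2m by (intro prob_compl) auto
      moreover have "prob (F1 \<union> F2) \<le> prob F1 + prob F2" using F1m F2m by (rule measure_Un_le)
      ultimately show ?thesis
        using stage1 cond final_probability_bound[OF d1 L nontrivial] unfolding F1_def F2_def by linarith
    qed
    ultimately show ?thesis
      unfolding R_def \<tau>_def d_def L1_def L2_def s1max_def by blast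
  qed
qed

end
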